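(* Let $p$ be a prime with $p\equiv 1\pmod 3$. Suppose there is a minimal $t\in\mathbb{N}$ such that the equation $p^t=X^2+27Y^2$ has an integral solution $(x,y)$ with $(x,p)=1$. Then, for every $\ell\ge 1$ and $0\le s<t$, the number $\mathcal{K}_3(\Gamma(3,p^{t\ell+s}))$ is determined by the numbers $\mathcal{K}_3(\Gamma(3,p^{t}))$ and $\mathcal{K}_3(\Gamma(3,p^{s}))$.
   Context: The generalized Paley graph $\Gamma(k,q)$ is the Cayley graph $\mathrm{Cay}(\mathbb{F}_q,\{x^k: x\in\mathbb{F}_q^*\})$: vertex set $\mathbb{F}_q$, with $v,w$ adjacent iff $w-v$ is a nonzero $k$-th power. For a graph $H$, $\mathcal{K}_{3}(H)$ denotes the number of triangles (cliques with $3$ vertices) of $H$. "Determined by" means that $\mathcal{K}_3(\Gamma(3,p^{t\ell+s}))$ can be computed from the two given numbers (together with $p,t,s,\ell$). *)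

theory Defs
  imports
    "HOL-Algebra.Ring"
    "HOL-Number_Theory.Cong"
    "HOL-Computational_Algebra.Polynomial"
    "Graph_Theory.Graph_Theory"
begin

definition cayley_graph :: "('a, 'm) ring_scheme \<Rightarrow> 'a set \<Rightarrow> 'a pair_pre_digraph" where
  "cayley_graph R S =
     \<lparr> pverts = carrier R,
       parcs = {(v, w). v \<in> carrier R \<and> w \<in> carrier R \<and> w \<ominus>\<^bsub>R\<^esub> v \<in> S} \<rparr>"

definition gen_paley_graph :: "nat \<Rightarrow> ('a, 'm) ring_scheme \<Rightarrow> 'a pair_pre_digraph" where
  "gen_paley_graph k R =
     cayley_graph R {x [^]\<^bsub>R\<^esub> k | x. x \<in> carrier R - {\<zero>\<^bsub>R\<^esub>}}"

text \<open>
  Undirected graphs are symmetric digraphs here, so \<^const>\<open>complete_digraph\<close> asks for arcs in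
  both directions between any two distinct vertices. Cliques are counted as vertex sets.
\<close>

definition num_cliques :: "nat \<Rightarrow> 'a pair_pre_digraph \<Rightarrow> nat" where
  "num_cliques n G =
     card {S. S \<subseteq> pverts G \<and> complete_digraph n (induce_subgraph (with_proj G) S)}"

text \<open>
  \<open>R\<close> is a model of \<open>F_q\<close>. For \<open>q = 1\<close> (which occurs as \<open>q = p ^ 0\<close>) there is no field, and
  the convention is that \<open>R\<close> is the zero ring; its generalized Paley graph is a single vertex
  without arcs.
\<close>

definition is_GF :: "nat \<Rightarrow> ('a, 'm) ring_scheme \<Rightarrow> bool" where
  "is_GF q R \<longleftrightarrow> cring R \<and> card (carrier R) = q \<and> (q \<noteq> 1 \<longrightarrow> field R)"

definition has_coprime_rep :: "nat \<Rightarrow> nat \<Rightarrow> bool" where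
  "has_coprime_rep p t \<longleftrightarrow>
     (\<exists>x y :: int. int p ^ t = x\<^sup>2 + 27 * y\<^sup>2 \<and> coprime x (int p))"

text \<open>
  The exponent ranges over the positive integers: \<open>t = 0\<close> always has the solution \<open>(1, 0)\<close>.
\<close>

definition minimal_rep_exponent :: "nat \<Rightarrow> nat \<Rightarrow> bool" where
  "minimal_rep_exponent p t \<longleftrightarrow>
     t \<ge> 1 \<and> has_coprime_rep p t \<and> (\<forall>t'. 1 \<le> t' \<and> t' < t \<longrightarrow> \<not> has_coprime_rep p t')"

text \<open>
  Nested polynomials represent integer polynomials in three variables. The inner two variables
  are evaluated last: \<open>Q = [: [: [:0, 1:] :] :]\<close> gives \<open>z\<close>, \<open>Q = [: [:0, 1:] :]\<close> gives \<open>y\<close> and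
  \<open>Q = [:0, 1:]\<close> gives \<open>x\<close>.
\<close>

definition eval3 :: "int poly poly poly \<Rightarrow> int \<Rightarrow> int \<Rightarrow> int \<Rightarrow> int" where
  "eval3 Q x y z = poly (poly (poly Q [:[:x:]:]) [:y:]) z"

text \<open>
  Pitfall: ``\<open>v\<close> is determined by \<open>a\<close>, \<open>b\<close> and \<open>p, t, s, l\<close>'' says nothing if it only asks
  for some function \<open>f\<close> with \<open>v = f p t s l a b\<close>, since \<open>K_3\<close> of the graph with
  \<open>p ^ (t * l + s)\<close> vertices already is a function of \<open>p, t, s, l\<close>. ``Computed from'' is
  therefore read as: there is a rational expression in \<open>p, a, b\<close> that depends on \<open>t, s, l\<close> only,
  hence is the same for all primes \<open>p\<close>. The quantifier over \<open>N\<close> and \<open>D\<close> must stand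
  outside the one over \<open>p\<close>.

  The denominator is required not to vanish, so division by zero gives no extra cases.
\<close>

definition given_by_rational_expr ::
    "int poly poly poly \<Rightarrow> int poly poly poly \<Rightarrow> nat \<Rightarrow> nat \<Rightarrow> nat \<Rightarrow> nat \<Rightarrow> bool" where
  "given_by_rational_expr N D x y z v \<longleftrightarrow>
     eval3 D (int x) (int y) (int z) \<noteq> 0 \<and>
     real v = real_of_int (eval3 N (int x) (int y) (int z))
                / real_of_int (eval3 D (int x) (int y) (int z))"

end

theory Submission
  imports
    "HOL-Algebra.Finite_Extensions"
    "HOL-Algebra.Multiplicative_Group"
    "HOL-Number_Theory.Residues"
    Defs
begin

text \<open>
  Let \<open>q = p\<^sup>m\<close> with \<open>p \<equiv> 1 (mod 3)\<close>. Scaling a triangle of \<open>\<Gamma>(3, q)\<close> shows that their number is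
  \<open>q (q - 1) N / 18\<close>, where \<open>N\<close> counts the \<open>x\<close> such that \<open>x\<close> and \<open>x + 1\<close> are nonzero cubes, and
  orthogonality of characters gives \<open>9 N = q - 8 + 2 Re J\<^sub>m\<close> for a cubic Jacobi sum \<open>J\<^sub>m\<close>. The
  Hasse--Davenport relation \<open>J\<^sub>m = - (- J\<^sub>1)\<^sup>m\<close> comes from the multiplicative function
  \<open>f \<mapsto> \<chi>(f(0)) \<chi>(f(1))\<close> on monic polynomials over \<open>F\<^sub>p\<close>: its sum over the monic polynomials of
  degree \<open>n\<close> vanishes for \<open>n \<ge> 2\<close>, so its Euler product is linear. Hence \<open>K\<^sub>3(\<Gamma>(3, p\<^sup>m))\<close> is
  equivalent to the trace \<open>T\<^sub>m = \<alpha>\<^sup>m + \<beta>\<^sup>m\<close>, where \<open>\<alpha> \<beta> = p\<close>.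

  A relation \<open>4 p = c\<^sup>2 + 27 d\<^sup>2\<close> forces \<open>t \<le> 3\<close>. For \<open>s = 0\<close> the trace \<open>T\<^bsub>tl\<^esub>\<close> is a polynomial in
  \<open>T\<^sub>t\<close> and \<open>p\<close>; for \<open>s = 1\<close> one knows \<open>T\<^sub>1\<close>; and for \<open>s = 2\<close>, \<open>t = 3\<close> one has
  \<open>T\<^sub>1 = T\<^sub>3 / (T\<^sub>2 - p)\<close>, whose denominator \<open>T\<^sub>1\<^sup>2 - 3 p\<close> does not vanish.
\<close>

section \<open>Frobenius and the prime field\<close>

no_notation vwalk_join (infixr \<open>\<oplus>\<close> 65)

text \<open>The fields \<open>Ft\<close>, \<open>Fs\<close> and \<open>F\<close> are unrelated
  models, so all traces are referred to one integer T_1 that is computed modulo p. A cubic character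
  depends on a choice of primitive cube root of unity; the other choice conjugates the Jacobi sum,
  and the trace does not see it. Inside each model the prime field is kept as a subset
  \<open>K\<close>, so that polynomials over \<open>K\<close> can be evaluated at elements of R. The
  minimal polynomial of x, evaluated at 0 and 1 and raised to the power m / deg, yields the norms of
  -x and 1 - x; this is how the Euler product over F_p becomes a Jacobi sum over R. Here alpha =
  -J_1 and beta is its conjugate, so T_n is a Lucas sequence with parameters T_1 and p. The factor
  27 arises because an element of Z[omega] of norm prime to 3 has an associate whose trace form
  gives 4 p = c^2 + 27 d^2; if c and d are odd, cubing clears the denominator 2. Uniformity in p is
  reached by working with rational functions on the set of all admissible data rather than with one
  prime at a time.\<close>

lemma (in cring) binomial_pow:
  assumes x: "x \<in> carrier R" and y: "y \<in> carrier R"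
  shows "(x \<oplus> y) [^] n = (\<Oplus>k\<in>{..n}. [(n choose k)] \<cdot> (x [^] k \<otimes> y [^] (n - k)))"
proof (induction n)
  case 0
  show ?case using x y by simp
next
  case (Suc n)
  define f where "f k = [(n choose k)] \<cdot> (x [^] k \<otimes> y [^] (Suc n - k))" for k
  \<comment> \<open>Multiplication by x shifts the index, so \<open>g k\<close> and
    \<open>f (Suc k)\<close> carry the same monomial and merge by Pascal's rule.\<close>
  define g where "g k = [(n choose k)] \<cdot> (x [^] Suc k \<otimes> y [^] (n - k))" for k
  have fc: "f \<in> UNIV \<rightarrow> carrier R" and gc: "g \<in> UNIV \<rightarrow> carrier R"
    using x y unfolding f_def g_def by auto
  have S: "(\<Oplus>k\<in>{..n}. [(n choose k)] \<cdot> (x [^] k \<otimes> y [^] (n - k))) \<in> carrier R"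
    using x y by (intro finsum_closed) auto
  have "(x \<oplus> y) [^] Suc n = (x \<oplus> y) [^] n \<otimes> x \<oplus> (x \<oplus> y) [^] n \<otimes> y"
    using x y by (simp add: r_distr)
  also have "(x \<oplus> y) [^] n \<otimes> x = (\<Oplus>k\<in>{..n}. g k)"
    unfolding Suc.IH using x y
    by (subst finsum_ldistr) (auto intro!: finsum_cong' simp: g_def add_pow_ldistr add_pow_rdistr m_ac)
  also have "(x \<oplus> y) [^] n \<otimes> y = (\<Oplus>k\<in>{..n}. f k)"
    unfolding Suc.IH using x y
    by (subst finsum_ldistr) (auto intro!: finsum_cong' simp: f_def add_pow_ldistr add_pow_rdistr m_ac Suc_diff_le)
  also have "(\<Oplus>k\<in>{..n}. f k) = (\<Oplus>k\<in>{..Suc n}. f k)"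
    using x y fc by (subst finsum_Suc) (auto simp: f_def binomial_eq_0)
  also have "(\<Oplus>k\<in>{..Suc n}. f k) = (\<Oplus>k\<in>{..n}. f (Suc k)) \<oplus> f 0"
    using fc by (intro finsum_Suc2) auto
  also have "(\<Oplus>k\<in>{..n}. g k) \<oplus> ((\<Oplus>k\<in>{..n}. f (Suc k)) \<oplus> f 0)
      = (\<Oplus>k\<in>{..n}. g k \<oplus> f (Suc k)) \<oplus> f 0"
    using fc gc by (subst finsum_addf) (auto simp: a_assoc Pi_def)
  also have "(\<Oplus>k\<in>{..n}. g k \<oplus> f (Suc k)) \<oplus> f 0
      = (\<Oplus>k\<in>{..Suc n}. [(Suc n choose k)] \<cdot> (x [^] k \<otimes> y [^] (Suc n - k)))"
    using x y 
    by (subst finsum_Suc2) (auto intro!: finsum_cong' simp: f_def g_def add.nat_pow_mult)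
  finally show ?case .
qed

text \<open>The prime divides every binomial coefficient strictly between the two ends, and
  multiples of p annihilate the ring.\<close>

lemma (in cring) freshmans_dream:
  assumes p: "Factorial_Ring.prime (p::nat)" and char: "[p] \<cdot> \<one> = \<zero>"
    and x: "x \<in> carrier R" and y: "y \<in> carrier R"
  shows "(x \<oplus> y) [^] p = x [^] p \<oplus> y [^] p"
proof -
  have z: "[n] \<cdot> z = \<zero>" if "p dvd n" "z \<in> carrier R" for n z
  proof -
    from that obtain j where j: "n = p * j" by auto
    have "[n] \<cdot> z = [j] \<cdot> (([p] \<cdot> \<one>) \<otimes> z)"
      using that by (simp add: j add.nat_pow_pow[symmetric] add_pow_ldistr del: add.nat_pow_pow)
    thus ?thesis using that by (simp add: char add.nat_pow_one)
  qed
  have p0: "p > 1" using p prime_gt_1_nat by blast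
  obtain r where r: "p = Suc r" using p0 by (cases p) auto
  have mid: "(\<Oplus>k\<in>{..r}. [(p choose k)] \<cdot> (x [^] k \<otimes> y [^] (p - k))) = y [^] p"
  proof -
    have "(\<Oplus>k\<in>{..r}. [(p choose k)] \<cdot> (x [^] k \<otimes> y [^] (p - k))) =
      (\<Oplus>k\<in>{..r}. if k = 0 then y [^] p else \<zero>)"
    proof (rule finsum_cong', goal_cases)
      case (3 k)
      show ?case
      proof (cases "k = 0")
        case False
        hence "p dvd (p choose k)" using 3 r p by (intro dvd_choose_prime) auto
        thus ?thesis using False x y z by simp
      qed (use x y in simp)
    qed (use y in auto)
    also have "\<dots> = y [^] p"
      using finsum_singleton[of 0 "{..r}" "\<lambda>_. y [^] p"] y by (simp add: eq_commute[of 0])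
    finally show ?thesis .
  qed
  have "(x \<oplus> y) [^] p = (\<Oplus>k\<in>{..Suc r}. [(p choose k)] \<cdot> (x [^] k \<otimes> y [^] (p - k)))"
    using binomial_pow[OF x y, of p] r by simp
  also have "\<dots> = x [^] p \<oplus> y [^] p"
    using x y mid by (subst finsum_Suc) (auto simp: r)
  finally show ?thesis .
qed

lemma (in cring) nat_mult_one: "[a] \<cdot> \<one> \<otimes> [b] \<cdot> \<one> = [(a * b :: nat)] \<cdot> \<one>"
proof -
  have "[a] \<cdot> \<one> \<otimes> [b] \<cdot> \<one> = [b] \<cdot> ([a] \<cdot> \<one>)"
    by (subst add_pow_rdistr) auto
  also have "\<dots> = [(a * b)] \<cdot> \<one>" by (rule add.nat_pow_pow) auto
  finally show ?thesis .
qed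

lemma (in cring) nat_pow_one_mult: "([a] \<cdot> \<one>) [^] (n::nat) = [(a ^ n :: nat)] \<cdot> \<one>"
proof (induction n)
  case (Suc n)
  have "([a] \<cdot> \<one>) [^] Suc n = [(a ^ n)] \<cdot> \<one> \<otimes> [a] \<cdot> \<one>" using Suc by simp
  thus ?case by (simp only: nat_mult_one power_Suc2)
qed simp

lemma (in domain) pow_eq_zero: "x [^] (n::nat) = \<zero> \<Longrightarrow> x \<in> carrier R \<Longrightarrow> x = \<zero>"
  by (induction n) (auto dest: integral)

section \<open>Finite fields with p^m elements and their prime field\<close>

locale GF = field R for R (structure) +
  fixes p m :: nat
  assumes prime_p: "Factorial_Ring.prime p" and card_R: "card (carrier R) = p ^ m"
begin

lemma p_gt_1: "p > 1"
  using prime_p prime_gt_1_nat by blast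

lemma finite_R [simp, intro]: "finite (carrier R)"
  using card_R p_gt_1 by (metis card.infinite not_one_less_zero power_eq_0_iff less_imp_not_less)

lemma m_pos: "m > 0"
proof (rule ccontr)
  assume "\<not> m > 0"
  hence "card (carrier R) = 1" using card_R by simp
  then obtain z where "carrier R = {z}" by (rule card_1_singletonE)
  thus False using zero_closed one_closed one_not_zero by auto
qed

text \<open>Lagrange in the additive group kills p^m times the unit, which is the m-th power of p
  times the unit; a domain has no nilpotents.\<close>

lemma char_p: "[p] \<cdot> \<one> = \<zero>"
proof -
  have "[(p ^ m)] \<cdot> \<one> = \<zero>"
    using add.pow_order_eq_1[OF one_closed] by (simp add: Coset.order_def card_R)
  hence "([p] \<cdot> \<one>) [^] m = \<zero>" by (simp add: nat_pow_one_mult)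
  thus ?thesis by (rule pow_eq_zero) simp
qed

lemma nat_mod_p: "[(n mod p)] \<cdot> \<one> = [n] \<cdot> \<one>"
proof -
  have "[n] \<cdot> \<one> = [(p * (n div p) + n mod p)] \<cdot> \<one>" by simp
  also have "\<dots> = ([p] \<cdot> \<one>) \<otimes> ([(n div p)] \<cdot> \<one>) \<oplus> [(n mod p)] \<cdot> \<one>"
    by (simp only: nat_mult_one add.nat_pow_mult one_closed)
  finally show ?thesis by (simp add: char_p)
qed

text \<open>An n prime to p has an inverse modulo p, so its image is a unit. The characteristic is
  thus exactly p, which gives \<open>K\<close> its p elements.\<close>

lemma nat_eq_zero_iff: "[n] \<cdot> \<one> = \<zero> \<longleftrightarrow> p dvd n"
proof
  assume n: "[n] \<cdot> \<one> = \<zero>"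
  show "p dvd n"
  proof (rule ccontr)
    assume "\<not> p dvd n"
    hence "coprime n p" using prime_p by (metis coprime_commute prime_imp_coprime_nat)
    then obtain k where k: "[n * k = Suc 0] (mod p)" using cong_solve_coprime_nat by auto
    have "[(n * k)] \<cdot> \<one> = \<one>"
      using k p_gt_1 by (subst nat_mod_p[symmetric]) (simp add: cong_def)
    thus False using n by (simp add: nat_mult_one[symmetric])
  qed
qed (use nat_mod_p[of n] in simp)

lemma nat_eq_iff: "[a] \<cdot> \<one> = [b] \<cdot> \<one> \<longleftrightarrow> a mod p = b mod p"
proof -
  have *: "a mod p = b mod p" if ab: "[a] \<cdot> \<one> = [b] \<cdot> \<one>" "a \<le> b" for a b
  proof -
    have "[a] \<cdot> \<one> \<oplus> [(b - a)] \<cdot> \<one> = [(a + (b - a))] \<cdot> \<one>"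
      by (rule add.nat_pow_mult) simp
    also have "a + (b - a) = b" using ab(2) by simp
    also have "[b] \<cdot> \<one> = [a] \<cdot> \<one> \<oplus> \<zero>" by (simp add: ab(1))
    finally have "[(b - a)] \<cdot> \<one> = \<zero>"
      using add.l_cancel[of "[a] \<cdot> \<one>" "[(b - a)] \<cdot> \<one>" \<zero>] by simp
    hence "p dvd b - a" by (rule nat_eq_zero_iff[THEN iffD1])
    hence "b mod p = a mod p" by (rule mod_eq_dvd_iff_nat[OF ab(2), THEN iffD2])
    thus ?thesis by (rule sym)
  qed
  show ?thesis
  proof
    show "a mod p = b mod p" if "[a] \<cdot> \<one> = [b] \<cdot> \<one>"
    proof (cases "a \<le> b")
      case False
      hence "b \<le> a" by simp
      from *[OF that[symmetric] this] show ?thesis by (rule sym)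
    qed (rule *[OF that])
    show "[a] \<cdot> \<one> = [b] \<cdot> \<one>" if "a mod p = b mod p"
      by (subst (1 2) nat_mod_p[symmetric]) (simp only: that)
  qed
qed

text \<open>The prime field F_p, realized inside R so that polynomials over it can be evaluated at
  elements of R.\<close>

definition K where "K = (\<lambda>n::nat. [n] \<cdot> \<one>) ` {..<p}"

lemma K_eq: "K = range (\<lambda>n::nat. [n] \<cdot> \<one>)"
proof -
  have "[n] \<cdot> \<one> \<in> K" for n :: nat
    unfolding K_def using p_gt_1 by (subst nat_mod_p[symmetric]) (rule imageI, simp)
  thus ?thesis by (auto simp: K_def)
qed

lemma card_K: "card K = p"
  unfolding K_def by (subst card_image) (auto simp: inj_on_def nat_eq_iff)

lemma finite_K [simp, intro]: "finite K"
  by (simp add: K_def)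

lemma K_carrier: "K \<subseteq> carrier R"
  by (auto simp: K_def)

lemma K_pow_p: "k \<in> K \<Longrightarrow> k [^] p = k"
proof -
  assume "k \<in> K"
  then obtain n :: nat where n: "k = [n] \<cdot> \<one>" by (auto simp: K_eq)
  have "[n ^ p = n] (mod p)"
  proof (cases "p dvd n")
    case True
    thus ?thesis using p_gt_1 by (auto simp: cong_def mod_eq_0_iff_dvd intro: dvd_trans[OF _ dvd_power])
  next
    case False
    hence "[n ^ (p - 1) = 1] (mod p)" using fermat_theorem prime_p by blast
    hence "[n ^ (p - 1) * n = 1 * n] (mod p)" by (rule cong_mult) simp
    moreover have "n ^ (p - 1) * n = n ^ p" using p_gt_1 by (intro power_minus_mult) simp
    ultimately show ?thesis by simp
  qed
  thus ?thesis unfolding n nat_pow_one_mult nat_eq_iff by (simp add: cong_def)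
qed

lemma K_subfield: "subfield K R"
proof (rule subfieldI')
  show "subring K R"
  proof (rule subringI)
    show "\<ominus> h \<in> K" if h: "h \<in> K" for h
    proof -
      obtain n :: nat where n: "h = [n] \<cdot> \<one>" using h unfolding K_eq by blast
      \<comment> \<open>Naturals have no negatives; n (p - 1) represents -n modulo p.\<close>
      have "h \<oplus> [(n * (p - 1))] \<cdot> \<one> = [(n * (p - 1) + n)] \<cdot> \<one>"
        by (simp add: n add.nat_pow_mult add.commute)
      also have "n * (p - 1) + n = n * p" using p_gt_1 by (simp add: algebra_simps)
      finally have "h \<oplus> [(n * (p - 1))] \<cdot> \<one> = \<zero>" using nat_eq_zero_iff by simp
      hence "\<ominus> h = [(n * (p - 1))] \<cdot> \<one>" using n by (intro minus_equality) (auto simp: a_comm)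
      thus ?thesis by (auto simp: K_eq)
    qed
    show "h1 \<otimes> h2 \<in> K" if "h1 \<in> K" "h2 \<in> K" for h1 h2
      using that unfolding K_eq by (auto simp: nat_mult_one)
    show "h1 \<oplus> h2 \<in> K" if "h1 \<in> K" "h2 \<in> K" for h1 h2
      using that unfolding K_eq by (auto simp: add.nat_pow_mult)
    show "\<one> \<in> K" unfolding K_eq by (rule range_eqI[of _ _ 1]) simp
  qed (rule K_carrier)
  show "inv k \<in> K" if k: "k \<in> K - {\<zero>}" for k
  proof -
    obtain n :: nat where n: "k = [n] \<cdot> \<one>" using k by (auto simp: K_eq)
    have kc: "k \<in> carrier R" "k \<noteq> \<zero>" using k K_carrier by auto
    \<comment> \<open>By Fermat k^p = k, so k^(p - 2) is the inverse, and it is visibly the image of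
      a natural number.\<close>
    have "k \<otimes> (k \<otimes> k [^] (p - 2)) = k [^] (Suc (Suc (p - 2)))"
      using kc by (simp add: m_ac)
    also have "Suc (Suc (p - 2)) = p" using p_gt_1 by simp
    also have "k [^] p = k \<otimes> \<one>" using K_pow_p[of k] k kc by simp
    finally have "k \<otimes> k [^] (p - 2) = \<one>" using kc m_lcancel[of k "k \<otimes> k [^] (p - 2)" \<one>] by simp
    hence "inv k = k [^] (p - 2)" using kc by (intro comm_inv_char) simp_all
    also have "\<dots> \<in> K" by (auto simp: n nat_pow_one_mult K_eq)
    finally show ?thesis .
  qed
qed

lemma K_subring: "subring K R"
  using K_subfield by (rule subfieldE(1))

lemma frob_add: "\<lbrakk>x \<in> carrier R; y \<in> carrier R\<rbrakk> \<Longrightarrow> (x \<oplus> y) [^] (p ^ i) = x [^] (p ^ i) \<oplus> y [^] (p ^ i)"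
proof (induction i)
  case (Suc i)
  have "(x \<oplus> y) [^] (p ^ Suc i) = ((x \<oplus> y) [^] (p ^ i)) [^] p"
    using Suc.prems by (simp add: nat_pow_pow mult.commute)
  also have "\<dots> = (x [^] (p ^ i)) [^] p \<oplus> (y [^] (p ^ i)) [^] p"
    using Suc by (simp add: freshmans_dream[OF prime_p char_p])
  finally show ?case using Suc.prems by (simp add: nat_pow_pow mult.commute)
qed auto

lemma pow_card: "x \<in> carrier R \<Longrightarrow> x [^] (p ^ m) = x"
proof -
  assume x: "x \<in> carrier R"
  show ?thesis
  proof (cases "x = \<zero>")
    case True
    thus ?thesis using p_gt_1 by (simp add: nat_pow_zero)
  next
    case False
    interpret G: group "Multiplicative_Group.mult_of R" by (rule field_mult_group)
    have "x [^] (p ^ m - 1) = \<one>"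
      using G.pow_order_eq_1[of x] x False order_mult_of[OF finite_R]
      by (simp add: Coset.order_def card_R mult_of_simps)
    hence "x [^] (p ^ m - 1) \<otimes> x = x" using x by simp
    thus ?thesis using p_gt_1 by (simp add: nat_pow_Suc[symmetric] del: nat_pow_Suc)
  qed
qed

text \<open>Nonzero fixed points of the d-th Frobenius power are roots of X^(p^d - 1) - 1, of which
  a field has at most p^d - 1. This caps degrees in \<open>degree_Irr_le\<close>.\<close>

lemma card_fixed: "d > 0 \<Longrightarrow> card {x \<in> carrier R. x [^] (p ^ d) = x} \<le> p ^ d"
proof -
  assume d: "d > 0"
  have pd: "p ^ d > 1" using d p_gt_1 by (metis one_less_power)
  let ?A = "{x \<in> carrier R. x [^] (p ^ d - 1) = \<one>}"
  have "{x \<in> carrier R. x [^] (p ^ d) = x} \<subseteq> insert \<zero> ?A"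
  proof (intro subsetI)
    fix x assume x: "x \<in> {x \<in> carrier R. x [^] (p ^ d) = x}"
    show "x \<in> insert \<zero> ?A"
    proof (cases "x = \<zero>")
      case False
      have xc: "x \<in> carrier R" and xp: "x [^] (p ^ d) = x" using x by auto
      have "x [^] Suc (p ^ d - 1) = x [^] (p ^ d - 1) \<otimes> x" by (rule nat_pow_Suc)
      moreover have "Suc (p ^ d - 1) = p ^ d" using pd by simp
      ultimately have "x [^] (p ^ d - 1) \<otimes> x = \<one> \<otimes> x"
        using xp xc by (simp only: l_one)
      hence "x [^] (p ^ d - 1) = \<one>" using m_rcancel False xc by blast
      thus ?thesis using xc by simp
    qed simp
  qed
  hence "card {x \<in> carrier R. x [^] (p ^ d) = x} \<le> card (insert \<zero> ?A)"
    by (rule card_mono[rotated]) auto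
  also have "\<dots> \<le> Suc (card ?A)" by (simp add: card_insert_if)
  also have "\<dots> \<le> Suc (p ^ d - 1)"
    using num_roots_le_deg[OF finite_R, of "p ^ d - 1"] pd by linarith
  also have "\<dots> = p ^ d" using pd by linarith
  finally show ?thesis .
qed

end

section \<open>Monic polynomials and unique factorization\<close>

context GF begin

interpretation UP: principal_domain "K[X]"
  by (rule univ_poly_is_principal[OF K_subfield])

definition monic :: "'a list \<Rightarrow> bool" where
  "monic f \<longleftrightarrow> f \<in> carrier (K[X]) \<and> f \<noteq> [] \<and> hd f = \<one>"

definition monics :: "nat \<Rightarrow> 'a list set" where
  "monics n = {f. monic f \<and> Polynomials.degree f = n}"

text \<open>The primes of the Euler product, one from each class of associates.\<close>

definition irr :: "'a list set" where
  "irr = {P. monic P \<and> pirreducible K P}"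

lemma monicD: "monic f \<Longrightarrow> f \<in> carrier (K[X])" "monic f \<Longrightarrow> f \<noteq> []" "monic f \<Longrightarrow> hd f = \<one>"
  by (auto simp: monic_def)

lemma monic_iff: "monic f \<longleftrightarrow> (\<exists>cs. f = \<one> # cs \<and> set cs \<subseteq> K)"
  using subringE(3)[OF K_subring]
  by (cases f) (auto simp: monic_def univ_poly_carrier[symmetric] polynomial_def)

lemma monic_set: "monic f \<Longrightarrow> set f \<subseteq> K"
  using subringE(3)[OF K_subring] by (auto simp: monic_iff)

lemma monic_set': "monic f \<Longrightarrow> set f \<subseteq> carrier R"
  using monic_set K_carrier by blast

lemma monics_eq: "monics n = (#) \<one> ` {cs. set cs \<subseteq> K \<and> length cs = n}"
  by (auto simp: monics_def monic_iff)

lemma finite_monics [simp, intro]: "finite (monics n)"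
  unfolding monics_eq by (intro finite_imageI finite_lists_length_eq finite_K)

lemma card_monics: "card (monics n) = p ^ n"
  unfolding monics_eq by (subst card_image) (auto simp: inj_on_def card_lists_length_eq card_K)

lemma monic_one: "monic [\<one>]"
  by (simp add: monic_iff)

lemma monics_0: "monics 0 = {[\<one>]}"
  by (auto simp: monics_eq)

lemma monic_mult:
  assumes "monic f" "monic g"
  shows "monic (f \<otimes>\<^bsub>K[X]\<^esub> g)"
    and "Polynomials.degree (f \<otimes>\<^bsub>K[X]\<^esub> g) = Polynomials.degree f + Polynomials.degree g"
proof -
  have fg: "polynomial K f" "polynomial K g" "f \<noteq> []" "g \<noteq> []"
    using assms by (auto simp: monic_def univ_poly_carrier)
  have fg': "f \<otimes>\<^bsub>K[X]\<^esub> g = poly_mult f g" by (simp add: univ_poly_mult)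
  show "Polynomials.degree (f \<otimes>\<^bsub>K[X]\<^esub> g) = Polynomials.degree f + Polynomials.degree g"
    unfolding fg' poly_mult_degree_eq[OF K_subring fg(1,2)] using fg by simp
  have "hd (f \<otimes>\<^bsub>K[X]\<^esub> g) = \<one>"
    unfolding fg' poly_mult_lead_coeff[OF K_subring fg] using assms by (simp add: monic_def)
  moreover have "f \<otimes>\<^bsub>K[X]\<^esub> g \<noteq> []"
    using poly_mult_integral[OF K_subring fg(1,2)] fg(3,4) by (auto simp: fg')
  ultimately show "monic (f \<otimes>\<^bsub>K[X]\<^esub> g)" using assms by (auto simp: monic_def)
qed

lemma monic_pow:
  assumes "monic f"
  shows "monic (f [^]\<^bsub>K[X]\<^esub> (n::nat))"
    and "Polynomials.degree (f [^]\<^bsub>K[X]\<^esub> n) = n * Polynomials.degree f"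
proof -
  show "monic (f [^]\<^bsub>K[X]\<^esub> (n::nat))"
    using assms by (induction n) (auto simp: univ_poly_one monic_one intro: monic_mult)
  show "Polynomials.degree (f [^]\<^bsub>K[X]\<^esub> n) = n * Polynomials.degree f"
    using assms by (intro subring_polynomial_pow_degree[OF K_subring]) (auto simp: monic_def)
qed

lemma monic_cofactor:
  assumes "monic f" "monic P" "g \<in> carrier (K[X])" "f = P \<otimes>\<^bsub>K[X]\<^esub> g"
  shows "monic g"
proof -
  have P: "polynomial K P" "polynomial K g" "P \<noteq> []"
    using assms by (auto simp: monic_def univ_poly_carrier)
  have g: "g \<noteq> []"
  proof
    assume "g = []"
    hence "f = []" using assms(4) UP.r_null[OF monicD(1)[OF assms(2)]] by (simp add: univ_poly_zero)
    thus False using assms(1) by (simp add: monic_def)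
  qed
  have "hd f = hd P \<otimes> hd g"
    unfolding assms(4) univ_poly_mult by (rule poly_mult_lead_coeff[OF K_subring P(1,2,3) g])
  moreover have "hd g \<in> carrier R"
    using P(2) g K_carrier by (cases g) (auto simp: polynomial_def)
  ultimately have "hd g = \<one>" using assms by (simp add: monic_def)
  thus ?thesis using g assms by (simp add: monic_def)
qed

lemma irrD: "P \<in> irr \<Longrightarrow> monic P" "P \<in> irr \<Longrightarrow> pirreducible K P" "P \<in> irr \<Longrightarrow> P \<in> carrier (K[X])"
  by (auto simp: irr_def monic_def)

lemma irr_degree: "P \<in> irr \<Longrightarrow> Polynomials.degree P \<ge> 1"
  using pirreducible_degree[OF K_subfield] by (auto simp: irr_def monic_def)

lemma exists_irr_divisor:
  assumes "monic f" "Polynomials.degree f \<ge> 1"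
  obtains P g where "P \<in> irr" "monic g" "f = P \<otimes>\<^bsub>K[X]\<^esub> g"
proof -
  have f: "f \<in> carrier (K[X]) - {\<zero>\<^bsub>K[X]\<^esub>}" "f \<notin> Units (K[X])"
    using assms univ_poly_units'[OF K_subfield] by (auto simp: monic_def univ_poly_zero)
  obtain b where b: "b \<in> carrier (K[X])" "pirreducible K b" "b divides\<^bsub>K[X]\<^esub> f"
    using UP.exists_irreducible_divisor[OF f] by blast
  have b0: "b \<noteq> []" using b by (auto simp: ring_irreducible_def univ_poly_zero)
  \<comment> \<open>Scaling by the inverse leading coefficient makes the divisor monic within its
    class of associates, and irreducibility is invariant there.\<close>
  define c where "c = inv (hd b)"
  have hb: "hd b \<in> K - {\<zero>}" using b(1) b0 by (cases b) (auto simp: univ_poly_carrier[symmetric] polynomial_def)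
  have c: "c \<in> K - {\<zero>}" using subfield_m_inv(1)[OF K_subfield hb] by (simp add: c_def)
  define P where "P = [c] \<otimes>\<^bsub>K[X]\<^esub> b"
  have Pm: "P = map (\<lambda>a. c \<otimes> a) b"
    unfolding P_def univ_poly_mult using b(1) c by (intro poly_mult_const(1)[OF K_subring]) (auto simp: univ_poly_carrier)
  have hP: "hd P = \<one>"
    unfolding Pm using b0 hb subfield_m_inv(3)[OF K_subfield hb] by (simp add: hd_map c_def)
  have cc: "[c] \<in> carrier (K[X])" using c by (auto simp: univ_poly_carrier[symmetric] polynomial_def)
  hence Pc: "P \<in> carrier (K[X])" unfolding P_def using b(1) by simp
  have ass: "P \<sim>\<^bsub>K[X]\<^esub> b"
    unfolding associated_polynomials_iff[OF K_subfield Pc b(1)] using c P_def by blast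
  have "pirreducible K P"
    unfolding ring_irreducible_def Divisibility.irreducible_def
  proof (intro conjI ballI impI)
    show "P \<noteq> \<zero>\<^bsub>K[X]\<^esub>" using b0 Pm by (simp add: univ_poly_zero)
    show "P \<notin> Units (K[X])"
      using b(2) UP.Units_cong[OF _ ass b(1)] by (auto simp: ring_irreducible_def Divisibility.irreducible_def)
    fix d assume "d \<in> carrier (K[X])" "properfactor (K[X]) d P"
    moreover from this have "properfactor (K[X]) d b"
      using UP.properfactor_cong_r[OF _ ass _ Pc b(1)] by blast
    ultimately show "d \<in> Units (K[X])" using b(2) by (auto simp: ring_irreducible_def Divisibility.irreducible_def)
  qed
  hence P: "P \<in> irr" using Pc hP b0 Pm by (simp add: irr_def monic_def)
  have "P divides\<^bsub>K[X]\<^esub> f"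
    using ass b(3) Pc UP.divides_trans unfolding associated_def by blast
  then obtain g where "g \<in> carrier (K[X])" "f = P \<otimes>\<^bsub>K[X]\<^esub> g"
    by (rule dividesE)
  thus ?thesis using that[OF P] monic_cofactor[OF assms(1)] P irrD(1) by blast
qed

text \<open>A prime P occurs in as many pairs as its multiplicity in f, so sums over this set count
  primes with multiplicity.\<close>

definition prime_powers_dvd :: "'a list \<Rightarrow> ('a list \<times> nat) set" where
  "prime_powers_dvd f = {(P, k). P \<in> irr \<and> k \<ge> 1 \<and> P [^]\<^bsub>K[X]\<^esub> k divides\<^bsub>K[X]\<^esub> f}"

lemma monic_divides_degree:
  assumes "monic P" "monic f" "P divides\<^bsub>K[X]\<^esub> f"
  shows "Polynomials.degree P \<le> Polynomials.degree f"
proof -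
  obtain g where g: "g \<in> carrier (K[X])" "f = P \<otimes>\<^bsub>K[X]\<^esub> g"
    using assms(3) by (rule dividesE)
  have "monic g" using monic_cofactor[OF assms(2,1) g] .
  thus ?thesis using monic_mult(2)[OF assms(1)] g(2) by simp
qed

lemma irr_pow_divides_le:
  assumes "P \<in> irr" "monic f" "P [^]\<^bsub>K[X]\<^esub> k divides\<^bsub>K[X]\<^esub> f"
  shows "k * Polynomials.degree P \<le> Polynomials.degree f"
  using monic_divides_degree[OF monic_pow(1)[OF irrD(1)[OF assms(1)]] assms(2,3)] monic_pow(2)[OF irrD(1)[OF assms(1)], of k]
  by simp

lemma irr_pow_divides_le':
  assumes "P \<in> irr" "monic f" "P [^]\<^bsub>K[X]\<^esub> k divides\<^bsub>K[X]\<^esub> f"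
  shows "k \<le> Polynomials.degree f"
proof -
  have "k * 1 \<le> k * Polynomials.degree P" using irr_degree[OF assms(1)] by (intro mult_le_mono) auto
  thus ?thesis using irr_pow_divides_le[OF assms] by linarith
qed

lemma finite_prime_powers_dvd:
  assumes "monic f"
  shows "finite (prime_powers_dvd f)"
proof (rule finite_subset)
  let ?n = "Polynomials.degree f"
  show "prime_powers_dvd f \<subseteq> (\<Union>d\<le>?n. monics d) \<times> {..?n}"
  proof (intro subsetI)
    fix z assume "z \<in> prime_powers_dvd f"
    then obtain P k where z: "z = (P, k)" "P \<in> irr" "k \<ge> 1" "P [^]\<^bsub>K[X]\<^esub> k divides\<^bsub>K[X]\<^esub> f"
      by (auto simp: prime_powers_dvd_def)
    have "1 * Polynomials.degree P \<le> k * Polynomials.degree P" using z(3) by (intro mult_le_mono) auto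
    hence "Polynomials.degree P \<le> ?n" using irr_pow_divides_le[OF z(2) assms z(4)] by linarith
    moreover have "k \<le> ?n" using irr_pow_divides_le'[OF z(2) assms z(4)] .
    ultimately show "z \<in> (\<Union>d\<le>?n. monics d) \<times> {..?n}"
      using z irrD(1) by (auto simp: monics_def)
  qed
qed auto

lemma irr_eq_if_divides:
  assumes "P \<in> irr" "Q \<in> irr" "P divides\<^bsub>K[X]\<^esub> Q"
  shows "P = Q"
proof -
  obtain g where g: "g \<in> carrier (K[X])" "Q = P \<otimes>\<^bsub>K[X]\<^esub> g"
    using assms(3) by (rule dividesE)
  have mg: "monic g" using monic_cofactor[OF irrD(1)[OF assms(2)] irrD(1)[OF assms(1)] g] .
  have "P \<in> Units (K[X]) \<or> g \<in> Units (K[X])"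
    using pirreducibleE(3)[OF K_subring irrD(3)[OF assms(2)] irrD(2)[OF assms(2)] irrD(3)[OF assms(1)] g(1) g(2)] .
  moreover have "P \<notin> Units (K[X])"
    using pirreducibleE(2)[OF K_subring irrD(3)[OF assms(1)] irrD(2)[OF assms(1)]] .
  ultimately have "Polynomials.degree g = 0" using univ_poly_units'[OF K_subfield] by blast
  hence "g = [\<one>]" using mg monics_0 by (auto simp: monics_def)
  thus ?thesis using g(2) irrD(3)[OF assms(1)] UP.r_one by (simp add: univ_poly_one)
qed

text \<open>Unique factorization in additive form: P contributes its degree once for each unit of
  its multiplicity. Splitting off one irreducible factor adds exactly one pair.\<close>

lemma sum_prime_powers_dvd:
  assumes "monic f"
  shows "(\<Sum>(P, k)\<in>prime_powers_dvd f. Polynomials.degree P) = Polynomials.degree f"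
  using assms
proof (induction "Polynomials.degree f" arbitrary: f rule: less_induct)
  case less
  show ?case
  proof (cases "Polynomials.degree f \<ge> 1")
    case False
    have "prime_powers_dvd f = {}"
    proof (rule ccontr)
      assume "prime_powers_dvd f \<noteq> {}"
      then obtain P and k :: nat where "P \<in> irr" "k \<ge> 1" "P [^]\<^bsub>K[X]\<^esub> k divides\<^bsub>K[X]\<^esub> f"
        by (auto simp: prime_powers_dvd_def)
      thus False using irr_pow_divides_le'[of P f k] False less.prems by linarith
    qed
    thus ?thesis using False by simp
  next
    case True
    then obtain Q g where Q: "Q \<in> irr" "monic g" "f = Q \<otimes>\<^bsub>K[X]\<^esub> g"
      using exists_irr_divisor less.prems by blast
    have Qc: "Q \<in> carrier (K[X])" "g \<in> carrier (K[X])" using Q irrD(3) monicD(1) by auto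
    have df: "Polynomials.degree f = Polynomials.degree Q + Polynomials.degree g"
      unfolding Q(3) by (rule monic_mult(2)[OF irrD(1)[OF Q(1)] Q(2)])
    \<comment> \<open>Exponent 0 is included on purpose: k in \<open>E\<close> corresponds to
      exponent k + 1 of Q in f, whereas the exponents counted for g are those of
      \<open>E - {0}\<close>.\<close>
    define E where "E = {k::nat. Q [^]\<^bsub>K[X]\<^esub> k divides\<^bsub>K[X]\<^esub> g}"
    define A where "A = {(P, k) \<in> prime_powers_dvd g. P \<noteq> Q}"
    have finE: "finite E"
      by (rule finite_subset[of _ "{..Polynomials.degree g}"]) (use irr_pow_divides_le'[OF Q(1,2)] in \<open>auto simp: E_def\<close>)
    have E0: "0 \<in> E" using Qc UP.one_divides by (simp add: E_def)
    have finA: "finite A" unfolding A_def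
      by (rule finite_subset[OF _ finite_prime_powers_dvd[OF Q(2)]]) auto
    have other: "P [^]\<^bsub>K[X]\<^esub> k divides\<^bsub>K[X]\<^esub> f \<longleftrightarrow> P [^]\<^bsub>K[X]\<^esub> k divides\<^bsub>K[X]\<^esub> g"
      if P: "P \<in> irr" "P \<noteq> Q" for P and k :: nat
    proof -
      have Pk: "P [^]\<^bsub>K[X]\<^esub> k \<in> carrier (K[X])" using irrD(3)[OF P(1)] by simp
      have "\<not> P pdivides Q"
        using irr_eq_if_divides[OF P(1) Q(1)] P pdivides_iff_shell[OF K_subfield irrD(3)[OF P(1)] Qc(1)] by blast
      hence "P [^]\<^bsub>K[X]\<^esub> k pdivides (Q \<otimes>\<^bsub>K[X]\<^esub> g) \<longleftrightarrow> P [^]\<^bsub>K[X]\<^esub> k pdivides g"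
        by (intro pirreducible_pow_pdivides_iff[OF K_subfield irrD(3)[OF P(1)] Qc irrD(2)[OF P(1)]])
      thus ?thesis unfolding Q(3) using pdivides_iff_shell[OF K_subfield Pk] Qc by simp
    qed
    have same: "Q [^]\<^bsub>K[X]\<^esub> Suc k divides\<^bsub>K[X]\<^esub> f \<longleftrightarrow> Q [^]\<^bsub>K[X]\<^esub> k divides\<^bsub>K[X]\<^esub> g" for k :: nat
    proof -
      have Qk: "Q [^]\<^bsub>K[X]\<^esub> k \<in> carrier (K[X])" using Qc by simp
      have Suc: "Q [^]\<^bsub>K[X]\<^esub> Suc k = Q \<otimes>\<^bsub>K[X]\<^esub> Q [^]\<^bsub>K[X]\<^esub> k"
        using Qc Qk UP.m_comm by simp
      have Q0: "Q \<noteq> \<zero>\<^bsub>K[X]\<^esub>" using monicD(2)[OF irrD(1)[OF Q(1)]] by (simp add: univ_poly_zero)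
      show ?thesis
      proof
        assume "Q [^]\<^bsub>K[X]\<^esub> k divides\<^bsub>K[X]\<^esub> g"
        thus "Q [^]\<^bsub>K[X]\<^esub> Suc k divides\<^bsub>K[X]\<^esub> f"
          unfolding Suc Q(3) by (rule UP.divides_mult[OF Qk Qc(1)])
      next
        assume "Q [^]\<^bsub>K[X]\<^esub> Suc k divides\<^bsub>K[X]\<^esub> f"
        then obtain h where h: "h \<in> carrier (K[X])" "f = Q [^]\<^bsub>K[X]\<^esub> Suc k \<otimes>\<^bsub>K[X]\<^esub> h"
          by (rule dividesE)
        have "Q \<otimes>\<^bsub>K[X]\<^esub> g = Q \<otimes>\<^bsub>K[X]\<^esub> (Q [^]\<^bsub>K[X]\<^esub> k \<otimes>\<^bsub>K[X]\<^esub> h)"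
          using h(2) Qc Qk h(1) unfolding Q(3) Suc by (simp only: UP.m_assoc)
        hence "g = Q [^]\<^bsub>K[X]\<^esub> k \<otimes>\<^bsub>K[X]\<^esub> h"
          using UP.m_lcancel[OF Q0 Qc(1) Qc(2)] Qk h(1) by blast
        thus "Q [^]\<^bsub>K[X]\<^esub> k divides\<^bsub>K[X]\<^esub> g" using h(1) by (auto simp: factor_def)
      qed
    qed
    have pf: "prime_powers_dvd f = A \<union> (\<lambda>k. (Q, Suc k)) ` E"
    proof (intro Set.set_eqI)
      fix z :: "'a list \<times> nat"
      obtain P k where z: "z = (P, k)" by (cases z)
      show "z \<in> prime_powers_dvd f \<longleftrightarrow> z \<in> A \<union> (\<lambda>k. (Q, Suc k)) ` E"
      proof (cases "P = Q")
        case True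
        show ?thesis
        proof (cases k)
          case 0
          thus ?thesis using True z by (auto simp: prime_powers_dvd_def A_def)
        next
          case (Suc k')
          thus ?thesis using True z Q(1) same[of k'] 
            by (auto simp: prime_powers_dvd_def A_def E_def simp del: nat_pow_Suc UP.nat_pow_Suc)
        qed
      next
        case False
        thus ?thesis using z other[of P k] by (auto simp: prime_powers_dvd_def A_def)
      qed
    qed
    have pg: "prime_powers_dvd g = A \<union> (\<lambda>k. (Q, k)) ` (E - {0})"
      using Q(1) by (auto simp: prime_powers_dvd_def A_def E_def)
    have "(\<Sum>(P, k)\<in>prime_powers_dvd f. Polynomials.degree P)
        = (\<Sum>(P, k)\<in>A. Polynomials.degree P) + card E * Polynomials.degree Q"
      unfolding pf using finA finE by (subst sum.union_disjoint) (auto simp: A_def sum.reindex inj_on_def)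
    also have "card E = Suc (card (E - {0}))" by (rule card.remove[OF finE E0])
    also have "(\<Sum>(P, k)\<in>A. Polynomials.degree P) + Suc (card (E - {0})) * Polynomials.degree Q =
      ((\<Sum>(P, k)\<in>A. Polynomials.degree P) + card (E - {0}) * Polynomials.degree Q) + Polynomials.degree Q"
      by simp
    also have "(\<Sum>(P, k)\<in>A. Polynomials.degree P) + card (E - {0}) * Polynomials.degree Q
       = (\<Sum>(P, k)\<in>prime_powers_dvd g. Polynomials.degree P)"
      unfolding pg using finA finE by (subst sum.union_disjoint) (auto simp: A_def sum.reindex inj_on_def)
    also have "\<dots> = Polynomials.degree g"
      using df irr_degree[OF Q(1)] by (intro less.hyps[OF _ Q(2)]) linarith
    finally show ?thesis using df by simp
  qed
qed

section \<open>Prime powers of fixed degree and the Newton identity\<close>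

definition prime_powers :: "nat \<Rightarrow> ('a list \<times> nat) set" where
  "prime_powers j = {(P, k). P \<in> irr \<and> k \<ge> 1 \<and> k * Polynomials.degree P = j}"

text \<open>The coefficients of the logarithmic derivative of the Euler product
  \<open>\<Prod>\<^sub>P (1 - lam(P) T\<^bsup>deg P\<^esup>)\<^sup>-\<^sup>1\<close>.\<close>

definition mangoldt_sum :: "('a list \<Rightarrow> 'c::comm_semiring_1) \<Rightarrow> nat \<Rightarrow> 'c" where
  "mangoldt_sum lam j = (\<Sum>(P, k)\<in>prime_powers j. of_nat (Polynomials.degree P) * lam P ^ k)"

lemma finite_prime_powers [simp, intro]: "finite (prime_powers j)"
proof (rule finite_subset)
  show "prime_powers j \<subseteq> (\<Union>d\<le>j. monics d) \<times> {..j}"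
  proof (intro subsetI)
    fix z assume "z \<in> prime_powers j"
    then obtain P k where z: "z = (P, k)" "P \<in> irr" "k \<ge> 1" "k * Polynomials.degree P = j"
      by (auto simp: prime_powers_def)
    have "1 * Polynomials.degree P \<le> k * Polynomials.degree P" using z(3) by (intro mult_le_mono) auto
    moreover have "k * 1 \<le> k * Polynomials.degree P" using irr_degree[OF z(2)] by (intro mult_le_mono) auto
    ultimately show "z \<in> (\<Union>d\<le>j. monics d) \<times> {..j}"
      using z irrD(1)[OF z(2)] by (auto simp: monics_def)
  qed
qed auto

end

text \<open>Replace n = deg f by the sum of deg P over the prime powers P^k dividing f, write f =
  P^k g, and sum over (P, k) and g separately. For the generating series Z this is the coefficient
  of T^n in T Z' = Z (T Z' / Z).\<close>

lemma (in GF) newton_identity: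
  fixes lam :: "'a list \<Rightarrow> 'c::comm_semiring_1"
  assumes lam_mult: "\<And>f g. monic f \<Longrightarrow> monic g \<Longrightarrow> lam (f \<otimes>\<^bsub>K[X]\<^esub> g) = lam f * lam g"
    and lam_one: "lam [\<one>] = 1"
  shows "of_nat n * (\<Sum>f\<in>monics n. lam f) =
    (\<Sum>j=1..n. mangoldt_sum lam j * (\<Sum>f\<in>monics (n - j). lam f))"
proof -
  interpret UP: principal_domain "K[X]"
    by (rule univ_poly_is_principal[OF K_subfield])
  have lam_pow: "lam (P [^]\<^bsub>K[X]\<^esub> k) = lam P ^ k" if "monic P" for P and k :: nat
    using that by (induction k) (auto simp: univ_poly_one lam_one lam_mult monic_pow mult.commute)
  define A where "A = (SIGMA f:monics n. prime_powers_dvd f)"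
  define B where "B = (SIGMA j:{1..n}. prime_powers j \<times> monics (n - j))"
  \<comment> \<open>The component j = k deg P is carried along so that the sum over \<open>B\<close>
    splits by j.\<close>
  define T where "T = (\<lambda>(j::nat, (P, k::nat), g). (P [^]\<^bsub>K[X]\<^esub> k \<otimes>\<^bsub>K[X]\<^esub> g, P, k))"
  have "bij_betw T B A"
    unfolding bij_betw_def
  proof (intro conjI)
    show "inj_on T B"
    proof (rule inj_onI)
      fix x y assume xy: "x \<in> B" "y \<in> B" "T x = T y"
      obtain j P k g where x: "x = (j, (P, k), g)" by (cases x) auto
      obtain j' P' k' g' where y: "y = (j', (P', k'), g')" by (cases y) auto
      have e: "P' = P" "k' = k" and eq: "P [^]\<^bsub>K[X]\<^esub> k \<otimes>\<^bsub>K[X]\<^esub> g = P [^]\<^bsub>K[X]\<^esub> k \<otimes>\<^bsub>K[X]\<^esub> g'"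
        using xy(3) by (auto simp: x y T_def)
      have j: "j = j'" using xy(1,2) e by (auto simp: x y B_def prime_powers_def)
      have mP: "monic (P [^]\<^bsub>K[X]\<^esub> k)" and g: "monic g" "monic g'"
        using xy(1,2) by (auto simp: x y B_def prime_powers_def monics_def intro: monic_pow irrD)
      have "g = g'"
        using UP.m_lcancel[of "P [^]\<^bsub>K[X]\<^esub> k" g g'] eq monicD[OF mP] monicD[OF g(1)] monicD[OF g(2)]
        by (simp add: univ_poly_zero)
      thus "x = y" using e j by (simp add: x y)
    qed
    show "T ` B = A"
    proof
      show "T ` B \<subseteq> A"
      proof
        fix z assume "z \<in> T ` B"
        then obtain j P k g where z: "z = T (j, (P, k), g)" "(j, (P, k), g) \<in> B" by fastforce
        have P: "P \<in> irr" "k \<ge> 1" "k * Polynomials.degree P = j" "j \<le> n" "monic g" "Polynomials.degree g = n - j"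
          using z(2) by (auto simp: B_def prime_powers_def monics_def)
        have mP: "monic (P [^]\<^bsub>K[X]\<^esub> k)" using monic_pow(1)[OF irrD(1)[OF P(1)]] .
        have "Polynomials.degree (P [^]\<^bsub>K[X]\<^esub> k \<otimes>\<^bsub>K[X]\<^esub> g) = n"
          using monic_mult(2)[OF mP P(5)] monic_pow(2)[OF irrD(1)[OF P(1)], of k] P by simp
        moreover have "P [^]\<^bsub>K[X]\<^esub> k divides\<^bsub>K[X]\<^esub> (P [^]\<^bsub>K[X]\<^esub> k \<otimes>\<^bsub>K[X]\<^esub> g)"
          using monicD(1)[OF P(5)] by (auto simp: factor_def)
        ultimately show "z \<in> A"
          using P monic_mult(1)[OF mP P(5)] by (auto simp: z T_def A_def monics_def prime_powers_dvd_def)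
      qed
      show "A \<subseteq> T ` B"
      proof
        fix z assume "z \<in> A"
        then obtain f P k where z: "z = (f, P, k)" and f: "monic f" "Polynomials.degree f = n"
          and P: "P \<in> irr" "k \<ge> 1" "P [^]\<^bsub>K[X]\<^esub> k divides\<^bsub>K[X]\<^esub> f"
          by (auto simp: A_def monics_def prime_powers_dvd_def)
        have mP: "monic (P [^]\<^bsub>K[X]\<^esub> k)" using monic_pow(1)[OF irrD(1)[OF P(1)]] .
        obtain g where g: "g \<in> carrier (K[X])" "f = P [^]\<^bsub>K[X]\<^esub> k \<otimes>\<^bsub>K[X]\<^esub> g"
          using P(3) by (rule dividesE)
        have mg: "monic g" using monic_cofactor[OF f(1) mP g] .
        have deg: "n = k * Polynomials.degree P + Polynomials.degree g"
          using f(2) monic_mult(2)[OF mP mg] monic_pow(2)[OF irrD(1)[OF P(1)], of k] g(2) by simp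
        have "k * 1 \<le> k * Polynomials.degree P" using irr_degree[OF P(1)] by (intro mult_le_mono) auto
        hence "(k * Polynomials.degree P, (P, k), g) \<in> B"
          using deg P mg by (auto simp: B_def prime_powers_def monics_def)
        moreover have "z = T (k * Polynomials.degree P, (P, k), g)" by (simp add: z T_def g(2))
        ultimately show "z \<in> T ` B" by blast
      qed
    qed
  qed
  note bij = this
  define w where "w P = (of_nat (Polynomials.degree P) :: 'c)" for P :: "'a list"
  have "of_nat n * (\<Sum>f\<in>monics n. lam f)
      = (\<Sum>f\<in>monics n. of_nat (\<Sum>(P, k)\<in>prime_powers_dvd f. Polynomials.degree P) * lam f)"
    unfolding sum_distrib_left
  proof (intro sum.cong refl)
    fix f assume "f \<in> monics n"
    hence "monic f" "Polynomials.degree f = n" by (auto simp: monics_def)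
    thus "of_nat n * lam f
        = of_nat (\<Sum>(P, k)\<in>prime_powers_dvd f. Polynomials.degree P) * lam f"
      by (simp only: sum_prime_powers_dvd)
  qed
  also have "\<dots> = (\<Sum>f\<in>monics n. \<Sum>x\<in>prime_powers_dvd f. w (fst x) * lam f)"
    by (simp add: of_nat_sum sum_distrib_right case_prod_unfold w_def)
  also have "\<dots> = (\<Sum>z\<in>A. w (fst (snd z)) * lam (fst z))"
    unfolding A_def by (subst sum.Sigma[OF finite_monics])
      (auto simp: monics_def finite_prime_powers_dvd case_prod_unfold)
  also have "\<dots> = (\<Sum>y\<in>B. w (fst (snd (T y))) * lam (fst (T y)))"
    by (rule sum.reindex_bij_betw[OF bij, symmetric])
  also have "\<dots> = (\<Sum>y\<in>B. (w (fst (fst (snd y))) * lam (fst (fst (snd y))) ^ snd (fst (snd y))) * lam (snd (snd y)))"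
  proof (intro sum.cong refl)
    fix y assume yB: "y \<in> B"
    obtain j P k g where y: "y = (j, (P, k), g)" by (cases y) auto
    have P: "monic P" "monic g"
      using yB by (auto simp: y B_def prime_powers_def monics_def irrD)
    show "w (fst (snd (T y))) * lam (fst (T y)) =
       (w (fst (fst (snd y))) * lam (fst (fst (snd y))) ^ snd (fst (snd y))) * lam (snd (snd y))"
      using lam_mult[OF monic_pow(1)[OF P(1)] P(2), of k] lam_pow[OF P(1), of k]
      by (simp add: y T_def mult.assoc)
  qed
  also have "\<dots> = (\<Sum>j=1..n. \<Sum>x\<in>prime_powers j \<times> monics (n - j).
      (w (fst (fst x)) * lam (fst (fst x)) ^ snd (fst x)) * lam (snd x))"
    unfolding B_def by (subst sum.Sigma) (auto simp: case_prod_unfold)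
  also have "\<dots> = (\<Sum>j=1..n. mangoldt_sum lam j * (\<Sum>f\<in>monics (n - j). lam f))"
    unfolding mangoldt_sum_def sum_product sum.cartesian_product
    by (simp add: case_prod_unfold w_def)
  finally show ?thesis .
qed

section \<open>Minimal polynomials and Frobenius orbits\<close>

text \<open>Each root splits off a linear factor, and the other roots stay roots of the monic
  quotient. It serves both to bound numbers of roots and to write a minimal polynomial as a product
  over conjugates.\<close>

lemma (in domain) eval_monic_eq_prod:
  assumes "finite A" "A \<subseteq> carrier R" "\<And>a. a \<in> A \<Longrightarrow> eval f a = \<zero>"
    and "set f \<subseteq> carrier R" "f \<noteq> []" "hd f = \<one>"
  shows "card A \<le> Polynomials.degree f"
    and "card A = Polynomials.degree f \<Longrightarrow> x \<in> carrier R \<Longrightarrow> eval f x = (\<Otimes>a\<in>A. x \<ominus> a)"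
proof -
  have "card A \<le> Polynomials.degree f \<and>
    (card A = Polynomials.degree f \<longrightarrow> (\<forall>x\<in>carrier R. eval f x = (\<Otimes>a\<in>A. x \<ominus> a)))"
    using assms
  proof (induction A arbitrary: f rule: finite_induct)
    case empty
    show ?case
    proof (intro conjI impI ballI)
      fix x assume x: "x \<in> carrier R" and "card {} = Polynomials.degree f"
      hence "f = [\<one>]" using empty.prems by (cases f) auto
      thus "eval f x = (\<Otimes>a\<in>{}. x \<ominus> a)" using x by simp
    qed simp
  next
    case (insert a A)
    have ac: "a \<in> carrier R" and AR: "A \<subseteq> carrier R" using insert.prems by auto
    have fc: "f \<in> carrier (poly_ring R)"
      using insert.prems by (auto simp: univ_poly_carrier[symmetric] polynomial_def)
    have "is_root f a" using insert.prems by (auto simp: is_root_def)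
    hence "[\<one>, \<ominus> a] pdivides f" by (rule is_root_imp_pdivides[OF fc])
    then obtain g where g: "g \<in> carrier (poly_ring R)" "f = [\<one>, \<ominus> a] \<otimes>\<^bsub>poly_ring R\<^esub> g"
      unfolding pdivides_def by (rule dividesE)
    have lin: "polynomial (carrier R) [\<one>, \<ominus> a]" using ac by (auto simp: polynomial_def)
    have gp: "polynomial (carrier R) g" using g(1) by (simp add: univ_poly_carrier)
    have fm: "f = poly_mult [\<one>, \<ominus> a] g" using g(2) by (simp add: univ_poly_mult)
    have g0: "g \<noteq> []"
    proof
      assume "g = []"
      hence "f = []" using fm ac poly_mult_zero(2)[of "[\<one>, \<ominus> a]"] by simp
      thus False using insert.prems by simp
    qed
    have gset: "set g \<subseteq> carrier R" using gp by (auto simp: polynomial_def)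
    have "hd f = \<one> \<otimes> hd g"
      unfolding fm using poly_mult_lead_coeff[OF carrier_is_subring lin gp _ g0] by simp
    moreover have "hd g \<in> carrier R" using gset g0 by (cases g) auto
    ultimately have hg: "hd g = \<one>" using insert.prems by simp
    have deg: "Polynomials.degree f = Suc (Polynomials.degree g)"
      unfolding fm using poly_mult_degree_eq[OF carrier_is_subring lin gp] g0 by simp
    have ev: "eval f x = (x \<ominus> a) \<otimes> eval g x" if x: "x \<in> carrier R" for x
      unfolding fm using ac x gset by (subst eval_poly_mult) (auto simp: a_minus_def)
    have roots: "eval g b = \<zero>" if b: "b \<in> A" for b
    proof -
      have bc: "b \<in> carrier R" and ba: "b \<noteq> a" using b AR insert.hyps by auto
      have "(b \<ominus> a) \<otimes> eval g b = \<zero>" using ev[OF bc] insert.prems b by simp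
      moreover have "b \<ominus> a \<noteq> \<zero>" using ba bc ac by simp
      ultimately show ?thesis using integral eval_in_carrier[OF gset bc] bc ac by blast
    qed
    have IH: "card A \<le> Polynomials.degree g"
      "card A = Polynomials.degree g \<Longrightarrow> x \<in> carrier R \<Longrightarrow> eval g x = (\<Otimes>a\<in>A. x \<ominus> a)" for x
      using insert.IH[OF AR roots gset g0 hg] by auto
    show ?case
    proof (intro conjI impI ballI)
      show "card (insert a A) \<le> Polynomials.degree f" using IH(1) deg insert.hyps by simp
      fix x assume x: "x \<in> carrier R" and c: "card (insert a A) = Polynomials.degree f"
      have "eval g x = (\<Otimes>a\<in>A. x \<ominus> a)" using c deg insert.hyps by (intro IH(2) x) simp
      thus "eval f x = (\<Otimes>a\<in>insert a A. x \<ominus> a)"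
        using insert.hyps x AR ac by (subst finprod_insert) (auto simp: ev)
    qed
  qed
  thus "card A \<le> Polynomials.degree f"
    and "card A = Polynomials.degree f \<Longrightarrow> x \<in> carrier R \<Longrightarrow> eval f x = (\<Otimes>a\<in>A. x \<ominus> a)"
    by blast+
qed

context GF begin

interpretation UP: principal_domain "K[X]"
  by (rule univ_poly_is_principal[OF K_subfield])

text \<open>Evaluation at x maps the infinite set of polynomials over \<open>K\<close> into a finite
  field, so it cannot be injective.\<close>

lemma algebraic_K: "x \<in> carrier R \<Longrightarrow> (algebraic over K) x"
proof -
  assume x: "x \<in> carrier R"
  have "\<not> (transcendental over K) x"
  proof
    assume "(transcendental over K) x"
    hence inj: "inj_on (\<lambda>f. eval f x) (carrier (K[X]))" by (simp add: over_def transcendental_def)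
    have "(\<lambda>f. eval f x) ` carrier (K[X]) \<subseteq> carrier R"
      using eval_poly_in_carrier[OF K_subring _ x] by (auto simp: univ_poly_carrier)
    hence "finite ((\<lambda>f. eval f x) ` carrier (K[X]))" by (rule finite_subset) auto
    hence "finite (carrier (K[X]))" using inj by (rule finite_imageD)
    moreover have "range (\<lambda>n. \<one> # replicate n \<one>) \<subseteq> carrier (K[X])"
      using subringE(3)[OF K_subring] by (auto simp: univ_poly_carrier[symmetric] polynomial_def)
    ultimately have "finite (range (\<lambda>n::nat. \<one> # replicate n \<one>))" using finite_subset by blast
    moreover have "inj (\<lambda>n::nat. \<one> # replicate n \<one>)"
      by (intro injI) (metis length_replicate list.inject)
    ultimately show False using finite_imageD by blast
  qed
  thus ?thesis by (simp add: over_def)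
qed

lemma Irr_in_irr: "x \<in> carrier R \<Longrightarrow> Irr K x \<in> irr"
  using IrrE[OF K_subfield _ algebraic_K, of x] pirreducibleE(1)[OF K_subring]
  by (auto simp: irr_def monic_def)

lemma eval_Irr: "x \<in> carrier R \<Longrightarrow> eval (Irr K x) x = \<zero>"
  using IrrE(4)[OF K_subfield _ algebraic_K] by blast

lemma Irr_eqI: "\<lbrakk>P \<in> irr; x \<in> carrier R; eval P x = \<zero>\<rbrakk> \<Longrightarrow> Irr K x = P"
  using minimal_polynomial_is_unique[OF K_subfield _ algebraic_K, of x] Irr_in_irr[of x] eval_Irr[of x]
  by (auto simp: irr_def monic_def)

lemma K_pow: "k \<in> K \<Longrightarrow> k [^] (p ^ i) = k"
proof (induction i)
  case (Suc i)
  have "k [^] (p ^ Suc i) = (k [^] (p ^ i)) [^] p"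
    using Suc.prems K_carrier by (subst nat_pow_pow) (auto simp: mult.commute)
  thus ?case using Suc K_pow_p by simp
qed (use K_carrier in auto)

lemma frob_minus:
  assumes "x \<in> carrier R" "y \<in> carrier R"
  shows "(x \<ominus> y) [^] (p ^ i) = x [^] (p ^ i) \<ominus> y [^] (p ^ i)"
proof -
  have "x = (x \<ominus> y) \<oplus> y" using assms by (simp add: a_minus_def a_assoc l_neg)
  hence "x [^] (p ^ i) = (x \<ominus> y) [^] (p ^ i) \<oplus> y [^] (p ^ i)"
    using frob_add[of "x \<ominus> y" y i] assms by simp
  thus ?thesis using assms by (simp add: a_minus_def a_assoc r_neg)
qed

lemma frob_inj:
  assumes "x \<in> carrier R" "y \<in> carrier R" "x [^] (p ^ i) = y [^] (p ^ i)"
  shows "x = y"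
proof -
  have "(x \<ominus> y) [^] (p ^ i) = \<zero>" using assms by (simp add: frob_minus)
  hence "x \<ominus> y = \<zero>" using pow_eq_zero assms by blast
  thus ?thesis using assms by simp
qed

text \<open>Frobenius is a ring homomorphism that fixes the coefficients, since they lie in
  \<open>K\<close>. Hence it permutes the roots of a polynomial over \<open>K\<close>.\<close>

lemma eval_frob:
  assumes "set f \<subseteq> K" "x \<in> carrier R"
  shows "eval f (x [^] (p ^ i)) = eval f x [^] (p ^ i)"
  using assms(1)
proof (induction f)
  case Nil
  show ?case using p_gt_1 by (simp add: nat_pow_zero)
next
  case (Cons a f)
  have a: "a \<in> K" "a \<in> carrier R" and f: "set f \<subseteq> carrier R" using Cons.prems K_carrier by auto
  have "a \<otimes> (x [^] (p ^ i)) [^] length f = (a \<otimes> x [^] length f) [^] (p ^ i)"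
    using a assms(2) K_pow[OF a(1)] by (simp add: nat_pow_distrib nat_pow_pow mult.commute)
  thus ?case using Cons a f assms(2) eval_in_carrier[OF f assms(2)] by (simp add: frob_add)
qed

text \<open>The number of conjugates of x; \<open>degree_Irr\<close> identifies it with the degree
  of x over \<open>K\<close>.\<close>

definition frob_order :: "'a \<Rightarrow> nat" where
  "frob_order x = (LEAST d. d > 0 \<and> x [^] (p ^ d) = x)"

lemma frob_order:
  assumes "x \<in> carrier R"
  shows "frob_order x > 0" "x [^] (p ^ frob_order x) = x" "frob_order x \<le> m"
    "\<And>d. d > 0 \<Longrightarrow> x [^] (p ^ d) = x \<Longrightarrow> frob_order x \<le> d"
proof -
  have *: "m > 0 \<and> x [^] (p ^ m) = x" using m_pos pow_card[OF assms] by simp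
  show "frob_order x > 0" "x [^] (p ^ frob_order x) = x"
    using LeastI[of "\<lambda>d. d > 0 \<and> x [^] (p ^ d) = x", OF *] by (auto simp: frob_order_def)
  show le: "\<And>d. d > 0 \<Longrightarrow> x [^] (p ^ d) = x \<Longrightarrow> frob_order x \<le> d"
    unfolding frob_order_def by (rule Least_le) auto
  show "frob_order x \<le> m" using le * by blast
qed

lemma frob_frob: "x \<in> carrier R \<Longrightarrow> (x [^] (p ^ i)) [^] (p ^ j) = x [^] (p ^ (i + j))"
  by (simp add: nat_pow_pow power_add)

lemma frob_periodic:
  assumes "x \<in> carrier R" "x [^] (p ^ d) = x"
  shows "x [^] (p ^ (d * k)) = x"
proof (induction k)
  case (Suc k)
  have "x [^] (p ^ (d * Suc k)) = (x [^] (p ^ d)) [^] (p ^ (d * k))"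
    using frob_frob[OF assms(1), of d "d * k"] by simp
  thus ?case using Suc assms(2) by simp
qed (use assms in simp)

text \<open>Both the m-th Frobenius power and the one of order \<open>frob_order x\<close> fix x,
  hence so does the one for the remainder, which minimality forces to be 0.\<close>

lemma frob_order_dvd: "x \<in> carrier R \<Longrightarrow> frob_order x dvd m"
proof -
  assume x: "x \<in> carrier R"
  let ?d = "frob_order x"
  have "x [^] (p ^ (?d * (m div ?d) + m mod ?d)) = x" using pow_card[OF x] by simp
  hence "(x [^] (p ^ (?d * (m div ?d)))) [^] (p ^ (m mod ?d)) = x"
    using frob_frob[OF x] by simp
  hence "x [^] (p ^ (m mod ?d)) = x"
    using frob_periodic[OF x frob_order(2)[OF x]] by simp
  moreover have "m mod ?d < ?d" using frob_order(1)[OF x] by simp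
  ultimately have "\<not> m mod ?d > 0" using frob_order(4)[OF x, of "m mod ?d"] by linarith
  thus ?thesis by (simp add: mod_eq_0_iff_dvd)
qed

lemma frob_orbit_inj: "x \<in> carrier R \<Longrightarrow> inj_on (\<lambda>i. x [^] (p ^ i)) {..<frob_order x}"
proof (rule linorder_inj_onI)
  fix i j assume x: "x \<in> carrier R" and ij: "i < j" "i \<in> {..<frob_order x}" "j \<in> {..<frob_order x}"
  show "x [^] (p ^ i) \<noteq> x [^] (p ^ j)"
  proof
    assume eq: "x [^] (p ^ i) = x [^] (p ^ j)"
    have "(x [^] (p ^ (j - i))) [^] (p ^ i) = x [^] (p ^ i)"
      using frob_frob[OF x, of "j - i" i] ij eq by simp
    hence "x [^] (p ^ (j - i)) = x" using frob_inj x by blast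
    hence "frob_order x \<le> j - i" using frob_order(4)[OF x] ij by simp
    thus False using ij by simp
  qed
qed auto

definition frob_orbit :: "'a \<Rightarrow> 'a set" where
  "frob_orbit x = (\<lambda>i. x [^] (p ^ i)) ` {..<frob_order x}"

lemma card_frob_orbit: "x \<in> carrier R \<Longrightarrow> card (frob_orbit x) = frob_order x"
  unfolding frob_orbit_def by (subst card_image[OF frob_orbit_inj]) auto

lemma frob_orbit_roots:
  assumes "x \<in> carrier R" "b \<in> frob_orbit x"
  shows "b \<in> carrier R" "eval (Irr K x) b = \<zero>"
proof -
  obtain i where b: "b = x [^] (p ^ i)" using assms(2) by (auto simp: frob_orbit_def)
  have "set (Irr K x) \<subseteq> K" using Irr_in_irr[OF assms(1)] monic_set irrD(1) by blast
  hence "eval (Irr K x) b = \<zero> [^] (p ^ i)"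
    unfolding b using eval_frob assms(1) eval_Irr[OF assms(1)] by simp
  thus "eval (Irr K x) b = \<zero>" using p_gt_1 by (simp add: nat_pow_zero)
  show "b \<in> carrier R" using b assms(1) by simp
qed

text \<open>Polynomials of degree below e, the degree of the minimal polynomial, take p^e distinct
  values at x by minimality. With d = \<open>frob_order x\<close>, all these values are fixed by the
  d-th Frobenius power, which has at most p^d fixed points.\<close>

lemma degree_Irr_le: "x \<in> carrier R \<Longrightarrow> Polynomials.degree (Irr K x) \<le> frob_order x"
proof -
  assume x: "x \<in> carrier R"
  define e where "e = Polynomials.degree (Irr K x)"
  define d where "d = frob_order x"
  \<comment> \<open>Lists of fixed length e may start with zeros; \<open>normalize\<close> strips
    these to reach genuine polynomials, and the known length restores them at the end.\<close>
  define L where "L = {cs. set cs \<subseteq> K \<and> length cs = e}"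
  have "inj_on (\<lambda>cs. eval cs x) L"
  proof (rule inj_onI)
    fix as bs assume L: "as \<in> L" "bs \<in> L" and eq: "eval as x = eval bs x"
    have K: "set as \<subseteq> K" "set bs \<subseteq> K" "length as = e" "length bs = e" using L by (auto simp: L_def)
    have Kc: "set as \<subseteq> carrier R" "set bs \<subseteq> carrier R" using K K_carrier by auto
    define f where "f = normalize as"
    define g where "g = normalize bs"
    have fg: "f \<in> carrier (K[X])" "g \<in> carrier (K[X])"
      unfolding f_def g_def using K by (auto simp: univ_poly_carrier[symmetric] intro: normalize_gives_polynomial)
    have len: "length f \<le> e" "length g \<le> e"
      using normalize_length_le[of as] normalize_length_le[of bs] K by (auto simp: f_def g_def)
    define h where "h = f \<ominus>\<^bsub>K[X]\<^esub> g"
    have h: "h \<in> carrier (K[X])" unfolding h_def using fg by simp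
    have "length h \<le> max (length f) (length (\<ominus>\<^bsub>K[X]\<^esub> g))"
      unfolding h_def a_minus_def univ_poly_add by (rule poly_add_length_le)
    hence lh: "length h \<le> e" using len univ_poly_a_inv_length[OF K_subring fg(2)] by simp
    have ef: "eval f x = eval g x"
      unfolding f_def g_def using eval_normalize[OF _ x] Kc eq by simp
    interpret h: ring_hom_ring "K[X]" R "\<lambda>p. eval p x" by (rule eval_ring_hom[OF K_subring x])
    have "eval h x = eval f x \<ominus> eval g x"
      unfolding h_def a_minus_def using fg by simp
    also have "\<dots> = \<zero>" unfolding ef using h.hom_closed[OF fg(2)] by simp
    finally have "Irr K x pdivides h"
      using Irr_minimal[OF K_subfield x algebraic_K[OF x] h] by simp
    moreover have "e \<ge> 1" using irr_degree[OF Irr_in_irr[OF x]] by (simp add: e_def)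
    ultimately have "h = []"
      using pdivides_imp_degree_le[OF K_subring irrD(3)[OF Irr_in_irr[OF x]] h] lh by (cases h) (auto simp: e_def)
    hence "f = g" using fg unfolding h_def by (metis UP.r_right_minus_eq univ_poly_zero)
    thus "as = bs" using normalize_trick[of as] normalize_trick[of bs] K by (simp add: f_def g_def)
  qed
  hence "card ((\<lambda>cs. eval cs x) ` L) = card L" by (rule card_image)
  also have "card L = p ^ e" unfolding L_def by (simp add: card_lists_length_eq card_K)
  finally have "p ^ e = card ((\<lambda>cs. eval cs x) ` L)" by simp
  also have "\<dots> \<le> card {y \<in> carrier R. y [^] (p ^ d) = y}"
  proof (rule card_mono)
    show "(\<lambda>cs. eval cs x) ` L \<subseteq> {y \<in> carrier R. y [^] (p ^ d) = y}"
    proof (intro image_subsetI CollectI conjI)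
      fix cs assume "cs \<in> L"
      hence cs: "set cs \<subseteq> K" "set cs \<subseteq> carrier R" using K_carrier by (auto simp: L_def)
      show "eval cs x \<in> carrier R" by (rule eval_in_carrier[OF cs(2) x])
      show "eval cs x [^] (p ^ d) = eval cs x"
        using eval_frob[OF cs(1) x, of d] frob_order(2)[OF x] by (simp add: d_def)
    qed
  qed auto
  also have "\<dots> \<le> p ^ d" using card_fixed frob_order(1)[OF x] by (simp add: d_def)
  finally show "e \<le> frob_order x" using p_gt_1 by (simp add: d_def power_increasing_iff)
qed

text \<open>The \<open>frob_order x\<close> conjugates of x are distinct roots of its minimal
  polynomial, which gives the missing inequality.\<close>

lemma degree_Irr: "x \<in> carrier R \<Longrightarrow> Polynomials.degree (Irr K x) = frob_order x"
proof (rule antisym)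
  assume x: "x \<in> carrier R"
  note P = irrD(1)[OF Irr_in_irr[OF x]]
  show "Polynomials.degree (Irr K x) \<le> frob_order x" by (rule degree_Irr_le[OF x])
  have "card (frob_orbit x) \<le> Polynomials.degree (Irr K x)"
    using frob_orbit_roots[OF x] monic_set'[OF P] monicD[OF P]
    by (intro eval_monic_eq_prod(1)) (auto simp: frob_orbit_def)
  thus "frob_order x \<le> Polynomials.degree (Irr K x)" using card_frob_orbit[OF x] by simp
qed

lemma finprod_frob: "y \<in> carrier R \<Longrightarrow> (\<Otimes>i\<in>{..<n::nat}. y [^] (p ^ i)) = y [^] (\<Sum>i<n. p ^ i)"
proof (induction n)
  case (Suc n)
  have "(\<Otimes>i\<in>insert n {..<n}. y [^] (p ^ i)) = y [^] (p ^ n) \<otimes> (\<Otimes>i\<in>{..<n}. y [^] (p ^ i))"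
    using Suc.prems by (subst finprod_insert) auto
  thus ?case using Suc by (simp add: lessThan_Suc nat_pow_mult add.commute)
qed simp

text \<open>The minimal polynomial is the product of X - x^(p^i) over the orbit, and k - x^(p^i) =
  (k - x)^(p^i) because Frobenius fixes k.\<close>

lemma eval_Irr_K:
  assumes "x \<in> carrier R" "k \<in> K"
  shows "eval (Irr K x) k = (k \<ominus> x) [^] (\<Sum>i<frob_order x. p ^ i)"
proof -
  note P = irrD(1)[OF Irr_in_irr[OF assms(1)]]
  have kc: "k \<in> carrier R" using assms K_carrier by auto
  have "eval (Irr K x) k = (\<Otimes>a\<in>frob_orbit x. k \<ominus> a)"
    using frob_orbit_roots[OF assms(1)] monic_set'[OF P] monicD[OF P] card_frob_orbit[OF assms(1)]
      degree_Irr[OF assms(1)] kc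
    by (intro eval_monic_eq_prod(2)) (auto simp: frob_orbit_def)
  also have "\<dots> = (\<Otimes>i\<in>{..<frob_order x}. k \<ominus> x [^] (p ^ i))"
    unfolding frob_orbit_def using assms(1) kc
    by (intro finprod_reindex frob_orbit_inj) auto
  also have "\<dots> = (\<Otimes>i\<in>{..<frob_order x}. (k \<ominus> x) [^] (p ^ i))"
    using assms kc K_pow by (intro finprod_cong') (auto simp: frob_minus)
  also have "\<dots> = (k \<ominus> x) [^] (\<Sum>i<frob_order x. p ^ i)" using assms kc by (intro finprod_frob) simp
  finally show ?thesis .
qed

text \<open>The left side is the norm of k - x down to \<open>K\<close>, and this is its
  transitivity through K(x). With d = \<open>frob_order x\<close> the exponent factors as (1 + ... +
  p^(d-1)) times the sum of the p^(d j) for j < m / d; the first factor produces a value in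
  \<open>K\<close>, on which each p^(d j)-th power is the identity.\<close>

lemma norm_eq:
  assumes "x \<in> carrier R" "k \<in> K"
  shows "(k \<ominus> x) [^] (\<Sum>i<m. p ^ i) = eval (Irr K x) k [^] (m div frob_order x)"
proof -
  define d where "d = frob_order x"
  define y where "y = eval (Irr K x) k"
  have kc: "k \<in> carrier R" using assms K_carrier by auto
  have yK: "y \<in> K"
    unfolding y_def using Irr_in_irr[OF assms(1)] assms(2) 
    by (intro ring.eval_in_carrier[OF subring_is_ring[OF K_subring], simplified, unfolded eval_consistent[OF K_subring]])
      (auto dest: monic_set[OF irrD(1)])
  have yc: "y \<in> carrier R" using yK K_carrier by auto
  have "(\<Sum>i<d * n. p ^ i) = (\<Sum>i<d. p ^ i) * (\<Sum>j<n. p ^ (d * j))" for n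
  proof (induction n)
    case (Suc n)
    have split: "(\<Sum>i<a + b. f i) = (\<Sum>i<a. f i) + (\<Sum>i<b. f (a + i))" for a b and f :: "nat \<Rightarrow> nat"
      by (induction b) auto
    have "(\<Sum>i<d * Suc n. p ^ i) = (\<Sum>i<d * n. p ^ i) + (\<Sum>i<d. p ^ (d * n + i))"
      by (subst split[symmetric]) (simp add: algebra_simps)
    also have "(\<Sum>i<d. p ^ (d * n + i)) = (\<Sum>i<d. p ^ i) * p ^ (d * n)"
      by (simp add: power_add sum_distrib_right mult.commute)
    finally show ?case using Suc by (simp add: algebra_simps)
  qed simp
  hence "(\<Sum>i<m. p ^ i) = (\<Sum>i<d. p ^ i) * (\<Sum>j<m div d. p ^ (d * j))"
    using frob_order_dvd[OF assms(1)] by (metis d_def dvd_mult_div_cancel)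
  hence "(k \<ominus> x) [^] (\<Sum>i<m. p ^ i) = y [^] (\<Sum>j<m div d. p ^ (d * j))"
    unfolding y_def eval_Irr_K[OF assms] using assms kc by (simp add: nat_pow_pow d_def)
  also have "\<dots> = y [^] (m div d)"
  proof -
    have "y [^] (\<Sum>j<n. p ^ (d * j)) = y [^] n" for n
      using yc K_pow[OF yK] by (induction n) (simp_all add: nat_pow_mult[symmetric])
    thus ?thesis .
  qed
  finally show ?thesis by (simp add: y_def d_def)
qed

text \<open>By \<open>Irr_image\<close> these are exactly the minimal polynomials of the elements of
  R.\<close>

definition irr_dvd :: "'a list set" where
  "irr_dvd = {P \<in> irr. Polynomials.degree P dvd m}"

lemma irr_dvd_bij: "bij_betw fst (prime_powers m) irr_dvd"
  unfolding bij_betw_def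
proof (intro conjI)
  show "inj_on fst (prime_powers m)"
  proof (rule inj_onI)
    fix x y assume xy: "x \<in> prime_powers m" "y \<in> prime_powers m" "fst x = fst y"
    obtain P k l where P: "x = (P, k)" "y = (P, l)" using xy(3) by (cases x; cases y) auto
    have "k * Polynomials.degree P = l * Polynomials.degree P" "Polynomials.degree P \<ge> 1"
      using xy irr_degree[of P] unfolding P prime_powers_def by auto
    hence "k = l" using mult_cancel2[of k "Polynomials.degree P" l] by linarith
    thus "x = y" using P by simp
  qed
  show "fst ` prime_powers m = irr_dvd"
  proof (intro equalityI subsetI)
    fix P assume "P \<in> irr_dvd"
    hence P: "P \<in> irr" and "Polynomials.degree P dvd m" by (auto simp: irr_dvd_def)
    then obtain k where k: "m = k * Polynomials.degree P" by (auto simp: dvd_def mult.commute)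
    hence "k \<noteq> 0" using m_pos by auto
    hence "(P, k) \<in> prime_powers m" using k P by (auto simp: prime_powers_def)
    thus "P \<in> fst ` prime_powers m" by force
  next
    fix P assume "P \<in> fst ` prime_powers m"
    then obtain k where "(P, k) \<in> prime_powers m" by auto
    hence P: "P \<in> irr" and k: "k * Polynomials.degree P = m" by (auto simp: prime_powers_def)
    have "Polynomials.degree P dvd m" unfolding k[symmetric] by simp
    thus "P \<in> irr_dvd" using P by (simp only: irr_dvd_def mem_Collect_eq)
  qed
qed

lemma finite_irr_dvd: "finite irr_dvd"
  using bij_betw_finite[OF irr_dvd_bij] by simp

lemma mangoldt_sum_irr_dvd:
  "mangoldt_sum lam m = (\<Sum>P\<in>irr_dvd. of_nat (Polynomials.degree P) * lam P ^ (m div Polynomials.degree P))"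
proof -
  have "(\<Sum>P\<in>irr_dvd. of_nat (Polynomials.degree P) * lam P ^ (m div Polynomials.degree P)) =
    (\<Sum>x\<in>prime_powers m. of_nat (Polynomials.degree (fst x)) * lam (fst x) ^ (m div Polynomials.degree (fst x)))"
    by (rule sum.reindex_bij_betw[OF irr_dvd_bij, symmetric])
  also have "\<dots> = mangoldt_sum lam m"
    unfolding mangoldt_sum_def
  proof (intro sum.cong refl)
    fix x assume x: "x \<in> prime_powers m"
    obtain P k where P: "x = (P, k)" by (cases x)
    have k: "k * Polynomials.degree P = m" and "Polynomials.degree P \<ge> 1"
      using x irr_degree[of P] unfolding P prime_powers_def by auto
    hence "m div Polynomials.degree P = k"
      by (subst k[symmetric]) (rule div_mult_self_is_m, linarith)
    thus "of_nat (Polynomials.degree (fst x)) * lam (fst x) ^ (m div Polynomials.degree (fst x)) =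
      (case x of (P, k) \<Rightarrow> of_nat (Polynomials.degree P) * lam P ^ k)" by (simp add: P)
  qed
  finally show ?thesis by simp
qed

text \<open>Gauss's count of irreducible polynomials: there are p^n monic polynomials of degree n,
  and the Newton identity then determines the sums one after another, each earlier term of the
  convolution being p^n.\<close>

lemma mangoldt_sum_1: "n \<ge> 1 \<Longrightarrow> mangoldt_sum (\<lambda>_. 1) n = p ^ n"
proof (induction n rule: less_induct)
  case (less n)
  have "n * p ^ n = (\<Sum>j=1..n. mangoldt_sum (\<lambda>_. 1) j * p ^ (n - j))"
    using newton_identity[of "\<lambda>_. 1::nat" n] by (simp add: card_monics)
  also have "{1..n} = insert n {1..<n}" using less.prems by auto
  also have "(\<Sum>j\<in>insert n {1..<n}. mangoldt_sum (\<lambda>_. 1) j * p ^ (n - j))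
     = mangoldt_sum (\<lambda>_. 1) n + (\<Sum>j=1..<n. mangoldt_sum (\<lambda>_. 1) j * p ^ (n - j))"
    by simp
  also have "(\<Sum>j=1..<n. mangoldt_sum (\<lambda>_. 1) j * p ^ (n - j)) = (\<Sum>j=1..<n. p ^ n)"
  proof (intro sum.cong refl)
    fix j assume j: "j \<in> {1..<n}"
    hence "mangoldt_sum (\<lambda>_. 1) j * p ^ (n - j) = p ^ j * p ^ (n - j)" using less.IH by simp
    also have "\<dots> = p ^ n" using j by (simp add: power_add[symmetric])
    finally show "mangoldt_sum (\<lambda>_. 1) j * p ^ (n - j) = p ^ n" .
  qed
  also have "\<dots> = (n - 1) * p ^ n" by simp
  finally have "n * p ^ n = mangoldt_sum (\<lambda>_. 1) n + (n - 1) * p ^ n" .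
  moreover have "n * p ^ n = p ^ n + (n - 1) * p ^ n" using less.prems by (cases n) auto
  ultimately show ?case by linarith
qed

text \<open>The orbit lies in the fibre, the fibre consists of roots of \<open>Irr K x\<close>, and
  their number is at most the degree, which is the size of the orbit.\<close>

lemma Irr_fibre: "x \<in> carrier R \<Longrightarrow> {y \<in> carrier R. Irr K y = Irr K x} = frob_orbit x"
proof -
  assume x: "x \<in> carrier R"
  have sub: "frob_orbit x \<subseteq> {y \<in> carrier R. Irr K y = Irr K x}"
    using frob_orbit_roots[OF x] Irr_eqI[OF Irr_in_irr[OF x]] by auto
  note P = irrD(1)[OF Irr_in_irr[OF x]]
  have "card {y \<in> carrier R. Irr K y = Irr K x} \<le> Polynomials.degree (Irr K x)"
  proof (rule eval_monic_eq_prod(1))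
    show "eval (Irr K x) y = \<zero>" if "y \<in> {y \<in> carrier R. Irr K y = Irr K x}" for y
      using that eval_Irr[of y] by auto
  qed (use monic_set'[OF P] monicD[OF P] in auto)
  also have "\<dots> = card (frob_orbit x)" using degree_Irr[OF x] card_frob_orbit[OF x] by simp
  finally show ?thesis using sub by (intro card_seteq[symmetric]) auto
qed

lemma sum_over_Irr:
  fixes w :: "'a list \<Rightarrow> 'c::comm_semiring_1"
  shows "(\<Sum>x\<in>carrier R. w (Irr K x)) = (\<Sum>P\<in>Irr K ` carrier R. of_nat (Polynomials.degree P) * w P)"
proof -
  have "(\<Sum>x\<in>carrier R. w (Irr K x)) = (\<Sum>P\<in>Irr K ` carrier R. \<Sum>x\<in>{x \<in> carrier R. Irr K x = P}. w (Irr K x))"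
    by (rule sum.image_gen) simp
  also have "\<dots> = (\<Sum>P\<in>Irr K ` carrier R. of_nat (Polynomials.degree P) * w P)"
  proof (intro sum.cong refl)
    fix P assume "P \<in> Irr K ` carrier R"
    then obtain x where x: "x \<in> carrier R" "P = Irr K x" by auto
    have "(\<Sum>y\<in>{y \<in> carrier R. Irr K y = P}. w (Irr K y)) = (\<Sum>y\<in>{y \<in> carrier R. Irr K y = P}. w P)"
      by (intro sum.cong) auto
    also have "\<dots> = of_nat (card (frob_orbit x)) * w P" by (simp add: x Irr_fibre)
    finally show "(\<Sum>y\<in>{y \<in> carrier R. Irr K y = P}. w (Irr K y)) = of_nat (Polynomials.degree P) * w P"
      using x card_frob_orbit[OF x(1)] degree_Irr[OF x(1)] by simp
  qed
  finally show ?thesis .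
qed

text \<open>Both sides have total degree \<open>p ^ m\<close>: the right one by the Newton identity for the
  constant weight 1, which spares a construction of roots of a given irreducible polynomial.\<close>

lemma Irr_image: "Irr K ` carrier R = irr_dvd"
proof -
  have sub: "Irr K ` carrier R \<subseteq> irr_dvd"
    using Irr_in_irr degree_Irr frob_order_dvd by (auto simp: irr_dvd_def)
  have "(\<Sum>P\<in>Irr K ` carrier R. Polynomials.degree P) = (\<Sum>P\<in>irr_dvd. Polynomials.degree P)"
    using sum_over_Irr[of "\<lambda>_. 1::nat"] mangoldt_sum_irr_dvd[of "\<lambda>_. 1::nat"] mangoldt_sum_1[of m] m_pos card_R
    by simp
  moreover have "(\<Sum>P\<in>irr_dvd. Polynomials.degree P) =
    (\<Sum>P\<in>Irr K ` carrier R. Polynomials.degree P) + (\<Sum>P\<in>irr_dvd - Irr K ` carrier R. Polynomials.degree P)"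
    using sum.subset_diff[OF sub finite_irr_dvd] by (simp add: add.commute)
  ultimately have "(\<Sum>P\<in>irr_dvd - Irr K ` carrier R. Polynomials.degree P) = 0" by linarith
  hence deg: "Polynomials.degree P = 0" if "P \<in> irr_dvd - Irr K ` carrier R" for P
    using that finite_irr_dvd sum_eq_0_iff[of "irr_dvd - Irr K ` carrier R" Polynomials.degree]
    by (metis (no_types, lifting) finite_Diff)
  have "P \<in> Irr K ` carrier R" if "P \<in> irr_dvd" for P
  proof (rule ccontr)
    assume "P \<notin> Irr K ` carrier R"
    hence "Polynomials.degree P = 0" using that by (intro deg) simp
    moreover have "P \<in> irr" using that by (simp add: irr_dvd_def)
    ultimately show False using irr_degree[of P] by linarith
  qed
  thus ?thesis using sub by blast
qed

text \<open>Grouping the elements of R by minimal polynomial meets each prime P of degree dividing m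
  exactly deg P times. This is the passage from Euler products to sums over R.\<close>

theorem mangoldt_sum_eq:
  fixes lam :: "'a list \<Rightarrow> 'c::comm_semiring_1"
  shows "mangoldt_sum lam m = (\<Sum>x\<in>carrier R. lam (Irr K x) ^ (m div Polynomials.degree (Irr K x)))"
  unfolding sum_over_Irr[of "\<lambda>P. lam P ^ (m div Polynomials.degree P)"] Irr_image
  by (rule mangoldt_sum_irr_dvd)

end

section \<open>Cubic characters and Jacobi sums\<close>

definition omega :: complex where "omega = Complex (- 1 / 2) (sqrt 3 / 2)"

lemma omega_sq: "omega * omega = cnj omega"
  by (simp add: omega_def complex_eq_iff)

lemma omega_cnj: "omega * cnj omega = 1" "cnj omega * omega = 1"
  by (simp_all add: omega_def complex_eq_iff)

lemma omega_cnj_sq: "cnj omega * cnj omega = omega"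
  by (simp add: omega_def complex_eq_iff)

lemma omega_sum: "1 + omega + cnj omega = 0"
  by (simp add: omega_def complex_eq_iff)

lemma omega_neq: "omega \<noteq> 1" "cnj omega \<noteq> 1" "omega \<noteq> 0"
  by (auto simp: omega_def complex_eq_iff)

definition eisenstein :: "complex set" where
  "eisenstein = {of_int a + of_int b * omega | a b. True}"

lemma eisenstein_add: "x \<in> eisenstein \<Longrightarrow> y \<in> eisenstein \<Longrightarrow> x + y \<in> eisenstein"
proof -
  assume "x \<in> eisenstein" "y \<in> eisenstein"
  then obtain a b c d where "x = of_int a + of_int b * omega" "y = of_int c + of_int d * omega"
    by (auto simp: eisenstein_def)
  hence "x + y = of_int (a + c) + of_int (b + d) * omega" by (simp add: algebra_simps)
  thus ?thesis unfolding eisenstein_def by blast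
qed

lemma eisenstein_sum: "(\<And>x. x \<in> A \<Longrightarrow> f x \<in> eisenstein) \<Longrightarrow> sum f A \<in> eisenstein"
proof (induction A rule: infinite_finite_induct)
  case empty
  show ?case unfolding eisenstein_def by (auto intro: exI[of _ 0])
next
  case (infinite A)
  show ?case using infinite(1) unfolding eisenstein_def by (auto intro: exI[of _ 0])
qed (auto intro: eisenstein_add)

lemma cube_roots_eisenstein: "{0, 1, omega, cnj omega} \<subseteq> eisenstein"
proof -
  have "0 = of_int 0 + of_int 0 * omega" "1 = of_int 1 + of_int 0 * omega" "omega = of_int 0 + of_int 1 * omega"
    "cnj omega = of_int (-1) + of_int (-1) * omega"
    using omega_sum by (auto simp: algebra_simps add_eq_0_iff)
  thus ?thesis unfolding eisenstein_def by blast
qed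

text \<open>If g^e were 1, the powers of g would take at most e values, but more than e nonzero
  elements have to be reached.\<close>

lemma (in field) exists_generator:
  assumes fin: "finite (carrier R)" and e_pos: "e > 0" and card: "card (carrier R) > e + 1"
  obtains g where "g \<in> carrier R - {\<zero>}" "carrier R - {\<zero>} = {g [^] i | i::nat. True}" "g [^] (e::nat) \<noteq> \<one>"
proof -
  obtain g where g: "g \<in> carrier R - {\<zero>}" "carrier R - {\<zero>} = {g [^] i | i::nat. True}"
    using finite_field_mult_group_has_gen[OF fin] by (auto simp: mult_of_simps)
  have "g [^] e \<noteq> \<one>"
  proof
    assume ge: "g [^] e = \<one>"
    have gc: "g \<in> carrier R" using g(1) by simp
    have "carrier R - {\<zero>} \<subseteq> (\<lambda>i. g [^] i) ` {..<e}"
    proof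
      fix x assume "x \<in> carrier R - {\<zero>}"
      then obtain i :: nat where i: "x = g [^] i" using g(2) by auto
      have "x = g [^] (e * (i div e) + i mod e)" using i by simp
      also have "\<dots> = (g [^] e) [^] (i div e) \<otimes> g [^] (i mod e)"
        using gc by (simp only: nat_pow_pow nat_pow_mult)
      also have "\<dots> = g [^] (i mod e)" using gc by (simp add: ge)
      finally show "x \<in> (\<lambda>i. g [^] i) ` {..<e}" using e_pos by auto
    qed
    hence "card (carrier R - {\<zero>}) \<le> card ((\<lambda>i. g [^] i) ` {..<e})" by (rule card_mono[rotated]) simp
    also have "\<dots> \<le> e" using card_image_le[of "{..<e}" "\<lambda>i. g [^] i"] by simp
    finally have "card (carrier R - {\<zero>}) \<le> e" .
    moreover have "card (carrier R - {\<zero>}) = card (carrier R) - 1" by (rule card_Diff_singleton) simp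
    ultimately show False using card by linarith
  qed
  thus ?thesis using that g by blast
qed

definition (in ring) cubes :: "'a set" where "cubes = {x [^] (3::nat) | x. x \<in> carrier R - {\<zero>}}"

text \<open>The number N of the overview.\<close>

definition (in ring) consecutive_cubes :: nat where "consecutive_cubes = card {x. x \<in> cubes \<and> x \<oplus> \<one> \<in> cubes}"

text \<open>The parameter \<open>z\<close> decides which cube root of unity is sent to
  \<open>omega\<close>, that is, between a cubic character and its conjugate. Fixing it from outside
  allows compatible characters on R and on its prime field.\<close>

locale cubic_field = field R for R (structure) +
  fixes e :: nat and z :: 'a
  assumes fin [simp, intro]: "finite (carrier R)" and card: "card (carrier R) = 3 * e + 1"
    and z: "z \<in> carrier R" "z [^] (3::nat) = \<one>" "z \<noteq> \<one>"
begin

text \<open>On the group {1, z, z^2} this is the homomorphism with z sent to \<open>omega\<close>.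
  The last branch is meant for z^2; no value outside 0 and this group occurs as x^e.\<close>

definition h :: "'a \<Rightarrow> complex" where
  "h u = (if u = \<zero> then 0 else if u = \<one> then 1 else if u = z then omega else cnj omega)"

text \<open>The cubic residue character: q - 1 = 3 e makes x^e a cube root of unity for nonzero
  x.\<close>

definition chi :: "'a \<Rightarrow> complex" where "chi x = h (x [^] e)"

text \<open>Since \<open>-1\<close> is a cube, \<open>x + 1\<close> may stand for the \<open>1 - x\<close> of the usual Jacobi sum.\<close>

definition J :: complex where "J = (\<Sum>x\<in>carrier R. chi x * chi (x \<oplus> \<one>))"

lemma nz: "z \<noteq> \<zero>"
proof
  assume "z = \<zero>"
  hence "\<zero> [^] (3::nat) = \<one>" using z(2) by (simp only:)
  thus False by (simp add: nat_pow_zero)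
qed

lemma zz: "z \<otimes> z \<noteq> \<one>" "z \<otimes> z \<noteq> z" "z \<otimes> z \<noteq> \<zero>" "z \<otimes> (z \<otimes> z) = \<one>" "z \<otimes> z \<otimes> z = \<one>"
proof -
  show 1: "z \<otimes> (z \<otimes> z) = \<one>" using z by (simp add: numeral_3_eq_3 m_assoc)
  show "z \<otimes> z \<otimes> z = \<one>" using 1 z by (simp add: m_assoc)
  show "z \<otimes> z \<noteq> \<one>" using 1 z by auto
  show "z \<otimes> z \<noteq> z" using m_lcancel[of z z \<one>] nz z by auto
  show "z \<otimes> z \<noteq> \<zero>" using nz z integral by blast
qed

lemma e_pos: "e > 0"
proof (rule ccontr)
  assume "\<not> e > 0"
  hence "card (carrier R) = 1" using card by simp
  then obtain w where "carrier R = {w}" by (rule card_1_singletonE)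
  thus False using z nz one_closed zero_closed by auto
qed

lemma cube_roots: "u \<in> carrier R \<Longrightarrow> u [^] (3::nat) = \<one> \<Longrightarrow> u \<in> {\<one>, z, z \<otimes> z}"
proof -
  assume u: "u \<in> carrier R" "u [^] (3::nat) = \<one>"
  have cc: "card {x \<in> carrier R. x [^] (3::nat) = \<one>} \<le> 3"
    by (rule num_roots_le_deg) auto
  have "(z \<otimes> z) [^] (3::nat) = \<one>" using z by (simp add: nat_pow_distrib)
  hence sub: "{\<one>, z, z \<otimes> z} \<subseteq> {x \<in> carrier R. x [^] (3::nat) = \<one>}" using z by auto
  have "card {\<one>, z, z \<otimes> z} = 3" using z zz by auto
  hence "{\<one>, z, z \<otimes> z} = {x \<in> carrier R. x [^] (3::nat) = \<one>}"
    using cc by (intro card_seteq[OF _ sub]) auto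
  thus ?thesis using u by auto
qed

lemma pow_3e: "x \<in> carrier R \<Longrightarrow> x \<noteq> \<zero> \<Longrightarrow> x [^] (3 * e) = \<one>"
proof -
  assume x: "x \<in> carrier R" "x \<noteq> \<zero>"
  interpret G: group "Multiplicative_Group.mult_of R" by (rule field_mult_group)
  show ?thesis
    using G.pow_order_eq_1[of x] x order_mult_of[OF fin]
    by (simp add: Coset.order_def card mult_of_simps)
qed

lemma pow_e_root: "x \<in> carrier R \<Longrightarrow> x \<noteq> \<zero> \<Longrightarrow> x [^] e \<in> {\<one>, z, z \<otimes> z}"
  using pow_3e[of x] by (intro cube_roots) (auto simp: nat_pow_pow mult.commute)

lemma h_mult:
  assumes "u \<in> {\<one>, z, z \<otimes> z}" "v \<in> {\<one>, z, z \<otimes> z}"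
  shows "h (u \<otimes> v) = h u * h v"
proof -
  have "(z \<otimes> z) \<otimes> (z \<otimes> z) = (z \<otimes> z \<otimes> z) \<otimes> z" using z(1) by (simp add: m_assoc)
  hence zzzz: "(z \<otimes> z) \<otimes> (z \<otimes> z) = z" using z(1) zz(5) by simp
  have zzc: "z \<otimes> z \<in> carrier R" using z(1) by simp
  have h: "h \<one> = 1" "h z = omega" "h (z \<otimes> z) = cnj omega" using z zz nz by (simp_all add: h_def)
  note simps = h zz(4,5) zzzz omega_sq omega_cnj omega_cnj_sq mult_1 mult_1_right
    l_one[OF one_closed] l_one[OF z(1)] r_one[OF z(1)] l_one[OF zzc] r_one[OF zzc]
  show ?thesis using assms unfolding insert_iff empty_iff by (elim disjE) (simp_all only: simps)
qed

lemma chi_0 [simp]: "chi \<zero> = 0"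
  using e_pos by (simp add: chi_def h_def nat_pow_zero)

lemma chi_1 [simp]: "chi \<one> = 1"
  by (simp add: chi_def h_def)

lemma chi_mult: "x \<in> carrier R \<Longrightarrow> y \<in> carrier R \<Longrightarrow> chi (x \<otimes> y) = chi x * chi y"
proof -
  assume xy: "x \<in> carrier R" "y \<in> carrier R"
  show ?thesis
  proof (cases "x = \<zero> \<or> y = \<zero>")
    case False
    have "chi (x \<otimes> y) = h (x [^] e \<otimes> y [^] e)" using xy by (simp add: chi_def nat_pow_distrib)
    also have "\<dots> = chi x * chi y"
      unfolding chi_def using False xy by (intro h_mult pow_e_root) auto
    finally show ?thesis .
  qed (use xy in auto)
qed

lemma chi_range: "x \<in> carrier R \<Longrightarrow> x \<noteq> \<zero> \<Longrightarrow> chi x \<in> {1, omega, cnj omega}"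
  using pow_e_root[of x] z zz by (auto simp: chi_def h_def)

lemma chi_range': "x \<in> carrier R \<Longrightarrow> chi x \<in> {0, 1, omega, cnj omega}"
  using chi_range[of x] by (cases "x = \<zero>") auto

lemma chi_sq: "x \<in> carrier R \<Longrightarrow> chi x * chi x = cnj (chi x)"
  using chi_range'[of x] by (auto simp: omega_sq omega_cnj_sq)

lemma chi_cnj: "x \<in> carrier R \<Longrightarrow> x \<noteq> \<zero> \<Longrightarrow> chi x * cnj (chi x) = 1"
  using chi_range[of x] by (auto simp: omega_cnj)

lemma chi_inv: "x \<in> carrier R \<Longrightarrow> x \<noteq> \<zero> \<Longrightarrow> chi (inv x) = cnj (chi x)"
proof -
  assume x: "x \<in> carrier R" "x \<noteq> \<zero>"
  have xi: "inv x \<in> carrier R" "x \<otimes> inv x = \<one>" using x by (auto simp: field_Units)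
  have "chi x * chi (inv x) = 1" using chi_mult[OF x(1) xi(1)] xi(2) by simp
  hence "cnj (chi x) = (chi x * cnj (chi x)) * chi (inv x)" by (simp add: mult_ac)
  thus ?thesis using chi_cnj[OF x] by simp
qed

lemma generator: obtains g where "g \<in> carrier R - {\<zero>}" "carrier R - {\<zero>} = {g [^] i | i::nat. True}" "g [^] e \<noteq> \<one>"
proof -
  have c: "card (carrier R) > e + 1" using card e_pos by simp
  show ?thesis by (rule exists_generator[OF fin e_pos c]) (rule that)
qed

lemma cubes_carrier: "cubes \<subseteq> carrier R - {\<zero>}"
proof
  fix c assume "c \<in> cubes"
  then obtain x where x: "x \<in> carrier R" "x \<noteq> \<zero>" "c = x [^] (3::nat)" by (auto simp: cubes_def)
  have "c \<noteq> \<zero>"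
  proof
    assume "c = \<zero>"
    hence "x [^] (3::nat) = \<zero>" using x(3) by (rule trans[OF sym, rotated])
    hence "x = \<zero>" by (rule pow_eq_zero[OF _ x(1)])
    thus False using x(2) by contradiction
  qed
  thus "c \<in> carrier R - {\<zero>}" using x by simp
qed

text \<open>A generator g has chi g different from 1, hence of order 3, so chi (g^i) = 1 forces 3 to
  divide i.\<close>

lemma chi_eq_1_iff:
  assumes x: "x \<in> carrier R" "x \<noteq> \<zero>"
  shows "chi x = 1 \<longleftrightarrow> x \<in> cubes"
proof
  assume "x \<in> cubes"
  then obtain y where y: "y \<in> carrier R" "y \<noteq> \<zero>" "x = y [^] (3::nat)" by (auto simp: cubes_def)
  have "x [^] e = y [^] (3 * e)" using y by (simp add: nat_pow_pow)
  thus "chi x = 1" using pow_3e[OF y(1,2)] by (simp add: chi_def h_def)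
next
  assume "chi x = 1"
  obtain g where g: "g \<in> carrier R - {\<zero>}" "carrier R - {\<zero>} = {g [^] i | i::nat. True}" "g [^] e \<noteq> \<one>"
    by (rule generator)
  have gc: "g \<in> carrier R" "g \<noteq> \<zero>" using g(1) by auto
  have chig: "chi (g [^] i) = chi g ^ i" for i :: nat
    using gc by (induction i) (auto simp: chi_mult)
  obtain i :: nat where i: "x = g [^] i" using g(2) x by auto
  have cg: "chi g \<in> {omega, cnj omega}"
    using pow_e_root[OF gc] g(3) by (auto simp: chi_def h_def nz zz z)
  hence c3: "chi g ^ 3 = 1" by (auto simp: numeral_3_eq_3 omega_sq omega_cnj omega_cnj_sq)
  have "chi g ^ i = chi g ^ (3 * (i div 3) + i mod 3)" by simp
  also have "\<dots> = chi g ^ (i mod 3)" by (simp only: power_add power_mult c3 power_one mult_1)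
  finally have "chi g ^ (i mod 3) = 1" using \<open>chi x = 1\<close> chig i by simp
  moreover have "i mod 3 \<in> {0, 1, 2}" by auto
  ultimately have "i mod 3 = 0" using cg omega_neq by (auto simp: power2_eq_square omega_sq omega_cnj_sq)
  hence "i div 3 * 3 = i" by auto
  hence "x = (g [^] (i div 3)) [^] (3::nat)"
    using gc by (simp add: i nat_pow_pow)
  moreover have "g [^] (i div 3) \<in> carrier R - {\<zero>}" using g(2) by blast
  ultimately show "x \<in> cubes" by (auto simp: cubes_def)
qed

lemma minus_add_cancel': "x \<in> carrier R \<Longrightarrow> c \<in> carrier R \<Longrightarrow> (x \<ominus> c) \<oplus> c = x"
  by (simp add: a_minus_def a_assoc l_neg)

lemma add_minus_cancel': "x \<in> carrier R \<Longrightarrow> c \<in> carrier R \<Longrightarrow> (x \<oplus> c) \<ominus> c = x"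
  by (simp add: a_minus_def a_assoc r_neg)

lemma sum_translate:
  assumes "c \<in> carrier R"
  shows "(\<Sum>x\<in>carrier R. f (x \<oplus> c)) = (\<Sum>x\<in>carrier R. f x)"
  using assms
  by (intro sum.reindex_bij_witness[of _ "\<lambda>x. x \<ominus> c" "\<lambda>x. x \<oplus> c"])
     (auto simp: minus_add_cancel' add_minus_cancel')

lemma inv_closed': "c \<in> carrier R \<Longrightarrow> c \<noteq> \<zero> \<Longrightarrow> inv c \<in> carrier R"
  and inv_l: "c \<in> carrier R \<Longrightarrow> c \<noteq> \<zero> \<Longrightarrow> inv c \<otimes> c = \<one>"
  and inv_r: "c \<in> carrier R \<Longrightarrow> c \<noteq> \<zero> \<Longrightarrow> c \<otimes> inv c = \<one>"
  by (auto simp: field_Units)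

lemma cancel_inv:
  assumes "c \<in> carrier R" "c \<noteq> \<zero>" "x \<in> carrier R"
  shows "c \<otimes> (inv c \<otimes> x) = x" "inv c \<otimes> (c \<otimes> x) = x"
  using assms by (simp_all add: m_assoc[symmetric] inv_l inv_r inv_closed')

lemma sum_scale:
  assumes "c \<in> carrier R" "c \<noteq> \<zero>"
  shows "(\<Sum>x\<in>carrier R. f (c \<otimes> x)) = (\<Sum>x\<in>carrier R. f x)"
  using assms
  by (intro sum.reindex_bij_witness[of _ "\<lambda>x. inv c \<otimes> x" "\<lambda>x. c \<otimes> x"])
     (auto simp: cancel_inv inv_closed')

text \<open>Multiplication by some g with chi g different from 1 permutes the field and multiplies
  the sum by chi g.\<close>

lemma sum_chi: "(\<Sum>x\<in>carrier R. chi x) = 0"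
proof -
  obtain g where g: "g \<in> carrier R - {\<zero>}" "g [^] e \<noteq> \<one>" using generator by metis
  have cg: "chi g \<noteq> 1"
    using pow_e_root[of g] g omega_neq by (auto simp: chi_def h_def)
  have "(\<Sum>x\<in>carrier R. chi x) = (\<Sum>x\<in>carrier R. chi (g \<otimes> x))"
    using g by (intro sum_scale[symmetric]) auto
  also have "\<dots> = chi g * (\<Sum>x\<in>carrier R. chi x)"
    unfolding sum_distrib_left using g by (intro sum.cong) (auto simp: chi_mult)
  finally have "(1 - chi g) * (\<Sum>x\<in>carrier R. chi x) = 0" by (simp add: algebra_simps)
  thus ?thesis using cg by simp
qed

lemma sum_cnj_chi: "(\<Sum>x\<in>carrier R. cnj (chi x)) = 0"
  using arg_cong[OF sum_chi, of cnj] by simp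

text \<open>For nonzero x the summand is the conjugate of chi (1 + c / x), and 1 + c / x runs
  through everything except 1. The full sum vanishes, so the omitted value chi 1 = 1 leaves
  -1.\<close>

lemma sum_chi_cnj_shift:
  assumes c: "c \<in> carrier R" "c \<noteq> \<zero>"
  shows "(\<Sum>x\<in>carrier R. chi x * cnj (chi (x \<oplus> c))) = -1"
proof -
  have "(\<Sum>x\<in>carrier R. chi x * cnj (chi (x \<oplus> c)))
      = (\<Sum>x\<in>carrier R - {\<zero>}. chi x * cnj (chi (x \<oplus> c)))"
    by (rule sum.mono_neutral_right) auto
  also have "\<dots> = (\<Sum>w\<in>carrier R - {\<one>}. cnj (chi w))"
  proof (rule sum.reindex_bij_witness[of _ "\<lambda>w. c \<otimes> inv (w \<ominus> \<one>)" "\<lambda>x. inv x \<otimes> c \<oplus> \<one>"])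
    fix x assume "x \<in> carrier R - {\<zero>}"
    hence x: "x \<in> carrier R" "x \<noteq> \<zero>" by auto
    have xi: "inv x \<in> carrier R" "inv x \<noteq> \<zero>" using x inv_r[OF x] by (auto simp: inv_closed')
    have xc: "inv x \<otimes> c \<in> carrier R" "inv x \<otimes> c \<noteq> \<zero>" using xi c integral by auto
    show "inv x \<otimes> c \<oplus> \<one> \<in> carrier R - {\<one>}" using xc by (simp add: add.l_cancel_one)
    have eq: "inv x \<otimes> c \<oplus> \<one> \<ominus> \<one> = inv x \<otimes> c" using xc by (simp add: add_minus_cancel')
    have "inv (inv x \<otimes> c) = x \<otimes> inv c"
    proof (rule comm_inv_char)
      have "inv x \<otimes> c \<otimes> (x \<otimes> inv c) = (inv x \<otimes> x) \<otimes> (c \<otimes> inv c)"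
        using x xi c by (simp add: m_ac inv_closed')
      thus "inv x \<otimes> c \<otimes> (x \<otimes> inv c) = \<one>" using x c by (simp add: inv_l inv_r)
    qed (use x c xc in \<open>auto simp: inv_closed'\<close>)
    hence "c \<otimes> inv (inv x \<otimes> c) = c \<otimes> (inv c \<otimes> x)" using x c by (simp add: m_comm inv_closed')
    thus "c \<otimes> inv (inv x \<otimes> c \<oplus> \<one> \<ominus> \<one>) = x" unfolding eq using cancel_inv(1)[OF c x(1)] by simp
    have "x \<otimes> (inv x \<otimes> c \<oplus> \<one>) = x \<oplus> c"
      using x xi c by (simp add: r_distr cancel_inv a_comm)
    hence "chi (x \<oplus> c) = chi x * chi (inv x \<otimes> c \<oplus> \<one>)"
      using chi_mult[of x "inv x \<otimes> c \<oplus> \<one>"] x xc by simp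
    thus "cnj (chi (inv x \<otimes> c \<oplus> \<one>)) = chi x * cnj (chi (x \<oplus> c))"
      using chi_cnj[OF x] by (simp add: mult.assoc[symmetric])
  next
    fix w assume "w \<in> carrier R - {\<one>}"
    hence w: "w \<in> carrier R" "w \<noteq> \<one>" by auto
    hence w1: "w \<ominus> \<one> \<in> carrier R" "w \<ominus> \<one> \<noteq> \<zero>" by auto
    have wi: "inv (w \<ominus> \<one>) \<in> carrier R" "inv (w \<ominus> \<one>) \<noteq> \<zero>"
      using w1 inv_r[OF w1] by (auto simp: inv_closed')
    have cw: "c \<otimes> inv (w \<ominus> \<one>) \<in> carrier R" "c \<otimes> inv (w \<ominus> \<one>) \<noteq> \<zero>"
      using wi c integral by auto
    show "c \<otimes> inv (w \<ominus> \<one>) \<in> carrier R - {\<zero>}" using cw by simp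
    have "inv (c \<otimes> inv (w \<ominus> \<one>)) = inv c \<otimes> (w \<ominus> \<one>)"
    proof (rule comm_inv_char)
      have "c \<otimes> inv (w \<ominus> \<one>) \<otimes> (inv c \<otimes> (w \<ominus> \<one>)) = (inv c \<otimes> c) \<otimes> ((w \<ominus> \<one>) \<otimes> inv (w \<ominus> \<one>))"
        using w1 wi c by (simp add: m_ac inv_closed')
      thus "c \<otimes> inv (w \<ominus> \<one>) \<otimes> (inv c \<otimes> (w \<ominus> \<one>)) = \<one>" using w1 c by (simp add: inv_l inv_r)
    qed (use w1 c cw in \<open>auto simp: inv_closed'\<close>)
    hence "inv (c \<otimes> inv (w \<ominus> \<one>)) \<otimes> c = c \<otimes> (inv c \<otimes> (w \<ominus> \<one>))"
      using w1 c by (simp add: m_comm inv_closed')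
    thus "inv (c \<otimes> inv (w \<ominus> \<one>)) \<otimes> c \<oplus> \<one> = w"
      using cancel_inv(1)[OF c w1(1)] w by (simp add: minus_add_cancel')
  qed
  also have "\<dots> = (\<Sum>w\<in>carrier R. cnj (chi w)) - 1"
    using sum.remove[of "carrier R" \<one> "\<lambda>w. cnj (chi w)"] by simp
  finally show ?thesis by (simp add: sum_cnj_chi)
qed

text \<open>Orthogonality over the three characters of order dividing 3; it turns the condition of
  being a cube into a character sum.\<close>

lemma chi_cube: "x \<in> carrier R \<Longrightarrow> x \<noteq> \<zero> \<Longrightarrow> 1 + chi x + cnj (chi x) = (if x \<in> cubes then 3 else 0)"
proof -
  assume x: "x \<in> carrier R" "x \<noteq> \<zero>"
  show ?thesis
  proof (cases "x \<in> cubes")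
    case True
    hence "chi x = 1" using chi_eq_1_iff[OF x] by blast
    thus ?thesis using True by simp
  next
    case False
    hence "chi x \<noteq> 1" using chi_eq_1_iff[OF x] by blast
    hence "chi x = omega \<or> chi x = cnj omega" using chi_range[OF x] by blast
    moreover have "1 + cnj omega + omega = 0" using omega_sum by (simp add: add_ac)
    ultimately show ?thesis using False omega_sum by (elim disjE) simp_all
  qed
qed

text \<open>Expand t(x) t(x + 1) into nine terms: the constant gives q, the four single characters
  cancel, the two mixed products give -1 each, and the others are J and its conjugate. The count
  contributes 9 for each admissible x plus 6 from two exceptional points, whence q - 2 - 6.\<close>

lemma consecutive_cubes_eq: "9 * of_nat consecutive_cubes = of_nat (card (carrier R)) - 8 + (J + cnj J)"
proof -
  define t where "t x = 1 + chi x + cnj (chi x)" for x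
  define m1 where "m1 = \<ominus> \<one>"
  have m1: "m1 \<in> carrier R" "m1 \<oplus> \<one> = \<zero>" "m1 \<noteq> \<zero>"
  proof -
    show "m1 \<in> carrier R" "m1 \<oplus> \<one> = \<zero>" by (simp_all add: m1_def l_neg)
    thus "m1 \<noteq> \<zero>" by auto
  qed
  have m1': "x = m1" if "x \<in> carrier R" "x \<oplus> \<one> = \<zero>" for x
    unfolding m1_def by (rule minus_equality[symmetric]) (use that in simp_all)
  have m1_cube: "m1 = m1 [^] (3::nat)"
  proof -
    have "m1 \<otimes> m1 = \<one>" by (simp add: m1_def l_minus r_minus)
    thus ?thesis using m1(1) by (simp add: numeral_3_eq_3)
  qed
  have m1c: "m1 \<in> cubes"
    unfolding cubes_def by (rule CollectI, rule exI[of _ m1]) (use m1 m1_cube in blast)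
  have tm1: "t m1 = 3" using chi_cube[OF m1(1,3)] m1c by (simp add: t_def)
  have t01: "t \<zero> = 1" "t \<one> = 3" by (simp_all add: t_def)
  let ?A = "{x. x \<in> cubes \<and> x \<oplus> \<one> \<in> cubes}"
  have A: "?A \<subseteq> carrier R - {\<zero>, m1}" using cubes_carrier m1(2) by auto
  \<comment> \<open>At 0 the function \<open>t\<close> has value 1 although 0 is not a counted cube,
    so x = 0 and x = -1 each contribute 1 * 3.\<close>
  have "(\<Sum>x\<in>carrier R. t x * t (x \<oplus> \<one>)) = 3 + (3 + (\<Sum>x\<in>carrier R - {\<zero>} - {m1}. t x * t (x \<oplus> \<one>)))"
    using m1 by (simp add: sum.remove[of "carrier R" \<zero>] sum.remove[of "carrier R - {\<zero>}" m1] t01 tm1)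
  also have "(\<Sum>x\<in>carrier R - {\<zero>} - {m1}. t x * t (x \<oplus> \<one>)) = (\<Sum>x\<in>carrier R - {\<zero>} - {m1}. if x \<in> ?A then 9 else 0)"
  proof (intro sum.cong refl)
    fix x assume "x \<in> carrier R - {\<zero>} - {m1}"
    hence "x \<in> carrier R" "x \<noteq> \<zero>" "x \<oplus> \<one> \<in> carrier R" "x \<oplus> \<one> \<noteq> \<zero>" using m1' by auto
    thus "t x * t (x \<oplus> \<one>) = (if x \<in> ?A then 9 else 0)" by (simp add: t_def chi_cube)
  qed
  also have "\<dots> = (\<Sum>x\<in>?A. 9)"
  proof -
    have "(carrier R - {\<zero>} - {m1}) \<inter> ?A = ?A" using A by blast
    thus ?thesis using sum.inter_restrict[of "carrier R - {\<zero>} - {m1}" "\<lambda>_. 9 :: complex" ?A] by simp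
  qed
  also have "\<dots> = 9 * of_nat consecutive_cubes" by (simp add: consecutive_cubes_def)
  finally have 1: "(\<Sum>x\<in>carrier R. t x * t (x \<oplus> \<one>)) = 6 + 9 * of_nat consecutive_cubes" by simp
  have "(\<Sum>x\<in>carrier R. t x * t (x \<oplus> \<one>)) = (\<Sum>x\<in>carrier R. 1 + chi x + cnj (chi x)
      + chi (x \<oplus> \<one>) + cnj (chi (x \<oplus> \<one>)) + chi x * chi (x \<oplus> \<one>) + cnj (chi x * chi (x \<oplus> \<one>))
      + chi x * cnj (chi (x \<oplus> \<one>)) + cnj (chi x * cnj (chi (x \<oplus> \<one>))))"
    by (intro sum.cong refl) (simp add: t_def algebra_simps)
  also have "\<dots> = of_nat (card (carrier R)) + (J + cnj J) - 2"
    using sum_translate[of \<one> chi] sum_translate[of \<one> "\<lambda>x. cnj (chi x)"] sum_chi sum_cnj_chi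
      sum_chi_cnj_shift[of \<one>]
    by (simp only: sum.distrib cnj_sum[symmetric]) (simp add: J_def)
  finally show ?thesis using 1 by (simp add: algebra_simps)
qed

text \<open>The shifted sums \<open>G t = \<Sum> \<chi>(x) \<chi>(x + t)\<close> satisfy \<open>G t = cnj (\<chi> t) J\<close>; both sides of the
  claim come from evaluating \<open>\<Sum> \<bar>G t\<bar>\<^sup>2\<close> in two ways.\<close>

lemma J_norm: "J * cnj J = of_nat (card (carrier R))"
proof -
  define q :: complex where "q = of_nat (card (carrier R))"
  define G where "G t = (\<Sum>x\<in>carrier R. chi x * chi (x \<oplus> t))" for t
  have G0: "G \<zero> = 0"
    using sum_cnj_chi by (simp add: G_def chi_sq)
  have Gt: "G t = cnj (chi t) * J" if t: "t \<in> carrier R" for t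
  proof (cases "t = \<zero>")
    case False
    have "G t = (\<Sum>x\<in>carrier R. chi (t \<otimes> x) * chi (t \<otimes> x \<oplus> t))"
      unfolding G_def using t False by (intro sum_scale[symmetric])
    also have "\<dots> = (\<Sum>x\<in>carrier R. cnj (chi t) * (chi x * chi (x \<oplus> \<one>)))"
    proof (intro sum.cong refl)
      fix x assume x: "x \<in> carrier R"
      have "t \<otimes> x \<oplus> t = t \<otimes> (x \<oplus> \<one>)" using t x by (simp add: r_distr)
      thus "chi (t \<otimes> x) * chi (t \<otimes> x \<oplus> t) = cnj (chi t) * (chi x * chi (x \<oplus> \<one>))"
        using t x chi_sq[OF t] by (simp add: chi_mult mult_ac)
    qed
    finally show ?thesis by (simp add: J_def sum_distrib_left)
  qed (simp add: G0)
  have S: "(\<Sum>t\<in>carrier R. chi (x \<oplus> t) * cnj (chi (y \<oplus> t))) = (if x = y then q else 0) - 1"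
    if xy: "x \<in> carrier R" "y \<in> carrier R" for x y
  proof -
    have "(\<Sum>t\<in>carrier R. chi (x \<oplus> t) * cnj (chi (y \<oplus> t)))
       = (\<Sum>t\<in>carrier R. (\<lambda>u. chi u * cnj (chi (u \<oplus> (y \<ominus> x)))) (t \<oplus> x))"
    proof (intro sum.cong refl)
      fix t assume t: "t \<in> carrier R"
      have "t \<oplus> x \<oplus> (y \<ominus> x) = t \<oplus> (x \<oplus> (y \<ominus> x))" using t xy by (intro a_assoc) auto
      also have "x \<oplus> (y \<ominus> x) = (y \<ominus> x) \<oplus> x" using xy by (intro a_comm) auto
      also have "\<dots> = y" using xy by (intro minus_add_cancel')
      also have "t \<oplus> y = y \<oplus> t" using t xy by (intro a_comm)
      finally have "t \<oplus> x \<oplus> (y \<ominus> x) = y \<oplus> t" .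
      thus "chi (x \<oplus> t) * cnj (chi (y \<oplus> t)) = chi (t \<oplus> x) * cnj (chi (t \<oplus> x \<oplus> (y \<ominus> x)))"
        using t xy by (simp add: a_comm)
    qed
    also have "\<dots> = (\<Sum>u\<in>carrier R. chi u * cnj (chi (u \<oplus> (y \<ominus> x))))"
      using xy by (intro sum_translate)
    also have "\<dots> = (if x = y then q else 0) - 1"
    proof (cases "x = y")
      case True
      have "(\<Sum>u\<in>carrier R. chi u * cnj (chi (u \<oplus> (y \<ominus> x)))) = (\<Sum>u\<in>carrier R. if u = \<zero> then 0 else 1)"
        using True xy by (intro sum.cong) (auto simp: chi_cnj a_minus_def r_neg)
      also have "\<dots> = (\<Sum>u\<in>carrier R - {\<zero>}. 1)"
        by (subst sum.remove[of "carrier R" \<zero>]) (auto intro!: sum.cong)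
      also have "\<dots> = q - 1" using card by (simp add: q_def card_Diff_singleton)
      finally show ?thesis using True by simp
    next
      case False
      thus ?thesis using sum_chi_cnj_shift[of "y \<ominus> x"] xy by auto
    qed
    finally show ?thesis .
  qed
  have "(\<Sum>t\<in>carrier R. G t * cnj (G t)) = (\<Sum>t\<in>carrier R. if t = \<zero> then 0 else J * cnj J)"
  proof (intro sum.cong refl)
    fix t assume t: "t \<in> carrier R"
    show "G t * cnj (G t) = (if t = \<zero> then 0 else J * cnj J)"
      using t chi_cnj[OF t] by (auto simp: Gt mult_ac)
  qed
  also have "\<dots> = (\<Sum>t\<in>carrier R - {\<zero>}. J * cnj J)"
    by (subst sum.remove[of "carrier R" \<zero>]) (auto intro!: sum.cong)
  also have "\<dots> = (q - 1) * (J * cnj J)" using card by (simp add: q_def card_Diff_singleton)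
  finally have 1: "(\<Sum>t\<in>carrier R. G t * cnj (G t)) = (q - 1) * (J * cnj J)" .
  have "(\<Sum>t\<in>carrier R. G t * cnj (G t)) = (\<Sum>t\<in>carrier R. \<Sum>x\<in>carrier R. \<Sum>y\<in>carrier R.
      (chi x * cnj (chi y)) * (chi (x \<oplus> t) * cnj (chi (y \<oplus> t))))"
    unfolding G_def cnj_sum sum_product by (simp add: mult_ac)
  also have "\<dots> = (\<Sum>x\<in>carrier R. \<Sum>t\<in>carrier R. \<Sum>y\<in>carrier R.
      (chi x * cnj (chi y)) * (chi (x \<oplus> t) * cnj (chi (y \<oplus> t))))"
    by (rule sum.swap)
  also have "\<dots> = (\<Sum>x\<in>carrier R. \<Sum>y\<in>carrier R. \<Sum>t\<in>carrier R.
      (chi x * cnj (chi y)) * (chi (x \<oplus> t) * cnj (chi (y \<oplus> t))))"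
    by (rule sum.cong[OF refl]) (rule sum.swap)
  also have "\<dots> = (\<Sum>x\<in>carrier R. \<Sum>y\<in>carrier R. (if x = y then q * (chi x * cnj (chi y)) else 0) - chi x * cnj (chi y))"
    unfolding sum_distrib_left[symmetric] by (intro sum.cong refl) (auto simp: S algebra_simps)
  also have "\<dots> = (\<Sum>x\<in>carrier R. q * (chi x * cnj (chi x))) - (\<Sum>x\<in>carrier R. chi x) * (\<Sum>y\<in>carrier R. cnj (chi y))"
    by (simp add: sum_subtractf sum_product)
  also have "(\<Sum>x\<in>carrier R. q * (chi x * cnj (chi x))) = (\<Sum>x\<in>carrier R. if x = \<zero> then 0 else q)"
    by (intro sum.cong refl) (auto simp: chi_cnj)
  also have "\<dots> = (\<Sum>t\<in>carrier R - {\<zero>}. q)"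
    by (subst sum.remove[of "carrier R" \<zero>]) (auto intro!: sum.cong)
  also have "\<dots> = (q - 1) * q" using card by (simp add: q_def card_Diff_singleton)
  finally have "(q - 1) * (J * cnj J) = (q - 1) * q" using 1 by (simp add: sum_chi)
  moreover have "q - 1 \<noteq> 0" using card e_pos by (simp add: q_def)
  ultimately show ?thesis by (simp add: q_def)
qed

lemma J_eisenstein: "J \<in> eisenstein"
  unfolding J_def
proof (rule eisenstein_sum)
  fix x assume x: "x \<in> carrier R"
  have "chi x * chi (x \<oplus> \<one>) \<in> {0, 1, omega, cnj omega}"
    using chi_range'[of x] chi_range'[of "x \<oplus> \<one>"] x
    by (auto simp: omega_sq omega_cnj omega_cnj_sq)
  thus "chi x * chi (x \<oplus> \<one>) \<in> eisenstein" using cube_roots_eisenstein by blast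
qed

end

section \<open>The Hasse--Davenport relation\<close>

text \<open>For g with g^e different from 1, the element g^e works, since its cube is g^(q - 1) =
  1.\<close>

lemma (in field) exists_cube_root:
  assumes "finite (carrier R)" "card (carrier R) = 3 * e + 1" "e > 0"
  obtains z where "z \<in> carrier R" "z [^] (3::nat) = \<one>" "z \<noteq> \<one>"
proof -
  have c: "card (carrier R) > e + 1" using assms by simp
  obtain g where g: "g \<in> carrier R - {\<zero>}" "g [^] e \<noteq> \<one>"
    by (rule exists_generator[OF assms(1,3) c])
  interpret G: group "Multiplicative_Group.mult_of R" by (rule field_mult_group)
  have "g [^] (3 * e) = \<one>"
    using G.pow_order_eq_1[of g] g order_mult_of[OF assms(1)] assms(2)
    by (simp add: Coset.order_def mult_of_simps)
  hence "(g [^] e) [^] (3::nat) = \<one>" using g by (simp add: nat_pow_pow mult.commute)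
  thus ?thesis using that[of "g [^] e"] g by simp
qed

context GF begin

text \<open>The prime field as a ring of its own, so that the theory of \<open>cubic_field\<close>
  can be instantiated at it.\<close>

abbreviation Kf where "Kf \<equiv> R\<lparr>carrier := K\<rparr>"

lemma field_Kf: "field Kf"
  by (rule subfield_iff(2)[OF K_subfield])

lemma Kf_pow: "x [^]\<^bsub>Kf\<^esub> (n::nat) = x [^] n"
  by (simp add: nat_pow_def)

lemma one_zero_K: "\<one> \<in> K" "\<zero> \<in> K"
  using subringE(2,3)[OF K_subring] by auto

lemma pow_K: "x \<in> K \<Longrightarrow> x [^] (n::nat) \<in> K"
  using one_zero_K subringE(6)[OF K_subring] by (induction n) auto

lemma eval_K: "set f \<subseteq> K \<Longrightarrow> x \<in> K \<Longrightarrow> eval f x \<in> K"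
  using one_zero_K subringE(6,7)[OF K_subring] pow_K by (induction f) auto

text \<open>The two lowest coefficients are isolated because f(0) is the last one, while f(1) also
  contains the one before it with coefficient 1; see \<open>sum_lam_ge_2\<close>.\<close>

lemma monics_append2:
  "bij_betw (\<lambda>(cs, b, a). \<one> # cs @ [b, a]) ({cs. set cs \<subseteq> K \<and> length cs = n} \<times> K \<times> K) (monics (Suc (Suc n)))"
  unfolding bij_betw_def
proof (intro conjI)
  show "inj_on (\<lambda>(cs, b, a). \<one> # cs @ [b, a]) ({cs. set cs \<subseteq> K \<and> length cs = n} \<times> K \<times> K)"
    by (auto simp: inj_on_def)
  show "(\<lambda>(cs, b, a). \<one> # cs @ [b, a]) ` ({cs. set cs \<subseteq> K \<and> length cs = n} \<times> K \<times> K) = monics (Suc (Suc n))"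
  proof (intro equalityI subsetI)
    fix f assume "f \<in> monics (Suc (Suc n))"
    then obtain cs where cs: "f = \<one> # cs" "set cs \<subseteq> K" "length cs = Suc (Suc n)" by (auto simp: monics_eq)
    obtain ds a where 1: "cs = ds @ [a]" using cs(3) by (cases cs rule: rev_cases) auto
    obtain es b where 2: "ds = es @ [b]" using cs(3) 1 by (cases ds rule: rev_cases) auto
    have "f = (\<lambda>(cs, b, a). \<one> # cs @ [b, a]) (es, b, a)" by (simp add: cs 1 2)
    moreover have "(es, b, a) \<in> {cs. set cs \<subseteq> K \<and> length cs = n} \<times> K \<times> K" using cs 1 2 by auto
    ultimately show "f \<in> (\<lambda>(cs, b, a). \<one> # cs @ [b, a]) ` ({cs. set cs \<subseteq> K \<and> length cs = n} \<times> K \<times> K)"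
      by (rule image_eqI)
  qed (auto simp: monics_eq)
qed

lemma geometric: "(p - 1) * (\<Sum>i<n. p ^ i) + 1 = p ^ n"
proof (induction n)
  case (Suc n)
  have "(p - 1) * (\<Sum>i<Suc n. p ^ i) + 1 = p ^ n + (p - 1) * p ^ n"
    using Suc by (simp add: algebra_simps)
  also have "\<dots> = p * p ^ n" using p_gt_1 by (cases p) auto
  finally show ?case by simp
qed simp

end

locale GF3 = GF +
  assumes p3: "[p = 1] (mod 3)"
begin

definition eK where "eK = (p - 1) div 3"

lemma eK: "p = 3 * eK + 1" "eK > 0"
proof -
  have "p mod 3 = 1" using p3 by (simp add: cong_def)
  hence "p = 3 * (p div 3) + 1" by presburger
  thus "p = 3 * eK + 1" unfolding eK_def by presburger
  thus "eK > 0" using p_gt_1 by auto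
qed

text \<open>Equal to (p^m - 1) / 3, but written so that x^eR is the eK-th power of the norm of
  x.\<close>

definition eR where "eR = eK * (\<Sum>i<m. p ^ i)"

lemma eR: "p ^ m = 3 * eR + 1"
proof -
  have "p - 1 = 3 * eK" using eK(1) by simp
  thus ?thesis using geometric[of m] by (simp only: eR_def mult.assoc)
qed

definition zeta where "zeta = (SOME z. z \<in> K \<and> z [^] (3::nat) = \<one> \<and> z \<noteq> \<one>)"

lemma zeta: "zeta \<in> K" "zeta [^] (3::nat) = \<one>" "zeta \<noteq> \<one>"
proof -
  interpret Kf: field Kf by (rule field_Kf)
  obtain z where "z \<in> K \<and> z [^] (3::nat) = \<one> \<and> z \<noteq> \<one>"
    by (rule Kf.exists_cube_root[of eK]) (use eK in \<open>auto simp: card_K Kf_pow\<close>)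
  from someI[of "\<lambda>z. z \<in> K \<and> z [^] (3::nat) = \<one> \<and> z \<noteq> \<one>", OF this]
  show "zeta \<in> K" "zeta [^] (3::nat) = \<one>" "zeta \<noteq> \<one>" by (auto simp: zeta_def)
qed

text \<open>\<open>A\<close> is the whole field and \<open>B\<close> its prime field. The common
  root \<open>zeta\<close> in \<open>K\<close> makes the character of \<open>A\<close> the composite
  of that of \<open>B\<close> with the norm, as \<open>A_chi\<close> states.\<close>

sublocale A: cubic_field R eR zeta
  by unfold_locales (use zeta K_carrier card_R eR in auto)

sublocale B: cubic_field Kf eK zeta
proof -
  interpret Kf: field Kf by (rule field_Kf)
  show "cubic_field Kf eK zeta"
    by unfold_locales (use zeta eK in \<open>auto simp: card_K Kf_pow\<close>)
qed

lemma B_chi: "B.chi x = A.h (x [^] eK)"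
  by (simp add: B.chi_def B.h_def A.h_def Kf_pow)

lemma A_chi: "x \<in> carrier R \<Longrightarrow> A.chi x = B.chi (x [^] (\<Sum>i<m. p ^ i))"
proof -
  assume "x \<in> carrier R"
  hence "x [^] eR = (x [^] (\<Sum>i<m. p ^ i)) [^] eK"
    by (simp add: nat_pow_pow eR_def mult.commute)
  thus ?thesis by (simp only: A.chi_def B_chi)
qed

lemma B_chi_pow: "y \<in> K \<Longrightarrow> n > 0 \<Longrightarrow> B.chi (y [^] (n::nat)) = B.chi y ^ n"
proof (induction n)
  case (Suc n)
  show ?case
  proof (cases n)
    case (Suc n')
    thus ?thesis using Suc.IH Suc.prems B.chi_mult[of "y [^] n" y] pow_K[of y n] by simp
  qed (use Suc.prems K_carrier in auto)
qed simp

text \<open>The points 0 and 1 are chosen so that the minimal polynomial of x yields the norms of -x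
  and 1 - x, the two arguments in a Jacobi sum; on X + a the value is already the summand of
  \<open>B.J\<close>.\<close>

definition lam :: "'a list \<Rightarrow> complex" where
  "lam f = B.chi (eval f \<zero>) * B.chi (eval f \<one>)"

lemma lam_mult:
  assumes "monic f" "monic g"
  shows "lam (f \<otimes>\<^bsub>K[X]\<^esub> g) = lam f * lam g"
  using assms monic_set'[OF assms(1)] monic_set'[OF assms(2)] eval_K[OF monic_set one_zero_K(1)] eval_K[OF monic_set one_zero_K(2)]
    B.chi_mult[of "eval f \<zero>" "eval g \<zero>"] B.chi_mult[of "eval f \<one>" "eval g \<one>"]
  by (simp add: lam_def univ_poly_mult eval_poly_mult mult_ac)

lemma lam_one: "lam [\<one>] = 1"
  using B.chi_1 by (simp add: lam_def)

lemma sum_lam_0: "(\<Sum>f\<in>monics 0. lam f) = 1"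
  by (simp add: monics_0 lam_one)

lemma sum_lam_1: "(\<Sum>f\<in>monics 1. lam f) = B.J"
proof -
  have "(\<Sum>f\<in>monics 1. lam f) = (\<Sum>a\<in>K. lam [\<one>, a])"
    by (rule sum.reindex_bij_witness[of _ "\<lambda>a. [\<one>, a]" "\<lambda>f. f ! 1"]) (auto simp: monics_eq length_Suc_conv)
  also have "\<dots> = (\<Sum>a\<in>K. B.chi a * B.chi (a \<oplus> \<one>))"
    using K_carrier by (intro sum.cong) (auto simp: lam_def a_comm subset_iff)
  finally show ?thesis by (simp add: B.J_def)
qed

text \<open>From degree 2 on, the coefficient b of X is free: it leaves f(0) = a alone and
  translates f(1), so the sum over b is a complete character sum and vanishes.\<close>

lemma sum_lam_ge_2:
  assumes "n \<ge> 2"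
  shows "(\<Sum>f\<in>monics n. lam f) = 0"
proof -
  obtain k where n: "n = Suc (Suc k)" using assms by (metis Suc_diff_Suc Suc_1 add_2_eq_Suc le_Suc_ex)
  let ?L = "{cs. set cs \<subseteq> K \<and> length cs = k}"
  have "(\<Sum>f\<in>monics n. lam f) = (\<Sum>x\<in>?L \<times> K \<times> K. lam ((\<lambda>(cs, b, a). \<one> # cs @ [b, a]) x))"
    unfolding n by (rule sum.reindex_bij_betw[OF monics_append2, symmetric])
  also have "\<dots> = (\<Sum>cs\<in>?L. \<Sum>b\<in>K. \<Sum>a\<in>K. lam (\<one> # cs @ [b, a]))"
    by (simp add: sum.cartesian_product case_prod_unfold)
  also have "\<dots> = (\<Sum>cs\<in>?L. 0)"
  proof (intro sum.cong refl)
    fix cs assume "cs \<in> ?L"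
    hence cs: "set (\<one> # cs) \<subseteq> K" "set (\<one> # cs) \<subseteq> carrier R" using one_zero_K K_carrier by auto
    \<comment> \<open>The sum of the coefficients of degree at least 2, so that f(1) = b + a +
      s.\<close>
    define s where "s = eval (\<one> # cs) \<one>"
    have sK: "s \<in> K" unfolding s_def by (rule eval_K[OF cs(1) one_zero_K(1)])
    have lam_eq: "lam (\<one> # cs @ [b, a]) = B.chi a * B.chi (b \<oplus> (a \<oplus> s))" if ba: "b \<in> K" "a \<in> K" for a b
    proof -
      have bac: "b \<in> carrier R" "a \<in> carrier R" "s \<in> carrier R" using ba sK K_carrier by auto
      have "eval ((\<one> # cs @ [b]) @ [a]) \<zero> = eval (\<one> # cs @ [b]) \<zero> \<otimes> \<zero> \<oplus> a"
        using cs bac by (intro eval_append_aux) auto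
      moreover have "eval (\<one> # cs @ [b]) \<zero> \<in> carrier R" using cs bac by (intro eval_in_carrier) auto
      ultimately have 0: "eval (\<one> # cs @ [b, a]) \<zero> = a" using bac by simp
      have "eval ((\<one> # cs) @ [b, a]) \<one> = s \<otimes> \<one> [^] length [b, a] \<oplus> eval [b, a] \<one>"
        unfolding s_def using cs bac by (intro eval_append) auto
      hence 1: "eval (\<one> # cs @ [b, a]) \<one> = b \<oplus> (a \<oplus> s)" using bac by (simp add: a_ac)
      show ?thesis unfolding lam_def 0 1 ..
    qed
    have "(\<Sum>b\<in>K. \<Sum>a\<in>K. lam (\<one> # cs @ [b, a])) = (\<Sum>b\<in>K. \<Sum>a\<in>K. B.chi a * B.chi (b \<oplus> (a \<oplus> s)))"
      by (intro sum.cong refl lam_eq)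
    also have "\<dots> = (\<Sum>a\<in>K. \<Sum>b\<in>K. B.chi a * B.chi (b \<oplus> (a \<oplus> s)))" by (rule sum.swap)
    also have "\<dots> = (\<Sum>a\<in>K. B.chi a * (\<Sum>b\<in>K. B.chi b))"
    proof (intro sum.cong refl)
      fix a assume a: "a \<in> K"
      have "a \<oplus> s \<in> K" using a sK subringE(7)[OF K_subring] by blast
      hence "(\<Sum>b\<in>K. B.chi (b \<oplus> (a \<oplus> s))) = (\<Sum>b\<in>K. B.chi b)"
        using B.sum_translate[of "a \<oplus> s" B.chi] by simp
      thus "(\<Sum>b\<in>K. B.chi a * B.chi (b \<oplus> (a \<oplus> s))) = B.chi a * (\<Sum>b\<in>K. B.chi b)"
        by (simp add: sum_distrib_left[symmetric])
    qed
    also have "\<dots> = 0" using B.sum_chi by simp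
    finally show "(\<Sum>b\<in>K. \<Sum>a\<in>K. lam (\<one> # cs @ [b, a])) = 0" .
  qed
  finally show ?thesis by simp
qed

text \<open>As the monic sums are 1, J, 0, 0, ..., the Newton identity collapses to two terms, and
  each sum is -J times the preceding one. This is the logarithmic derivative of 1 + J T.\<close>

lemma mangoldt_sum_lam: "mangoldt_sum lam (Suc n) = - ((- B.J) ^ Suc n)"
proof (induction n)
  case 0
  show ?case using newton_identity[of lam 1, OF lam_mult lam_one] sum_lam_0 sum_lam_1 by simp
next
  case (Suc n)
  have "(\<Sum>j=1..Suc (Suc n). mangoldt_sum lam j * (\<Sum>f\<in>monics (Suc (Suc n) - j). lam f))
      = (\<Sum>j\<in>{Suc n, Suc (Suc n)}. mangoldt_sum lam j * (\<Sum>f\<in>monics (Suc (Suc n) - j). lam f))"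
    by (rule sum.mono_neutral_right) (auto intro!: sum_lam_ge_2)
  hence "mangoldt_sum lam (Suc n) * B.J + mangoldt_sum lam (Suc (Suc n)) = 0"
    using newton_identity[of lam "Suc (Suc n)", OF lam_mult lam_one] sum_lam_ge_2[of "Suc (Suc n)"]
      sum_lam_0 sum_lam_1 by simp
  hence "mangoldt_sum lam (Suc (Suc n)) = - (mangoldt_sum lam (Suc n) * B.J)" by (simp add: add_eq_0_iff)
  thus ?case unfolding Suc.IH by simp
qed

text \<open>The sum \<open>mangoldt_sum lam m\<close> is evaluated in two ways: over the elements of
  R it is the Jacobi sum of R by \<open>norm_eq\<close>, and by the recursion it is a power of the
  one of \<open>K\<close>.\<close>

theorem hasse_davenport: "A.J = - ((- B.J) ^ m)"
proof -
  \<comment> \<open>The sign change makes the arguments 0 - x and 1 - x, whose norms are values of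
    the minimal polynomial of x.\<close>
  have "A.J = (\<Sum>x\<in>carrier R. A.chi (\<ominus> x) * A.chi (\<ominus> x \<oplus> \<one>))"
    unfolding A.J_def by (rule sum.reindex_bij_witness[of _ "\<lambda>x. \<ominus> x" "\<lambda>x. \<ominus> x"]) auto
  also have "\<dots> = (\<Sum>x\<in>carrier R. lam (Irr K x) ^ (m div Polynomials.degree (Irr K x)))"
  proof (intro sum.cong refl)
    fix x assume x: "x \<in> carrier R"
    define n where "n = m div frob_order x"
    have n: "n > 0" unfolding n_def using frob_order(1,3)[OF x] by (simp add: div_greater_zero_iff)
    have evK: "eval (Irr K x) k \<in> K" if "k \<in> K" for k
      using eval_K[OF monic_set[OF irrD(1)[OF Irr_in_irr[OF x]]] that] .
    have chi: "A.chi (k \<ominus> x) = B.chi (eval (Irr K x) k) ^ n" if k: "k \<in> K" for k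
      using A_chi[of "k \<ominus> x"] norm_eq[OF x k] k x K_carrier B_chi_pow[OF evK[OF k] n] by (auto simp: n_def)
    have "\<ominus> x = \<zero> \<ominus> x" "\<ominus> x \<oplus> \<one> = \<one> \<ominus> x" using x by (simp_all add: a_minus_def a_comm)
    thus "A.chi (\<ominus> x) * A.chi (\<ominus> x \<oplus> \<one>) = lam (Irr K x) ^ (m div Polynomials.degree (Irr K x))"
      using chi[OF one_zero_K(1)] chi[OF one_zero_K(2)] degree_Irr[OF x]
      by (simp add: lam_def n_def power_mult_distrib)
  qed
  also have "\<dots> = mangoldt_sum lam m" by (rule mangoldt_sum_eq[symmetric])
  also have "\<dots> = - ((- B.J) ^ m)" using mangoldt_sum_lam[of "m - 1"] m_pos by simp
  finally show ?thesis .
qed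

end

section \<open>Traces of Jacobi sums as a Lucas sequence\<close>

definition cube_residue :: "nat \<Rightarrow> nat \<Rightarrow> bool" where
  "cube_residue p n \<longleftrightarrow> (\<exists>y. \<not> p dvd y \<and> [y ^ 3 = n] (mod p))"

definition cube_pairs :: "nat \<Rightarrow> nat" where
  "cube_pairs p = card {n \<in> {..<p}. cube_residue p n \<and> cube_residue p (n + 1)}"

text \<open>The trace \<open>T\<^sub>1\<close>, computed in \<open>\<int>/p\<close> so that it depends on \<open>p\<close> only and not on the model of
  the field.\<close>

definition jtrace :: "nat \<Rightarrow> int" where
  "jtrace p = int p - 8 - 9 * int (cube_pairs p)"

text \<open>The Lucas sequence V_n: power sums of the two roots of X^2 - T X + q. It is stated over
  any commutative ring so that it can be moved between integers, reals and complex numbers.\<close>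

fun tseq :: "'c::comm_ring_1 \<Rightarrow> 'c \<Rightarrow> nat \<Rightarrow> 'c" where
  "tseq q T 0 = 2"
| "tseq q T (Suc 0) = T"
| "tseq q T (Suc (Suc n)) = T * tseq q T (Suc n) - q * tseq q T n"

lemma tseq_powers: "tseq (a * b) (a + b) n = a ^ n + b ^ n"
  by (induction n rule: induct_nat_012) (simp_all add: algebra_simps)

lemma tseq_of_int: "of_int (tseq q T n) = tseq (of_int q) (of_int T) n"
  by (induction n rule: induct_nat_012) simp_all

context GF3 begin

text \<open>The map from n to n times the unit identifies Z/p with \<open>K\<close> and cubes with
  cubes. This frees the trace from the model R.\<close>

lemma consecutive_cubes_Kf: "ring.consecutive_cubes Kf = cube_pairs p"
proof -
  have cub: "[n] \<cdot> \<one> \<in> B.cubes \<longleftrightarrow> cube_residue p n" for n :: nat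
  proof
    assume "[n] \<cdot> \<one> \<in> B.cubes"
    then obtain x where x: "x \<in> K" "x \<noteq> \<zero>" "[n] \<cdot> \<one> = x [^] (3::nat)"
      by (auto simp: B.cubes_def Kf_pow)
    obtain y :: nat where y: "x = [y] \<cdot> \<one>" using x(1) unfolding K_eq by blast
    have "\<not> p dvd y" using x(2) y nat_eq_zero_iff by blast
    moreover have "[(y ^ 3)] \<cdot> \<one> = [n] \<cdot> \<one>" using x(3) unfolding y nat_pow_one_mult by (rule sym)
    ultimately show "cube_residue p n" unfolding cube_residue_def nat_eq_iff cong_def by blast
  next
    assume "cube_residue p n"
    then obtain y where y: "\<not> p dvd y" "[y ^ 3 = n] (mod p)" by (auto simp: cube_residue_def)
    have "[n] \<cdot> \<one> = ([y] \<cdot> \<one>) [^] (3::nat)"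
      unfolding nat_pow_one_mult nat_eq_iff using y(2) by (simp add: cong_def)
    moreover have "[y] \<cdot> \<one> \<noteq> \<zero>" using y(1) nat_eq_zero_iff by blast
    moreover have "[y] \<cdot> \<one> \<in> K" by (simp add: K_eq)
    ultimately show "[n] \<cdot> \<one> \<in> B.cubes" by (auto simp: B.cubes_def Kf_pow)
  qed
  have suc: "[n] \<cdot> \<one> \<oplus> \<one> = [(n + 1)] \<cdot> \<one>" for n :: nat by simp
  have "{x. x \<in> B.cubes \<and> x \<oplus>\<^bsub>Kf\<^esub> \<one>\<^bsub>Kf\<^esub> \<in> B.cubes}
     = (\<lambda>n. [n] \<cdot> \<one>) ` {n \<in> {..<p}. cube_residue p n \<and> cube_residue p (n + 1)}"
  proof (intro equalityI subsetI)
    fix x assume "x \<in> {x. x \<in> B.cubes \<and> x \<oplus>\<^bsub>Kf\<^esub> \<one>\<^bsub>Kf\<^esub> \<in> B.cubes}"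
    hence x: "x \<in> B.cubes" "x \<oplus> \<one> \<in> B.cubes" by auto
    have "x \<in> K" using x(1) B.cubes_carrier by auto
    then obtain n where n: "x = [n] \<cdot> \<one>" "n < p" by (auto simp: K_def)
    have "cube_residue p n" using x(1) cub unfolding n by blast
    moreover have "cube_residue p (n + 1)" using x(2) cub unfolding n suc by blast
    ultimately show "x \<in> (\<lambda>n. [n] \<cdot> \<one>) ` {n \<in> {..<p}. cube_residue p n \<and> cube_residue p (n + 1)}"
      using n by blast
  next
    fix x assume "x \<in> (\<lambda>n. [n] \<cdot> \<one>) ` {n \<in> {..<p}. cube_residue p n \<and> cube_residue p (n + 1)}"
    then obtain n where n: "x = [n] \<cdot> \<one>" "cube_residue p n" "cube_residue p (n + 1)" by blast
    have "x \<in> B.cubes" "x \<oplus> \<one> \<in> B.cubes" unfolding n suc using n(2,3) cub by blast+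
    thus "x \<in> {x. x \<in> B.cubes \<and> x \<oplus>\<^bsub>Kf\<^esub> \<one>\<^bsub>Kf\<^esub> \<in> B.cubes}" by simp
  qed
  moreover have "inj_on (\<lambda>n::nat. [n] \<cdot> \<one>) {n \<in> {..<p}. cube_residue p n \<and> cube_residue p (n + 1)}"
    by (auto simp: inj_on_def nat_eq_iff)
  ultimately show ?thesis unfolding B.consecutive_cubes_def cube_pairs_def by (simp add: card_image)
qed

lemma jtrace_eq: "of_int (jtrace p) = - B.J + - cnj B.J"
proof -
  have "9 * of_nat (cube_pairs p) = of_nat p - 8 + (B.J + cnj B.J)"
    using B.consecutive_cubes_eq unfolding consecutive_cubes_Kf by (simp add: card_K)
  thus ?thesis by (simp add: jtrace_def algebra_simps)
qed

lemma B_J_norm: "(- B.J) * (- cnj B.J) = of_nat p"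
  using B.J_norm by (simp add: card_K)

text \<open>The numbers -J and its conjugate, taken over \<open>K\<close>, have sum
  \<open>jtrace p\<close> and product p; by Hasse-Davenport their m-th powers add up to minus the
  trace of the Jacobi sum of R.\<close>

theorem consecutive_cubes_formula: "9 * int consecutive_cubes = int p ^ m - 8 - tseq (int p) (jtrace p) m"
proof -
  have "complex_of_int (tseq (int p) (jtrace p) m) = (- B.J) ^ m + (- cnj B.J) ^ m"
    unfolding tseq_of_int jtrace_eq using tseq_powers[of "- B.J" "- cnj B.J" m] B_J_norm by simp
  also have "\<dots> = - (A.J + cnj A.J)" by (simp add: hasse_davenport)
  finally have "complex_of_int (9 * int consecutive_cubes) = of_int (int p ^ m - 8 - tseq (int p) (jtrace p) m)"
    using A.consecutive_cubes_eq by (simp add: card_R)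
  thus ?thesis by (simp only: of_int_eq_iff)
qed

text \<open>The Jacobi sum over \<open>K\<close> is an Eisenstein integer a + b omega of norm p, and
  the trace of a + b omega is 2 a - b.\<close>

lemma jtrace_rep: "\<exists>a b :: int. int p = a\<^sup>2 - a * b + b\<^sup>2 \<and> jtrace p = b - 2 * a"
proof -
  obtain a b where ab: "B.J = of_int a + of_int b * omega"
    using B.J_eisenstein by (auto simp: eisenstein_def)
  have c: "cnj B.J = of_int a + of_int b * cnj omega" by (simp add: ab)
  have s: "omega + cnj omega = -1" using omega_sum by (simp add: add_eq_0_iff add.assoc)
  have "complex_of_int (jtrace p) = - 2 * of_int a - of_int b * (omega + cnj omega)"
    unfolding jtrace_eq ab c by (simp add: algebra_simps)
  hence "complex_of_int (jtrace p) = of_int (b - 2 * a)" unfolding s by simp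
  hence 1: "jtrace p = b - 2 * a" by (simp only: of_int_eq_iff)
  have "complex_of_int (int p) = B.J * cnj B.J" using B_J_norm by simp
  also have "\<dots> = of_int a ^ 2 + of_int a * of_int b * (omega + cnj omega) + of_int b ^ 2 * (omega * cnj omega)"
    unfolding ab by (simp add: algebra_simps power2_eq_square)
  also have "\<dots> = of_int (a\<^sup>2 - a * b + b\<^sup>2)" unfolding s omega_cnj by simp
  finally have "int p = a\<^sup>2 - a * b + b\<^sup>2" by (simp only: of_int_eq_iff)
  thus ?thesis using 1 by blast
qed

end

section \<open>Counting triangles\<close>

lemma card_orderings:
  assumes "card S = 3"
  shows "card {(u, v, w). {u, v, w} = S} = 6"
proof -
  obtain a b c where S: "S = {a, b, c}" "a \<noteq> b" "a \<noteq> c" "b \<noteq> c"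
    using assms by (auto simp: card_3_iff)
  have "{(u, v, w). {u, v, w} = S} = {(a, b, c), (a, c, b), (b, a, c), (b, c, a), (c, a, b), (c, b, a)}"
    (is "?A = ?B")
  proof (intro equalityI subsetI)
    fix t assume "t \<in> ?A"
    then obtain u v w where t: "t = (u, v, w)" and uvw: "{u, v, w} = {a, b, c}" by (auto simp: S)
    have mem: "u \<in> {a, b, c}" "v \<in> {a, b, c}" "w \<in> {a, b, c}" using uvw by blast+
    have "card {u, v, w} = 3" using uvw S by simp
    hence "u \<noteq> v" "u \<noteq> w" "v \<noteq> w" by (auto simp: card_insert_if split: if_splits)
    with mem S(2-4) show "t \<in> ?B"
      unfolding t insert_iff empty_iff prod.inject by (elim disjE) simp_all
  next
    fix t assume "t \<in> ?B"
    thus "t \<in> ?A" unfolding S by (elim insertE emptyE) auto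
  qed
  also have "card \<dots> = 6" using S(2-4) by simp
  finally show ?thesis .
qed

text \<open>Completeness fixes the arc set exactly, so the equivalence also covers u = v, where it
  excludes loops.\<close>

lemma num_cliques_eq:
  "num_cliques n G = card {S. S \<subseteq> pverts G \<and> finite S \<and> card S = n \<and>
      (\<forall>u\<in>S. \<forall>v\<in>S. (u, v) \<in> parcs G \<longleftrightarrow> u \<noteq> v)}"
proof -
  have "complete_digraph n (induce_subgraph (with_proj G) S) \<longleftrightarrow>
      finite S \<and> card S = n \<and> (\<forall>u\<in>S. \<forall>v\<in>S. (u, v) \<in> parcs G \<longleftrightarrow> u \<noteq> v)" for S
  proof -
    let ?H = "\<lparr>pverts = S, parcs = {a \<in> parcs G. fst a \<in> S \<and> snd a \<in> S}\<rparr>"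
    have H: "induce_subgraph (with_proj G) S = with_proj ?H"
      by (simp add: induce_subgraph_def with_proj_def)
    have "{a \<in> parcs G. fst a \<in> S \<and> snd a \<in> S} = {(u, v). (u, v) \<in> S \<times> S \<and> u \<noteq> v} \<longleftrightarrow>
        (\<forall>u\<in>S. \<forall>v\<in>S. (u, v) \<in> parcs G \<longleftrightarrow> u \<noteq> v)" (is "?L = ?R \<longleftrightarrow> ?C")
    proof
      assume eq: "?L = ?R"
      show ?C
      proof (intro ballI)
        fix u v assume uv: "u \<in> S" "v \<in> S"
        have "(u, v) \<in> ?L \<longleftrightarrow> (u, v) \<in> ?R" unfolding eq ..
        thus "(u, v) \<in> parcs G \<longleftrightarrow> u \<noteq> v" using uv by simp
      qed
    next
      assume C: ?C
      show "?L = ?R"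
      proof (intro Set.set_eqI)
        fix a :: "'a \<times> 'a"
        obtain u v where "a = (u, v)" by (cases a)
        thus "a \<in> ?L \<longleftrightarrow> a \<in> ?R" using C by auto
      qed
    qed
    thus ?thesis unfolding H complete_digraph_pair_def pair_pre_digraph.simps by (rule conj_cong[OF refl conj_cong[OF refl]])
  qed
  thus ?thesis unfolding num_cliques_def by simp
qed

section \<open>Ordered triangles and consecutive cubes\<close>

context cubic_field begin

lemma cubes_mult: "a \<in> cubes \<Longrightarrow> b \<in> cubes \<Longrightarrow> a \<otimes> b \<in> cubes"
proof -
  assume ab: "a \<in> cubes" "b \<in> cubes"
  hence c: "a \<in> carrier R" "a \<noteq> \<zero>" "b \<in> carrier R" "b \<noteq> \<zero>" using cubes_carrier by auto
  hence abc: "a \<otimes> b \<in> carrier R" "a \<otimes> b \<noteq> \<zero>" using integral by auto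
  have "chi (a \<otimes> b) = chi a * chi b" using c by (intro chi_mult)
  also have "\<dots> = 1" using chi_eq_1_iff[OF c(1,2)] chi_eq_1_iff[OF c(3,4)] ab by simp
  finally show ?thesis using chi_eq_1_iff[OF abc] by blast
qed

lemma cubes_inv: "a \<in> cubes \<Longrightarrow> inv a \<in> cubes"
proof -
  assume a: "a \<in> cubes"
  hence ac: "a \<in> carrier R" "a \<noteq> \<zero>" using cubes_carrier by auto
  have ai: "inv a \<in> carrier R" "inv a \<noteq> \<zero>" using ac inv_r[OF ac] by (auto simp: inv_closed')
  show ?thesis using chi_eq_1_iff[OF ac] chi_eq_1_iff[OF ai] chi_inv[OF ac] a by simp
qed

lemma minus_one_cubes: "\<ominus> \<one> \<in> cubes"
proof -
  have "(\<ominus> \<one>) [^] (3::nat) = \<ominus> \<one>" by (simp add: numeral_3_eq_3 l_minus r_minus)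
  moreover have "\<ominus> \<one> \<noteq> \<zero>" using add.inv_eq_1_iff by auto
  ultimately show ?thesis
    unfolding cubes_def by (intro CollectI exI[of _ "\<ominus> \<one>"]) simp
qed

text \<open>Since -1 is a cube, adjacency is symmetric and the graph is undirected.\<close>

lemma cubes_minus_commute: "u \<in> carrier R \<Longrightarrow> v \<in> carrier R \<Longrightarrow> u \<ominus> v \<in> cubes \<Longrightarrow> v \<ominus> u \<in> cubes"
proof -
  assume uv: "u \<in> carrier R" "v \<in> carrier R" "u \<ominus> v \<in> cubes"
  have "v \<ominus> u = \<ominus> \<one> \<otimes> (u \<ominus> v)" using uv by (simp add: l_minus a_minus_def minus_add a_comm)
  thus ?thesis using cubes_mult[OF minus_one_cubes uv(3)] by simp
qed

text \<open>Summing 1 + chi + conjugate over the nonzero elements gives q - 1 = 3 e, and each cube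
  contributes 3.\<close>

lemma card_cubes: "card cubes = e"
proof -
  have "0 = (\<Sum>x\<in>carrier R. chi x + cnj (chi x))" by (simp add: sum.distrib sum_chi sum_cnj_chi)
  also have "\<dots> = (\<Sum>x\<in>carrier R - {\<zero>}. chi x + cnj (chi x))"
    by (rule sum.mono_neutral_right) auto
  also have "\<dots> = (\<Sum>x\<in>carrier R - {\<zero>}. (if x \<in> cubes then 3 else 0) - 1)"
  proof (intro sum.cong refl)
    fix x assume "x \<in> carrier R - {\<zero>}"
    hence "1 + chi x + cnj (chi x) = (if x \<in> cubes then 3 else 0)" by (intro chi_cube) auto
    from this[symmetric] show "chi x + cnj (chi x) = (if x \<in> cubes then 3 else 0) - 1" by simp
  qed
  also have "\<dots> = (\<Sum>x\<in>carrier R - {\<zero>}. if x \<in> cubes then 3 else 0) - of_nat (3 * e)"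
    using card by (simp add: sum_subtractf card_Diff_singleton)
  also have "(\<Sum>x\<in>carrier R - {\<zero>}. if x \<in> cubes then 3 else 0) = (\<Sum>x\<in>(carrier R - {\<zero>}) \<inter> cubes. 3 :: complex)"
    by (rule sum.inter_restrict[symmetric]) auto
  also have "(carrier R - {\<zero>}) \<inter> cubes = cubes" using cubes_carrier by blast
  finally have "complex_of_nat (3 * card cubes) = of_nat (3 * e)" by simp
  thus ?thesis by (simp only: of_nat_eq_iff)
qed

text \<open>Ordered triangles; one direction per edge is enough by
  \<open>cubes_minus_commute\<close>.\<close>

definition triples :: "('a \<times> 'a \<times> 'a) set" where
  "triples = {(u, v, w). u \<in> carrier R \<and> v \<in> carrier R \<and> w \<in> carrier R \<and>
     v \<ominus> u \<in> cubes \<and> w \<ominus> u \<in> cubes \<and> w \<ominus> v \<in> cubes}"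

lemma finite_triples: "finite triples"
  by (rule finite_subset[of _ "carrier R \<times> carrier R \<times> carrier R"]) (auto simp: triples_def)

text \<open>Translate by u and scale by a = v - u: with w = v + a x the differences are a, a x and a
  (x + 1). As the cubes form a group, what is left is that a, x and x + 1 are cubes.\<close>

lemma card_triples: "card triples = card (carrier R) * (e * consecutive_cubes)"
proof -
  define M where "M = {x. x \<in> cubes \<and> x \<oplus> \<one> \<in> cubes}"
  have Xc: "M \<subseteq> carrier R" using cubes_carrier by (auto simp: M_def)
  have "bij_betw (\<lambda>(u, a, x). (u, u \<oplus> a, u \<oplus> a \<oplus> a \<otimes> x)) (carrier R \<times> cubes \<times> M) triples"
  proof (rule bij_betw_byWitness[where f' = "\<lambda>(u, v, w). (u, v \<ominus> u, inv (v \<ominus> u) \<otimes> (w \<ominus> v))"])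
    have fwd: "v \<ominus> u = a" "w \<ominus> v = a \<otimes> x" "w \<ominus> u = a \<otimes> (x \<oplus> \<one>)" "v \<in> carrier R" "w \<in> carrier R"
      if h: "u \<in> carrier R" "a \<in> carrier R" "x \<in> carrier R" and vw: "v = u \<oplus> a" "w = u \<oplus> a \<oplus> a \<otimes> x" for u v w a x
    proof -
      have vc: "v = a \<oplus> u" using h vw by (simp add: a_comm)
      show "v \<ominus> u = a" unfolding vc using h by (simp add: add_minus_cancel')
      show "v \<in> carrier R" "w \<in> carrier R" using h vw by auto
      have "w = a \<otimes> x \<oplus> v" using h vw by (simp add: a_comm)
      thus "w \<ominus> v = a \<otimes> x" using h vw by (simp add: add_minus_cancel')
      have "w = a \<otimes> (x \<oplus> \<one>) \<oplus> u" using h vw by (simp add: r_distr a_ac)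
      thus "w \<ominus> u = a \<otimes> (x \<oplus> \<one>)" using h by (simp add: add_minus_cancel')
    qed
    show "\<forall>y\<in>carrier R \<times> cubes \<times> M. (\<lambda>(u, v, w). (u, v \<ominus> u, inv (v \<ominus> u) \<otimes> (w \<ominus> v)))
        ((\<lambda>(u, a, x). (u, u \<oplus> a, u \<oplus> a \<oplus> a \<otimes> x)) y) = y"
    proof
      fix y assume "y \<in> carrier R \<times> cubes \<times> M"
      then obtain u a x where y: "y = (u, a, x)" "u \<in> carrier R" "a \<in> cubes" "x \<in> M" by auto
      have c: "a \<in> carrier R" "a \<noteq> \<zero>" "x \<in> carrier R" using y cubes_carrier Xc by auto
      show "(\<lambda>(u, v, w). (u, v \<ominus> u, inv (v \<ominus> u) \<otimes> (w \<ominus> v))) ((\<lambda>(u, a, x). (u, u \<oplus> a, u \<oplus> a \<oplus> a \<otimes> x)) y) = y"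
        unfolding y(1) prod.case fwd(1)[OF y(2) c(1,3) refl refl] fwd(2)[OF y(2) c(1,3) refl refl]
        using cancel_inv(2)[OF c(1,2,3)] by simp
    qed
    show "(\<lambda>(u, a, x). (u, u \<oplus> a, u \<oplus> a \<oplus> a \<otimes> x)) ` (carrier R \<times> cubes \<times> M) \<subseteq> triples"
    proof
      fix t assume "t \<in> (\<lambda>(u, a, x). (u, u \<oplus> a, u \<oplus> a \<oplus> a \<otimes> x)) ` (carrier R \<times> cubes \<times> M)"
      then obtain u a x where t: "t = (u, u \<oplus> a, u \<oplus> a \<oplus> a \<otimes> x)" "u \<in> carrier R" "a \<in> cubes" "x \<in> M" by auto
      have c: "a \<in> carrier R" "x \<in> carrier R" using t cubes_carrier Xc by auto
      note f = fwd[OF t(2) c refl refl]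
      show "t \<in> triples"
        unfolding t(1) triples_def mem_Collect_eq prod.case f(1-3)
        using f(4,5) t c cubes_mult by (auto simp: M_def)
    qed
    have bwd: "v \<ominus> u \<in> cubes" "inv (v \<ominus> u) \<otimes> (w \<ominus> v) \<in> M"
      "u \<oplus> (v \<ominus> u) = v" "v \<oplus> (v \<ominus> u) \<otimes> (inv (v \<ominus> u) \<otimes> (w \<ominus> v)) = w"
      if t: "(u, v, w) \<in> triples" for u v w
    proof -
      have c: "u \<in> carrier R" "v \<in> carrier R" "w \<in> carrier R" and
        cu: "v \<ominus> u \<in> cubes" "w \<ominus> u \<in> cubes" "w \<ominus> v \<in> cubes" using t by (auto simp: triples_def)
      show "v \<ominus> u \<in> cubes" by fact
      have a: "v \<ominus> u \<in> carrier R" "v \<ominus> u \<noteq> \<zero>" using cu(1) cubes_carrier by blast+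
      have ai: "inv (v \<ominus> u) \<in> carrier R" using inv_closed'[OF a] .
      show vv: "u \<oplus> (v \<ominus> u) = v" using minus_add_cancel'[of v u] c a(1) by (simp add: a_comm)
      have ww: "v \<oplus> (w \<ominus> v) = w" using minus_add_cancel'[of w v] c by (simp add: a_comm)
      show "v \<oplus> (v \<ominus> u) \<otimes> (inv (v \<ominus> u) \<otimes> (w \<ominus> v)) = w"
        using cancel_inv(1)[OF a, of "w \<ominus> v"] c ww by simp
      have "w \<ominus> u = (w \<ominus> v) \<oplus> (v \<ominus> u)"
        using c minus_add_cancel'[of w v] by (simp add: a_minus_def a_assoc[symmetric])
      hence "inv (v \<ominus> u) \<otimes> (w \<ominus> u) = inv (v \<ominus> u) \<otimes> (w \<ominus> v) \<oplus> \<one>"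
        using c a ai inv_l[OF a] by (simp add: r_distr)
      thus "inv (v \<ominus> u) \<otimes> (w \<ominus> v) \<in> M"
        unfolding M_def mem_Collect_eq using cubes_mult[OF cubes_inv[OF cu(1)] cu(2)] cubes_mult[OF cubes_inv[OF cu(1)] cu(3)]
        by simp
    qed
    show "\<forall>y\<in>triples. (\<lambda>(u, a, x). (u, u \<oplus> a, u \<oplus> a \<oplus> a \<otimes> x)) ((\<lambda>(u, v, w). (u, v \<ominus> u, inv (v \<ominus> u) \<otimes> (w \<ominus> v))) y) = y"
    proof
      fix y assume yt: "y \<in> triples"
      obtain u v w where y: "y = (u, v, w)" by (cases y)
      show "(\<lambda>(u, a, x). (u, u \<oplus> a, u \<oplus> a \<oplus> a \<otimes> x)) ((\<lambda>(u, v, w). (u, v \<ominus> u, inv (v \<ominus> u) \<otimes> (w \<ominus> v))) y) = y"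
        using bwd(3,4)[OF yt[unfolded y]] unfolding y prod.case by (simp only:)
    qed
    show "(\<lambda>(u, v, w). (u, v \<ominus> u, inv (v \<ominus> u) \<otimes> (w \<ominus> v))) ` triples \<subseteq> carrier R \<times> cubes \<times> M"
      using bwd(1,2) by (auto simp: triples_def)
  qed
  hence "card triples = card (carrier R \<times> cubes \<times> M)" by (rule bij_betw_same_card[symmetric])
  thus ?thesis by (simp add: card_cartesian_product card_cubes M_def consecutive_cubes_def)
qed

text \<open>The factor 18 = 6 * 3 combines the six orderings of a triangle with 3 e = q - 1.\<close>

theorem num_triangles: "18 * num_cliques 3 (gen_paley_graph 3 R) = card (carrier R) * (card (carrier R) - 1) * consecutive_cubes"
proof -
  define T where "T = {S. S \<subseteq> carrier R \<and> card S = 3 \<and> (\<forall>u\<in>S. \<forall>v\<in>S. u \<noteq> v \<longrightarrow> v \<ominus> u \<in> cubes)}"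
  have z: "u \<ominus> u \<notin> cubes" if "u \<in> carrier R" for u
    using that cubes_carrier by (auto simp: a_minus_def r_neg)
  have "{S. S \<subseteq> carrier R \<and> finite S \<and> card S = 3 \<and> (\<forall>u\<in>S. \<forall>v\<in>S. (u, v) \<in> parcs (gen_paley_graph 3 R) \<longleftrightarrow> u \<noteq> v)} = T"
  proof (intro Set.set_eqI)
    fix S
    have arc: "(u, v) \<in> parcs (gen_paley_graph 3 R) \<longleftrightarrow> v \<ominus> u \<in> cubes" if "S \<subseteq> carrier R" "u \<in> S" "v \<in> S" for u v
      using that by (auto simp: gen_paley_graph_def cayley_graph_def cubes_def)
    have "(\<forall>u\<in>S. \<forall>v\<in>S. (u, v) \<in> parcs (gen_paley_graph 3 R) \<longleftrightarrow> u \<noteq> v) \<longleftrightarrow>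
       (\<forall>u\<in>S. \<forall>v\<in>S. u \<noteq> v \<longrightarrow> v \<ominus> u \<in> cubes)" if S: "S \<subseteq> carrier R"
    proof (intro ball_cong refl)
      fix u v assume uv: "u \<in> S" "v \<in> S"
      show "((u, v) \<in> parcs (gen_paley_graph 3 R) \<longleftrightarrow> u \<noteq> v) \<longleftrightarrow> (u \<noteq> v \<longrightarrow> v \<ominus> u \<in> cubes)"
        unfolding arc[OF S uv] using z[of u] uv(1) S by (cases "u = v") auto
    qed
    moreover have "S \<subseteq> carrier R \<Longrightarrow> finite S" by (rule finite_subset) auto
    ultimately show "S \<in> {S. S \<subseteq> carrier R \<and> finite S \<and> card S = 3 \<and> (\<forall>u\<in>S. \<forall>v\<in>S. (u, v) \<in> parcs (gen_paley_graph 3 R) \<longleftrightarrow> u \<noteq> v)} \<longleftrightarrow> S \<in> T"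
      unfolding T_def mem_Collect_eq by blast
  qed
  hence nc: "num_cliques 3 (gen_paley_graph 3 R) = card T"
    unfolding num_cliques_eq by (simp add: gen_paley_graph_def cayley_graph_def)
  have finT: "finite T" by (rule finite_subset[of _ "Pow (carrier R)"]) (auto simp: T_def)
  define supp where "supp = (\<lambda>(u, v, w). {u, v, w :: 'a})"
  have supp_T: "supp t \<in> T" if tt: "t \<in> triples" for t
  proof -
    obtain u v w where t: "t = (u, v, w)" by (cases t)
    have c: "u \<in> carrier R" "v \<in> carrier R" "w \<in> carrier R" and
      cu: "v \<ominus> u \<in> cubes" "w \<ominus> u \<in> cubes" "w \<ominus> v \<in> cubes" using tt t by (auto simp: triples_def)
    have ne: "u \<noteq> v" "u \<noteq> w" "v \<noteq> w" using cu z c by auto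
    have cu': "u \<ominus> v \<in> cubes" "u \<ominus> w \<in> cubes" "v \<ominus> w \<in> cubes"
      using cu c cubes_minus_commute by blast+
    show ?thesis unfolding T_def t supp_def using c cu cu' ne by auto
  qed
  have fib: "{t \<in> triples. supp t = S} = {(u, v, w). {u, v, w} = S}" if S: "S \<in> T" for S
  proof (intro equalityI subsetI)
    fix t assume "t \<in> {(u, v, w). {u, v, w} = S}"
    then obtain u v w where t: "t = (u, v, w)" "{u, v, w} = S" by auto
    have "card {u, v, w} = 3" using S t by (simp add: T_def)
    hence ne: "u \<noteq> v" "u \<noteq> w" "v \<noteq> w" by (auto simp: card_insert_if split: if_splits)
    have "u \<in> S" "v \<in> S" "w \<in> S" using t(2) by auto
    hence "(u, v, w) \<in> triples" using S ne unfolding T_def triples_def by blast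
    thus "t \<in> {t \<in> triples. supp t = S}" using t by (simp add: supp_def)
  qed (auto simp: supp_def)
  have "card triples = (\<Sum>t\<in>triples. 1)" by simp
  also have "\<dots> = (\<Sum>S\<in>T. \<Sum>t\<in>{t \<in> triples. supp t = S}. 1)"
    by (rule sum.group[symmetric]) (use finite_triples finT supp_T in auto)
  also have "\<dots> = (\<Sum>S\<in>T. 6)"
  proof (intro sum.cong refl)
    fix S assume S: "S \<in> T"
    hence "card {(u, v, w). {u, v, w} = S} = 6" by (intro card_orderings) (simp add: T_def)
    thus "(\<Sum>t\<in>{t \<in> triples. supp t = S}. 1) = (6 :: nat)" by (simp add: fib[OF S])
  qed
  finally have "card triples = 6 * card T" by simp
  hence "18 * card T = 3 * (card (carrier R) * (e * consecutive_cubes))" using card_triples by simp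
  thus ?thesis unfolding nc using card by (simp add: algebra_simps)
qed

end

section \<open>The exponent of the representation\<close>

text \<open>Here 162 = 18 * 9, the factor of the triangle count times that of the cube
  count.\<close>

lemma (in GF3) num_triangles_formula:
  "162 * int (num_cliques 3 (gen_paley_graph 3 R)) =
     int p ^ m * (int p ^ m - 1) * (int p ^ m - 8 - tseq (int p) (jtrace p) m)"
proof -
  have q: "p ^ m \<ge> 1" using p_gt_1 by simp
  have "int (18 * num_cliques 3 (gen_paley_graph 3 R)) = int (p ^ m * (p ^ m - 1) * consecutive_cubes)"
    using A.num_triangles by (simp only: card_R)
  hence "18 * int (num_cliques 3 (gen_paley_graph 3 R)) = int p ^ m * (int p ^ m - 1) * int consecutive_cubes"
    using q by (simp add: of_nat_diff)
  hence "162 * int (num_cliques 3 (gen_paley_graph 3 R)) = int p ^ m * (int p ^ m - 1) * (9 * int consecutive_cubes)"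
    by simp
  thus ?thesis unfolding consecutive_cubes_formula .
qed

lemma is_GF_GF3:
  fixes R :: "'a ring"
  assumes "prime p" "[p = 1] (mod 3)" "is_GF (p ^ m) R" "m \<ge> 1"
  shows "GF3 R p m"
proof -
  have "p ^ m \<noteq> 1" using prime_gt_1_nat[OF assms(1)] assms(4) by (simp add: power_eq_1_iff)
  then interpret field R using assms(3) by (simp add: is_GF_def)
  show ?thesis
    by unfold_locales (use assms in \<open>simp_all add: is_GF_def\<close>)
qed

lemma prime_1_mod_3:
  assumes "prime (p::nat)" "[p = 1] (mod 3)"
  shows "p \<ge> 7" "\<not> 3 dvd p" "odd p"
proof -
  have m: "p mod 3 = 1" using assms(2) by (simp add: cong_def)
  thus 3: "\<not> 3 dvd p" by presburger
  have "p > 1" using prime_gt_1_nat[OF assms(1)] .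
  moreover have "p \<noteq> 2" "p \<noteq> 3" "p \<noteq> 5" using m by auto
  moreover have "p \<noteq> 4" "p \<noteq> 6" using assms(1) prime_product[of 2 2] prime_product[of 2 3] by auto
  ultimately show "p \<ge> 7" by linarith
  thus "odd p" using assms(1) prime_odd_nat by simp
qed

text \<open>4 n equals (2 b - a)^2 + 3 a^2, (2 a - b)^2 + 3 b^2 and (a + b)^2 + 3 (a - b)^2. If 3
  divides none of a, b, a - b, then b = -a modulo 3 and n would be divisible by 3; so one of the
  three forms gives 27.\<close>

lemma eisenstein_norm_rep:
  fixes n :: int
  assumes "n = a\<^sup>2 - a * b + b\<^sup>2" "\<not> 3 dvd n"
  obtains c d where "4 * n = c\<^sup>2 + 27 * d\<^sup>2"
proof -
  have "3 dvd a \<or> 3 dvd b \<or> 3 dvd (a - b)"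
  proof (rule ccontr)
    assume h: "\<not> (3 dvd a \<or> 3 dvd b \<or> 3 dvd (a - b))"
    hence "3 dvd (a + b)" by presburger
    then obtain k where "a + b = 3 * k" by auto
    hence b: "b = 3 * k - a" by simp
    have "n = 3 * (a\<^sup>2 - 3 * a * k + 3 * k\<^sup>2)"
      unfolding assms(1) b by (simp add: power2_eq_square algebra_simps)
    thus False using assms(2) by simp
  qed
  thus ?thesis
  proof (elim disjE)
    assume "3 dvd a"
    then obtain d where "a = 3 * d" by auto
    hence "4 * n = (2 * b - a)\<^sup>2 + 27 * d\<^sup>2"
      unfolding assms(1) by (simp add: power2_eq_square algebra_simps)
    thus ?thesis by (rule that)
  next
    assume "3 dvd b"
    then obtain d where "b = 3 * d" by auto
    hence "4 * n = (2 * a - b)\<^sup>2 + 27 * d\<^sup>2"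
      unfolding assms(1) by (simp add: power2_eq_square algebra_simps)
    thus ?thesis by (rule that)
  next
    assume "3 dvd (a - b)"
    then obtain d where d: "a - b = 3 * d" by auto
    hence a: "a = b + 3 * d" by simp
    have "4 * n = (a + b)\<^sup>2 + 27 * d\<^sup>2"
      unfolding assms(1) a by (simp add: power2_eq_square algebra_simps)
    thus ?thesis by (rule that)
  qed
qed

text \<open>If \<open>4 p = c\<^sup>2 + 27 d\<^sup>2\<close> with \<open>c\<close>, \<open>d\<close> odd, the cube of \<open>(c + d \<surd>(-27)) / 2\<close> lies in
  \<open>\<int>[\<surd>(-27)]\<close>.\<close>

lemma minimal_rep_exponent_le_3:
  assumes p: "prime p" "[p = 1] (mod 3)" and rep: "int p = a\<^sup>2 - a * b + b\<^sup>2"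
    and min: "minimal_rep_exponent p t"
  shows "t \<le> 3"
proof (rule ccontr)
  assume t: "\<not> t \<le> 3"
  have pp: "prime (int p)" using p(1) by simp
  have p7: "int p \<ge> 7" using prime_1_mod_3(1)[OF p] by simp
  have n3: "\<not> 3 dvd int p" using prime_1_mod_3(2)[OF p] by presburger
  obtain c d where cd: "4 * int p = c\<^sup>2 + 27 * d\<^sup>2"
    using eisenstein_norm_rep[OF rep n3] by blast
  \<comment> \<open>Otherwise p^2 divides 4 p, which fails for p >= 7.\<close>
  have not_both: False if "int p dvd c" "int p dvd d"
  proof -
    have "int p * int p dvd c\<^sup>2 + 27 * d\<^sup>2"
      using that by (intro dvd_add dvd_mult) (auto simp: power2_eq_square intro: mult_dvd_mono)
    hence "int p * int p dvd int p * 4" unfolding cd[symmetric] by (simp add: mult.commute)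
    hence "int p dvd 4" using p7 by simp
    hence "int p \<le> 4" by (rule zdvd_imp_le) simp
    thus False using p7 by simp
  qed
  have n27: "\<not> int p dvd 27"
  proof
    assume "int p dvd 27"
    hence "int p dvd 3 ^ 3" by simp
    hence "int p dvd 3" using pp prime_dvd_power by blast
    hence "int p \<le> 3" by (rule zdvd_imp_le) simp
    thus False using p7 by simp
  qed
  have c_d: "int p dvd d" if "int p dvd c"
  proof -
    have "int p dvd 4 * int p - c\<^sup>2" using that by (intro dvd_diff) (auto simp: power2_eq_square)
    hence "int p dvd 27 * d\<^sup>2" unfolding cd by simp
    thus ?thesis using n27 pp prime_dvd_mult_iff prime_dvd_power by blast
  qed
  have nc: "\<not> int p dvd c" using c_d not_both by blast
  have cop: "coprime x (int p)" if "\<not> int p dvd x" for x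
    using that pp by (metis coprime_commute prime_imp_coprime)
  show False
  \<comment> \<open>If c is even then so is d, and division by 4 represents p itself, with exponent
    1. If both are odd, exponent 3 works.\<close>
  proof (cases "even c")
    case True
    have "even (27 * d\<^sup>2)" using True cd by (metis dvd_add_right_iff dvd_mult2 even_numeral even_power zero_less_numeral)
    hence "even d" by simp
    then obtain d' where d': "d = 2 * d'" by auto
    obtain c' where c': "c = 2 * c'" using True by auto
    have "int p ^ 1 = c'\<^sup>2 + 27 * d'\<^sup>2" using cd by (simp add: c' d' power2_eq_square)
    moreover have "\<not> int p dvd c'" using nc unfolding c' by auto
    ultimately have "has_coprime_rep p 1" unfolding has_coprime_rep_def using cop by blast
    thus False using min t by (auto simp: minimal_rep_exponent_def)
  next
    case False
    have "odd d"
    proof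
      assume "even d"
      hence "even (4 * int p - 27 * d\<^sup>2)" by simp
      hence "even (c\<^sup>2)" unfolding cd by simp
      thus False using False by simp
    qed
    have odd_sq: "\<exists>k. x\<^sup>2 = 8 * k + 1" if odd: "odd x" for x :: int
    proof -
      obtain j where j: "x = 2 * j + 1" using odd by (rule oddE)
      have "even (j * (j + 1))" by simp
      then obtain k where "j * (j + 1) = 2 * k" by (rule evenE)
      hence "x\<^sup>2 = 8 * k + 1" by (simp add: j power2_eq_square algebra_simps)
      thus ?thesis by blast
    qed
    obtain j where j: "c\<^sup>2 = 8 * j + 1" using odd_sq[OF False] by blast
    obtain k where k: "d\<^sup>2 = 8 * k + 1" using odd_sq[OF \<open>odd d\<close>] by blast
    \<comment> \<open>The cube has rational part c (c^2 - 81 d^2) / 8 and root coefficient 3 d (c^2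
      - 9 d^2) / 8. Odd squares are 1 modulo 8, so both brackets are divisible by 8; the formulas
      for x and y carry out this division.\<close>
    define x where "x = c * (j - 81 * k - 10)"
    define y where "y = 3 * d * (j - 9 * k - 1)"
    have x8: "8 * x = c * (c\<^sup>2 - 81 * d\<^sup>2)" by (simp add: x_def j k algebra_simps)
    have y8: "8 * y = 3 * d * (c\<^sup>2 - 9 * d\<^sup>2)" by (simp add: y_def j k algebra_simps)
    have "64 * int p ^ 3 = (4 * int p) ^ 3" by (simp add: power3_eq_cube)
    also have "\<dots> = (8 * x)\<^sup>2 + 27 * (8 * y)\<^sup>2"
      unfolding cd x8 y8 by (simp add: power2_eq_square power3_eq_cube algebra_simps)
    also have "\<dots> = 64 * (x\<^sup>2 + 27 * y\<^sup>2)" by (simp add: power2_eq_square)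
    finally have "int p ^ 3 = x\<^sup>2 + 27 * y\<^sup>2" by simp
    moreover have "\<not> int p dvd x"
    proof
      assume "int p dvd x"
      hence "int p dvd 8 * x" by (rule dvd_mult)
      hence "int p dvd c * (c\<^sup>2 - 81 * d\<^sup>2)" unfolding x8 .
      hence "int p dvd c\<^sup>2 - 81 * d\<^sup>2" using nc pp prime_dvd_mult_iff by blast
      \<comment> \<open>Adding three times 4 p = c^2 + 27 d^2 cancels the terms in d and leaves 4
        c^2.\<close>
      hence "int p dvd 3 * (4 * int p) + (c\<^sup>2 - 81 * d\<^sup>2)" by (intro dvd_add) auto
      also have "3 * (4 * int p) + (c\<^sup>2 - 81 * d\<^sup>2) = 4 * c\<^sup>2" unfolding cd by simp
      finally have "int p dvd 4 \<or> int p dvd c\<^sup>2" using pp prime_dvd_mult_iff by blast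
      moreover have "\<not> int p dvd 4"
      proof
        assume "int p dvd 4"
        hence "int p \<le> 4" by (rule zdvd_imp_le) simp
        thus False using p7 by simp
      qed
      ultimately show False using nc pp prime_dvd_power by blast
    qed
    ultimately have "has_coprime_rep p 3" unfolding has_coprime_rep_def using cop by blast
    thus False using min t by (auto simp: minimal_rep_exponent_def)
  qed
qed

text \<open>If 3 divides T^2 then 9 does, so 3 would divide n. Applied with n = p, it keeps the
  denominator T_1^2 - 3 p away from 0.\<close>

lemma square_neq_3_prime:
  assumes "\<not> 3 dvd n"
  shows "T\<^sup>2 \<noteq> 3 * (n::int)"
proof
  assume eq: "T\<^sup>2 = 3 * n"
  hence "3 dvd T\<^sup>2" by simp
  hence "3 dvd T" using prime_dvd_power[of "3::int" T 2] by simp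
  then obtain k where "T = 3 * k" by auto
  hence "n = 3 * k\<^sup>2" using eq by (simp add: power2_eq_square)
  thus False using assms by simp
qed

text \<open>With A and B the complex roots of X^2 - T X + q, both sides are A^(t l) + B^(t
  l).\<close>

lemma tseq_mult: "tseq (q ^ t) (tseq q T t) l = tseq q T (t * l)"
  for q T :: int
proof -
  define A where "A = (complex_of_int T + csqrt (of_int T ^ 2 - 4 * of_int q)) / 2"
  define B where "B = (complex_of_int T - csqrt (of_int T ^ 2 - 4 * of_int q)) / 2"
  have sum: "A + B = of_int T" by (simp add: A_def B_def field_simps)
  have "A * B = (of_int T ^ 2 - csqrt (of_int T ^ 2 - 4 * of_int q) ^ 2) / 4"
    by (simp add: A_def B_def power2_eq_square algebra_simps)
  hence prod: "A * B = of_int q" by simp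
  have pw: "of_int (tseq q T n) = A ^ n + B ^ n" for n
    unfolding tseq_of_int sum[symmetric] prod[symmetric] by (rule tseq_powers)
  have "complex_of_int (tseq (q ^ t) (tseq q T t) l) = tseq (of_int (q ^ t)) (of_int (tseq q T t)) l"
    by (rule tseq_of_int)
  also have "\<dots> = tseq (A ^ t * B ^ t) (A ^ t + B ^ t) l"
    unfolding pw by (simp add: prod[symmetric] power_mult_distrib)
  also have "\<dots> = A ^ (t * l) + B ^ (t * l)" unfolding tseq_powers by (simp add: power_mult)
  also have "\<dots> = of_int (tseq q T (t * l))" by (rule pw[symmetric])
  finally show ?thesis by (simp only: of_int_eq_iff)
qed

section \<open>Rational expressions in the data\<close>

lemma eval3_hom:
  "eval3 (P + Q) x y z = eval3 P x y z + eval3 Q x y z"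
  "eval3 (P - Q) x y z = eval3 P x y z - eval3 Q x y z"
  "eval3 (P * Q) x y z = eval3 P x y z * eval3 Q x y z"
  by (simp_all add: eval3_def)

text \<open>One quotient of integer polynomials has to represent f on all of \<open>D\<close>, which
  is what makes the result uniform in p. The closure rules below spare writing the polynomials
  down.\<close>

definition rat_expr :: "(int \<times> int \<times> int) set \<Rightarrow> (int \<Rightarrow> int \<Rightarrow> int \<Rightarrow> real) \<Rightarrow> bool" where
  "rat_expr D f \<longleftrightarrow> (\<exists>P Q. \<forall>(x, y, z)\<in>D. eval3 Q x y z \<noteq> 0 \<and> f x y z = eval3 P x y z / eval3 Q x y z)"

lemma rat_exprI:
  assumes "\<And>x y z. (x, y, z) \<in> D \<Longrightarrow> eval3 Q x y z \<noteq> 0 \<and> f x y z = eval3 P x y z / eval3 Q x y z"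
  shows "rat_expr D f"
  using assms unfolding rat_expr_def by blast

lemma rat_exprE:
  assumes "rat_expr D f"
  obtains P Q where "\<And>x y z. (x, y, z) \<in> D \<Longrightarrow> eval3 Q x y z \<noteq> 0"
    "\<And>x y z. (x, y, z) \<in> D \<Longrightarrow> f x y z = eval3 P x y z / eval3 Q x y z"
  using assms unfolding rat_expr_def by blast

lemma rat_expr_cong:
  assumes "rat_expr D f" "\<And>x y z. (x, y, z) \<in> D \<Longrightarrow> g x y z = f x y z"
  shows "rat_expr D g"
proof -
  obtain P Q where PQ: "\<And>x y z. (x, y, z) \<in> D \<Longrightarrow> eval3 Q x y z \<noteq> 0"
    "\<And>x y z. (x, y, z) \<in> D \<Longrightarrow> f x y z = eval3 P x y z / eval3 Q x y z"
    using assms(1) by (rule rat_exprE) (rule that)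
  show ?thesis
  proof (rule rat_exprI[where P = P and Q = Q])
    fix x y z assume D: "(x, y, z) \<in> D"
    show "eval3 Q x y z \<noteq> 0 \<and> g x y z = eval3 P x y z / eval3 Q x y z"
      using PQ[OF D] assms(2)[OF D] by simp
  qed
qed

lemma rat_expr_of_int: "rat_expr D (\<lambda>x y z. real_of_int c)"
  by (rule rat_exprI[where P = "[:[:[:c:]:]:]" and Q = 1]) (simp add: eval3_def)

lemma rat_expr_vars:
  "rat_expr D (\<lambda>x y z. real_of_int x)" "rat_expr D (\<lambda>x y z. real_of_int y)" "rat_expr D (\<lambda>x y z. real_of_int z)"
  by (rule rat_exprI[where P = "[:0, 1:]" and Q = 1], simp add: eval3_def,
      rule rat_exprI[where P = "[:[:0, 1:]:]" and Q = 1], simp add: eval3_def,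
      rule rat_exprI[where P = "[:[:[:0, 1:]:]:]" and Q = 1], simp add: eval3_def)

lemma rat_expr_add:
  assumes "rat_expr D f" "rat_expr D g"
  shows "rat_expr D (\<lambda>x y z. f x y z + g x y z)"
  using assms
proof (elim rat_exprE)
  fix P Q P' Q'
  assume "\<And>x y z. (x, y, z) \<in> D \<Longrightarrow> eval3 Q x y z \<noteq> 0" "\<And>x y z. (x, y, z) \<in> D \<Longrightarrow> eval3 Q' x y z \<noteq> 0"
    "\<And>x y z. (x, y, z) \<in> D \<Longrightarrow> f x y z = eval3 P x y z / eval3 Q x y z"
    "\<And>x y z. (x, y, z) \<in> D \<Longrightarrow> g x y z = eval3 P' x y z / eval3 Q' x y z"
  thus ?thesis
    by (intro rat_exprI[where P = "P * Q' + P' * Q" and Q = "Q * Q'"]) (simp add: eval3_hom add_frac_eq)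
qed

lemma rat_expr_mult:
  assumes "rat_expr D f" "rat_expr D g"
  shows "rat_expr D (\<lambda>x y z. f x y z * g x y z)"
  using assms
proof (elim rat_exprE)
  fix P Q P' Q'
  assume "\<And>x y z. (x, y, z) \<in> D \<Longrightarrow> eval3 Q x y z \<noteq> 0" "\<And>x y z. (x, y, z) \<in> D \<Longrightarrow> eval3 Q' x y z \<noteq> 0"
    "\<And>x y z. (x, y, z) \<in> D \<Longrightarrow> f x y z = eval3 P x y z / eval3 Q x y z"
    "\<And>x y z. (x, y, z) \<in> D \<Longrightarrow> g x y z = eval3 P' x y z / eval3 Q' x y z"
  thus ?thesis
    by (intro rat_exprI[where P = "P * P'" and Q = "Q * Q'"]) (simp add: eval3_hom)
qed

lemma rat_expr_diff:
  assumes "rat_expr D f" "rat_expr D g"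
  shows "rat_expr D (\<lambda>x y z. f x y z - g x y z)"
  using rat_expr_add[OF assms(1) rat_expr_mult[OF rat_expr_of_int[of D "-1"] assms(2)]] by simp

lemma rat_expr_divide:
  assumes "rat_expr D f" "rat_expr D g" and nz: "\<And>x y z. (x, y, z) \<in> D \<Longrightarrow> g x y z \<noteq> 0"
  shows "rat_expr D (\<lambda>x y z. f x y z / g x y z)"
  using assms(1,2)
proof (elim rat_exprE)
  fix P Q P' Q'
  assume h: "\<And>x y z. (x, y, z) \<in> D \<Longrightarrow> eval3 Q x y z \<noteq> 0" "\<And>x y z. (x, y, z) \<in> D \<Longrightarrow> eval3 Q' x y z \<noteq> 0"
    "\<And>x y z. (x, y, z) \<in> D \<Longrightarrow> f x y z = eval3 P x y z / eval3 Q x y z"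
    "\<And>x y z. (x, y, z) \<in> D \<Longrightarrow> g x y z = eval3 P' x y z / eval3 Q' x y z"
  show ?thesis
  proof (rule rat_exprI[where P = "P * Q'" and Q = "Q * P'"])
    fix x y z assume D: "(x, y, z) \<in> D"
    show "eval3 (Q * P') x y z \<noteq> 0 \<and> f x y z / g x y z = eval3 (P * Q') x y z / eval3 (Q * P') x y z"
      using h[OF D] nz[OF D] by (auto simp: eval3_hom)
  qed
qed

lemma rat_expr_power: "rat_expr D f \<Longrightarrow> rat_expr D (\<lambda>x y z. f x y z ^ n)"
proof (induction n)
  case 0
  show ?case using rat_expr_of_int[of D 1] by simp
qed (simp add: rat_expr_mult)

lemma rat_expr_tseq:
  assumes "rat_expr D f" "rat_expr D g"
  shows "rat_expr D (\<lambda>x y z. tseq (f x y z) (g x y z) n)"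
proof (induction n rule: induct_nat_012)
  case 0
  show ?case using rat_expr_of_int[of D 2] by simp
next
  case 1
  show ?case using assms(2) by simp
next
  case (ge2 n)
  show ?case unfolding tseq.simps by (intro rat_expr_diff rat_expr_mult assms ge2)
qed

text \<open>The triples \<open>(p, K\<^sub>3(\<Gamma>(3, p\<^sup>t)), K\<^sub>3(\<Gamma>(3, p\<^sup>s)))\<close>; the last entry carries no
  information for \<open>s = 0\<close>.\<close>

definition data :: "nat \<Rightarrow> nat \<Rightarrow> (int \<times> int \<times> int) set" where
  "data t s = {(x, y, z). x \<ge> 2 \<and> (jtrace (nat x))\<^sup>2 \<noteq> 3 * x \<and>
     162 * y = x ^ t * (x ^ t - 1) * (x ^ t - 8 - tseq x (jtrace (nat x)) t) \<and>
     (s \<ge> 1 \<longrightarrow> 162 * z = x ^ s * (x ^ s - 1) * (x ^ s - 8 - tseq x (jtrace (nat x)) s))}"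

text \<open>The triangle formula is linear in the trace and is solved for it: T_k = x^k - 8 - 162 v
  / (x^k (x^k - 1)). The function v stands for either of the two given clique numbers.\<close>

lemma rat_expr_trace:
  assumes k: "k \<ge> 1" and v: "rat_expr D (\<lambda>x y z. real_of_int (v x y z))"
    and D: "\<And>x y z. (x, y, z) \<in> D \<Longrightarrow> x \<ge> 2 \<and>
      162 * v x y z = x ^ k * (x ^ k - 1) * (x ^ k - 8 - tseq x (jtrace (nat x)) k)"
  shows "rat_expr D (\<lambda>x y z. real_of_int (tseq x (jtrace (nat x)) k))"
proof -
  have nz: "real_of_int x ^ k * (real_of_int x ^ k - 1) \<noteq> 0" if "(x, y, z) \<in> D" for x y z
  proof -
    have "real_of_int x > 1" using D[OF that] by simp
    hence "real_of_int x ^ k > 1" using k by (intro one_less_power) auto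
    hence "real_of_int x ^ k \<noteq> 0" "real_of_int x ^ k - 1 \<noteq> 0" by linarith+
    thus ?thesis by (rule no_zero_divisors)
  qed
  have "rat_expr D (\<lambda>x y z. real_of_int x ^ k - real_of_int 8 - real_of_int 162 * real_of_int (v x y z) / (real_of_int x ^ k * (real_of_int x ^ k - real_of_int 1)))"
    by (intro rat_expr_diff rat_expr_divide rat_expr_mult rat_expr_power rat_expr_vars rat_expr_of_int v)
      (unfold of_int_1, rule nz)
  thus ?thesis
  proof (rule rat_expr_cong)
    fix x y z assume xyz: "(x, y, z) \<in> D"
    have "162 * v x y z = x ^ k * (x ^ k - 1) * (x ^ k - 8 - tseq x (jtrace (nat x)) k)"
      using D[OF xyz] by (rule conjunct2)
    also have "\<dots> = (x ^ k - 8 - tseq x (jtrace (nat x)) k) * (x ^ k * (x ^ k - 1))" by (rule mult.commute)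
    finally have "real_of_int (162 * v x y z)
        = real_of_int ((x ^ k - 8 - tseq x (jtrace (nat x)) k) * (x ^ k * (x ^ k - 1)))" by (rule arg_cong)
    hence "real_of_int 162 * real_of_int (v x y z)
        = (real_of_int x ^ k - 8 - real_of_int (tseq x (jtrace (nat x)) k)) * (real_of_int x ^ k * (real_of_int x ^ k - real_of_int 1))"
      by (simp only: of_int_mult of_int_diff of_int_power of_int_numeral of_int_1)
    hence "real_of_int 162 * real_of_int (v x y z) / (real_of_int x ^ k * (real_of_int x ^ k - real_of_int 1))
        = real_of_int x ^ k - 8 - real_of_int (tseq x (jtrace (nat x)) k)"
      unfolding of_int_1 nonzero_divide_eq_eq[OF nz[OF xyz]] .
    thus "real_of_int (tseq x (jtrace (nat x)) k) =
      real_of_int x ^ k - real_of_int 8 - real_of_int 162 * real_of_int (v x y z) / (real_of_int x ^ k * (real_of_int x ^ k - real_of_int 1))"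
      by linarith
  qed
qed

lemma dataD:
  assumes "(x, y, z) \<in> data t s"
  shows "x \<ge> 2 \<and> 162 * y = x ^ t * (x ^ t - 1) * (x ^ t - 8 - tseq x (jtrace (nat x)) t)"
    and "s \<ge> 1 \<Longrightarrow> x \<ge> 2 \<and> 162 * z = x ^ s * (x ^ s - 1) * (x ^ s - 8 - tseq x (jtrace (nat x)) s)"
    and "(jtrace (nat x))\<^sup>2 \<noteq> 3 * x"
  using assms unfolding data_def by blast+

text \<open>For s > 0 it is enough to recover T_1, since the recurrence then gives every trace. For
  s = 0 only T_t is at hand, and the index t l is a multiple of t.\<close>

lemma rat_expr_target:
  assumes t: "t \<ge> 1" "t \<le> 3" and s: "s < t"
  shows "rat_expr (data t s) (\<lambda>x y z. real_of_int (x ^ (t * l + s) * (x ^ (t * l + s) - 1) *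
      (x ^ (t * l + s) - 8 - tseq x (jtrace (nat x)) (t * l + s))) / real_of_int 162)"
proof -
  let ?D = "data t s" and ?T = "\<lambda>x. jtrace (nat x)"
  have Tt: "rat_expr ?D (\<lambda>x y z. real_of_int (tseq x (?T x) t))"
    by (rule rat_expr_trace[OF t(1) rat_expr_vars(2)]) (rule dataD(1))
  have Ts: "rat_expr ?D (\<lambda>x y z. real_of_int (tseq x (?T x) s))" if "s \<ge> 1"
    by (rule rat_expr_trace[OF that rat_expr_vars(3)]) (rule dataD(2)[OF _ that])
  have "rat_expr ?D (\<lambda>x y z. real_of_int (tseq x (?T x) (t * l + s)))"
  proof (cases "s = 0")
    case True
    have "rat_expr ?D (\<lambda>x y z. tseq (real_of_int x ^ t) (real_of_int (tseq x (?T x) t)) l)"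
      by (intro rat_expr_tseq rat_expr_power rat_expr_vars Tt)
    thus ?thesis
    proof (rule rat_expr_cong)
      fix x y z
      have "real_of_int (tseq x (?T x) (t * l + s)) = real_of_int (tseq (x ^ t) (tseq x (?T x) t) l)"
        by (simp only: True tseq_mult add_0_right)
      also have "\<dots> = tseq (real_of_int (x ^ t)) (real_of_int (tseq x (?T x) t)) l" by (rule tseq_of_int)
      finally show "real_of_int (tseq x (?T x) (t * l + s)) = tseq (real_of_int x ^ t) (real_of_int (tseq x (?T x) t)) l"
        by (simp only: of_int_power)
    qed
  next
    case False
    have "rat_expr ?D (\<lambda>x y z. real_of_int (?T x))"
    proof (cases "s = 1")
      case True
      hence "rat_expr ?D (\<lambda>x y z. real_of_int (tseq x (?T x) s))" by (intro Ts) simp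
      thus ?thesis unfolding True by simp
    next
      case False
      hence st: "s = 2" "t = 3" using \<open>s \<noteq> 0\<close> t s by auto
      \<comment> \<open>T_2 = T_1^2 - 2 x, so this difference is T_1^2 - 3 x.\<close>
      have nz: "real_of_int (tseq x (?T x) 2) - real_of_int x \<noteq> 0" if "(x, y, z) \<in> ?D" for x y z
      proof -
        have "(?T x)\<^sup>2 \<noteq> 3 * x" using that by (rule dataD(3))
        hence "tseq x (?T x) 2 \<noteq> x" by (simp add: numeral_2_eq_2)
        thus ?thesis by simp
      qed
      have "1 \<le> s" using st by simp
      hence T2: "rat_expr ?D (\<lambda>x y z. real_of_int (tseq x (?T x) 2))"
        using Ts unfolding st(1) by blast
      have T3: "rat_expr ?D (\<lambda>x y z. real_of_int (tseq x (?T x) 3))"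
        using Tt unfolding st(2) by blast
      have "rat_expr ?D (\<lambda>x y z. real_of_int (tseq x (?T x) 3) / (real_of_int (tseq x (?T x) 2) - real_of_int x))"
        by (intro rat_expr_divide rat_expr_diff T2 T3 rat_expr_vars nz)
      thus ?thesis
      proof (rule rat_expr_cong)
        fix x y z assume "(x, y, z) \<in> ?D"
        note nz = nz[OF this]
        \<comment> \<open>The recurrence T_3 = T_1 T_2 - x T_1 with T_1 factored out.\<close>
        have "tseq x (?T x) 3 = ?T x * (tseq x (?T x) 2 - x)"
          by (simp add: numeral_2_eq_2 numeral_3_eq_3 algebra_simps)
        hence "real_of_int (tseq x (?T x) 3) = real_of_int (?T x) * (real_of_int (tseq x (?T x) 2) - real_of_int x)" by simp
        thus "real_of_int (?T x) = real_of_int (tseq x (?T x) 3) / (real_of_int (tseq x (?T x) 2) - real_of_int x)"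
          unfolding nonzero_eq_divide_eq[OF nz] by (rule sym)
      qed
    qed
    from rat_expr_tseq[OF rat_expr_vars(1) this]
    have "rat_expr ?D (\<lambda>x y z. tseq (real_of_int x) (real_of_int (?T x)) (t * l + s))" .
    thus ?thesis by (simp only: tseq_of_int)
  qed
  note T = this
  have "rat_expr ?D (\<lambda>x y z. real_of_int x ^ (t * l + s) * (real_of_int x ^ (t * l + s) - real_of_int 1) *
      (real_of_int x ^ (t * l + s) - real_of_int 8 - real_of_int (tseq x (?T x) (t * l + s))) / real_of_int 162)"
    by (intro rat_expr_divide rat_expr_mult rat_expr_diff rat_expr_power rat_expr_vars rat_expr_of_int T) simp
  thus ?thesis by simp
qed

text \<open>The set \<open>data t s\<close> holds the data of all admissible primes at once, so
  polynomials valid on it can be chosen from t, s and l before any prime is fixed.\<close>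

theorem theorem3p3:
  shows "\<exists>N D :: nat \<Rightarrow> nat \<Rightarrow> nat \<Rightarrow> int poly poly poly.
    \<forall>p t. prime p \<and> [p = 1] (mod 3) \<and> minimal_rep_exponent p t \<longrightarrow>
      (\<forall>l s. l \<ge> 1 \<and> s < t \<longrightarrow>
        (\<forall>(Ft :: 'a ring) (Fs :: 'b ring) (F :: 'c ring).
           is_GF (p ^ t) Ft \<and> is_GF (p ^ s) Fs \<and> is_GF (p ^ (t * l + s)) F \<longrightarrow>
           given_by_rational_expr (N t s l) (D t s l)
             p (num_cliques 3 (gen_paley_graph 3 Ft)) (num_cliques 3 (gen_paley_graph 3 Fs))
             (num_cliques 3 (gen_paley_graph 3 F))))"
proof -
  define g :: "nat \<Rightarrow> nat \<Rightarrow> nat \<Rightarrow> int \<Rightarrow> real"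
    where "g t s l x = real_of_int (x ^ (t * l + s) * (x ^ (t * l + s) - 1) *
      (x ^ (t * l + s) - 8 - tseq x (jtrace (nat x)) (t * l + s))) / real_of_int 162" for t s l x
  define ok where "ok t s l P Q \<longleftrightarrow> (\<forall>(x, y, z)\<in>data t s. eval3 Q x y z \<noteq> 0 \<and>
      g t s l x = eval3 P x y z / eval3 Q x y z)" for t s l P Q
  \<comment> \<open>\<open>N\<close> is picked among the numerators that admit a denominator, and
    \<open>D\<close> is then picked to match it. For t > 3 the choices are arbitrary, but no minimal
    exponent is that large.\<close>
  define N where "N t s l = (SOME P. \<exists>Q. ok t s l P Q)" for t s l
  define D where "D t s l = (SOME Q. ok t s l (N t s l) Q)" for t s l
  have ok: "ok t s l (N t s l) (D t s l)" if "1 \<le> t" "t \<le> 3" "s < t" for t s l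
  proof -
    have "\<exists>P Q. ok t s l P Q"
      using rat_expr_target[OF that, of l] unfolding rat_expr_def ok_def g_def .
    hence "\<exists>Q. ok t s l (N t s l) Q" unfolding N_def by (rule someI_ex)
    thus ?thesis unfolding D_def by (rule someI_ex)
  qed
  show ?thesis
  proof (rule exI[of _ N], rule exI[of _ D], intro allI impI, elim conjE)
    fix p t l s and Ft :: "'a ring" and Fs :: "'b ring" and F :: "'c ring"
    assume p: "prime p" "[p = 1] (mod 3)" and min: "minimal_rep_exponent p t"
      and ls: "1 \<le> l" "s < t"
      and GF: "is_GF (p ^ t) Ft" "is_GF (p ^ s) Fs" "is_GF (p ^ (t * l + s)) F"
    have t1: "t \<ge> 1" using min by (simp add: minimal_rep_exponent_def)
    \<comment> \<open>A positive exponent ensures that \<open>F\<close> is a field and not the zero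
      ring.\<close>
    have "1 * 1 \<le> t * l" by (rule mult_le_mono[OF t1 ls(1)])
    hence "1 \<le> t * l + s" by linarith
    then interpret F: GF3 F p "t * l + s" by (rule is_GF_GF3[OF p GF(3)])
    interpret Ft: GF3 Ft p t by (rule is_GF_GF3[OF p GF(1) t1])
    \<comment> \<open>The Jacobi sum over the prime field of \<open>F\<close> shows that p is a norm
      from Z[omega], which bounds t.\<close>
    obtain a b where "int p = a\<^sup>2 - a * b + b\<^sup>2" using F.jtrace_rep by blast
    hence t3: "t \<le> 3" by (rule minimal_rep_exponent_le_3[OF p _ min])
    have "\<not> 3 dvd int p" using prime_1_mod_3(2)[OF p] by presburger
    hence sq: "(jtrace p)\<^sup>2 \<noteq> 3 * int p" by (rule square_neq_3_prime)
    \<comment> \<open>For s = 0 the ring \<open>Fs\<close> is the zero ring, where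
      \<open>GF3\<close> does not apply; accordingly \<open>data\<close> restricts its third entry
      only for s >= 1.\<close>
    have Fs: "162 * int (num_cliques 3 (gen_paley_graph 3 Fs)) =
        int p ^ s * (int p ^ s - 1) * (int p ^ s - 8 - tseq (int p) (jtrace p) s)" if "s \<ge> 1"
      using GF3.num_triangles_formula[OF is_GF_GF3[OF p GF(2) that]] .
    have "(int p, int (num_cliques 3 (gen_paley_graph 3 Ft)), int (num_cliques 3 (gen_paley_graph 3 Fs))) \<in> data t s"
      unfolding data_def using Ft.num_triangles_formula Fs sq prime_1_mod_3(1)[OF p] by simp
    hence ND: "eval3 (D t s l) (int p) (int (num_cliques 3 (gen_paley_graph 3 Ft))) (int (num_cliques 3 (gen_paley_graph 3 Fs))) \<noteq> 0 \<and>
      g t s l (int p) = eval3 (N t s l) (int p) (int (num_cliques 3 (gen_paley_graph 3 Ft))) (int (num_cliques 3 (gen_paley_graph 3 Fs)))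
        / eval3 (D t s l) (int p) (int (num_cliques 3 (gen_paley_graph 3 Ft))) (int (num_cliques 3 (gen_paley_graph 3 Fs)))"
      using ok[OF t1 t3 ls(2), of l] unfolding ok_def by blast
    have "g t s l (int p) = real_of_int (162 * int (num_cliques 3 (gen_paley_graph 3 F))) / real_of_int 162"
      unfolding g_def F.num_triangles_formula by simp
    hence "g t s l (int p) = real (num_cliques 3 (gen_paley_graph 3 F))" by simp
    thus "given_by_rational_expr (N t s l) (D t s l)
       p (num_cliques 3 (gen_paley_graph 3 Ft)) (num_cliques 3 (gen_paley_graph 3 Fs))
       (num_cliques 3 (gen_paley_graph 3 F))"
      unfolding given_by_rational_expr_def using ND by simp
  qed
qed

end
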